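(* Let $d\ge1$, $N\ge2$ be integers and let $B\in\mathcal{M}_{d\times d}(\mathbb{R})$ be non-singular. (a) If $s\in[0,1)$, then for all $\alpha\in(0,1)$ and all $N$ such that $N\ge\frac{16(d+2)^2}{\alpha(1-s)^2}$, $$\mathcal{E}_2(\mathcal{C}_s)\ge\frac{d^2\left(1-(s+1)^2/4\right)}{(1+\alpha)N}.$$ (b) If $s>1$, then for all $\alpha\in(0,1)$ and all $N$ such that $N\ge\log_2\left(\frac{d+2}{\alpha}\right)+3$, $$\mathcal{E}_2(\mathcal{C}_s)\ge\frac{d^2\left((s+1)^2-1\right)^2}{(1+\alpha)(s+1)^{2N}}.$$ (c) If $s=1$, $$\mathcal{E}_2(\mathcal{C}_1)\ge\frac{\log^2(d+2)}{3N^2(1+2/d)^2}.$$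
   Context: Model: for $A\in\mathcal{M}_{d\times d}(\mathbb{R})$, $x_0=0$ and $x_{i+1}=Ax_i+B\varepsilon_i$ for $0\le i\le N-1$, where $\varepsilon_0,\dots,\varepsilon_{N-1}$ are i.i.d. $\mathcal{N}(0,I_d)$; $\mathbb{E}_A$ is expectation under the law of $(x_1,\dots,x_N)$ with parameter $A$. $\mathcal{C}_s=\{A\in\mathcal{M}_{d\times d}(\mathbb{R}): s_{\min}(A)\ge s\}$, with $s_{\min}(A)$ the smallest singular value of $A$. Mean square risk: $\mathcal{E}_2(\hat A,A)=\mathbb{E}_A|\hat A-A|_{S_2}^2$ with $|W|_{S_2}=(\operatorname{tr}(W^*W))^{1/2}$. Minimax risk: $\mathcal{E}_2(\mathcal{C}_s)=\inf_{\hat A}\sup_{A\in\mathcal{C}_s}\mathcal{E}_2(\hat A,A)$, the infimum being over all $\mathcal{M}_{d\times d}(\mathbb{R})$-valued measurable functions $\hat A$ of $(x_1,\dots,x_N)$. *)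

theory Defs
  imports "HOL-Probability.Probability"
begin

definition singular_values :: "real^'n^'n \<Rightarrow> real set" where
  "singular_values A = {sqrt \<mu> | \<mu>. \<exists>v. v \<noteq> 0 \<and> (transpose A ** A) *v v = \<mu> *\<^sub>R v}"

(* The set of singular values is finite and nonempty, so Min is the actual minimum. *)
definition s_min :: "real^'n^'n \<Rightarrow> real" where
  "s_min A = Min (singular_values A)"

definition class_C :: "real \<Rightarrow> (real^'n^'n) set" where
  "class_C s = {A. s_min A \<ge> s}"

definition S2_norm :: "real^'n^'n \<Rightarrow> real" where
  "S2_norm W = sqrt (trace (transpose W ** W))"

definition std_gaussian :: "(real^'n) measure" where
  "std_gaussian = density lborel (\<lambda>x. ennreal (\<Prod>i\<in>UNIV. std_normal_density (x $ i)))"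

primrec state :: "real^'n^'n \<Rightarrow> real^'n^'n \<Rightarrow> (nat \<Rightarrow> real^'n) \<Rightarrow> nat \<Rightarrow> real^'n" where
  "state A B \<epsilon> 0 = 0"
| "state A B \<epsilon> (Suc i) = A *v state A B \<epsilon> i + B *v \<epsilon> i"

definition noise :: "nat \<Rightarrow> (nat \<Rightarrow> real^'n) measure" where
  "noise N = PiM {0..<N} (\<lambda>_. std_gaussian)"

abbreviation obs_space :: "nat \<Rightarrow> (nat \<Rightarrow> real^'n) measure" where
  "obs_space N \<equiv> PiM {1..N} (\<lambda>_. borel)"

definition traj_law :: "real^'n^'n \<Rightarrow> nat \<Rightarrow> real^'n^'n \<Rightarrow> (nat \<Rightarrow> real^'n) measure" where
  "traj_law B N A = distr (noise N) (obs_space N) (\<lambda>\<epsilon>. restrict (state A B \<epsilon>) {1..N})"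

(* Risks are valued in ennreal, since the mean square risk of an estimator may be infinite. *)
definition risk2 ::
  "real^'n^'n \<Rightarrow> nat \<Rightarrow> ((nat \<Rightarrow> real^'n) \<Rightarrow> real^'n^'n) \<Rightarrow> real^'n^'n \<Rightarrow> ennreal" where
  "risk2 B N Ahat A = (\<integral>\<^sup>+ x. ennreal ((S2_norm (Ahat x - A))\<^sup>2) \<partial>traj_law B N A)"

definition minimax_risk2 :: "real^'n^'n \<Rightarrow> nat \<Rightarrow> (real^'n^'n) set \<Rightarrow> ennreal" where
  "minimax_risk2 B N C = (INF Ahat \<in> borel_measurable (obs_space N). SUP A \<in> C. risk2 B N Ahat A)"

end

theory Submission
  imports Defs
begin

text \<open>
  The lower bounds are Bayesian. Let \<open>B = U \<Sigma> V\<^sup>T\<close> be a singular value decomposition and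
  \<open>y\<^sub>i = B\<inverse> x\<^sub>i\<close>, so that \<open>y\<^sub>i\<^sub>+\<^sub>1 = M y\<^sub>i + \<epsilon>\<^sub>i\<close> with \<open>M = B\<inverse> A B\<close>. The law of the
  trajectory has an explicit Gaussian likelihood ratio with respect to the law for \<open>A = 0\<close>, and its
  Fisher information in the direction \<open>C\<close> (a direction for \<open>M\<close>) is \<open>\<Sum>\<^sub>i \<Sum>\<^sub>l\<^sub><\<^sub>i |C M\<^sup>l|\<^sup>2\<close>. For a smooth
  prior on a linear family of matrices, the van Trees inequality applied to each coordinate
  separately bounds the supremum of the risk from below by \<open>\<Sum>\<^sub>b a\<^sub>b / V\<^sub>b\<close>, where \<open>V\<^sub>b\<close> is the mean
  information of the coordinate \<open>b\<close> plus the information of the prior.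

  For \<open>s \<noteq> 1\<close> the prior lives on \<open>A = r I + R U (a \<circ> z) U\<^sup>T\<close>, where \<open>z\<close> has density proportional to
  \<open>(1 - |z|\<^sup>2)\<^sup>d\<^sup>+\<^sup>2\<close> on the unit Frobenius ball and \<open>a j k = min 1 (\<sigma> j / \<sigma> k)\<close>; the bound for \<open>d\<^sup>2\<close>
  coordinates results from adding those of the entries \<open>(j, k)\<close> and \<open>(k, j)\<close>. For \<open>s = 1\<close> the prior
  lives on \<open>A = U diag (1 + z\<^sub>j / N) U\<^sup>T\<close>, the \<open>z\<^sub>j\<close> being independent with density proportional to
  \<open>t\<^sup>2 (3 - t)\<^sup>2\<close> on \<open>[0, 3]\<close>.
\<close>

section \<open>Gaussian measure\<close>

text \<open>The bounds contain no condition number of \<open>B\<close>, although \<open>B\<close> is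
  an arbitrary non-singular matrix. The loss lives in the coordinates of \<open>A\<close>, the
  information in those of \<open>B\<inverse> A B\<close>, and conjugation by \<open>B\<close>
  stretches the entry \<open>(j, k)\<close> by the ratio of two singular values. One entry alone can
  therefore miss its share of the bound, while the transposed entry has an excess that pays for it.
  A diagonal family is not stretched at all. The prior is placed by its two extreme moduli: from
  \<open>s\<close> to \<open>(s + 1) / 2\<close> if \<open>s < 1\<close>, from \<open>s\<close> to
  \<open>s + 1\<close> if \<open>s > 1\<close>. The lower end keeps it inside the class; the upper
  end bounds the growth of the trajectory and is what appears in the result. The conditions on
  \<open>N\<close> make the information of the prior at most a fraction \<alpha> of the bound
  \<open>n\<close> on that of the data. For \<open>s = 1\<close> the scale of the prior is tied to
  \<open>1 / N\<close>, and data and prior have information of the same order in \<open>N\<close>.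
  On the ball the latter also grows like \<open>d\<^sup>2\<close>, whereas a product prior keeps it
  constant for each coordinate. This gives a bound of order \<open>d / N\<^sup>2\<close>, of which
  the logarithmic one is a weakening.\<close>

lemma prod_Basis_vec:
  fixes f :: "real^'n \<Rightarrow> 'a::comm_monoid_mult"
  shows "(\<Prod>b\<in>Basis. f b) = (\<Prod>i\<in>UNIV. f (axis i 1))"
proof -
  have eq: "(Basis :: (real^'n) set) = (\<lambda>i. axis i 1) ` UNIV" by (auto simp: Basis_vec_def)
  have "inj (\<lambda>i::'n. axis i (1::real))" by (auto simp: inj_def axis_eq_axis)
  then show ?thesis unfolding eq by (subst prod.reindex) auto
qed

text \<open>\<open>lborel_eq\<close> presents Lebesgue measure as the image of a product of
  one-dimensional ones, so functions of single coordinates integrate factor by factor.\<close>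

lemma lborel_integral_prod_Basis:
  fixes f :: "'e::euclidean_space \<Rightarrow> real \<Rightarrow> real"
  assumes "\<And>b. b \<in> Basis \<Longrightarrow> integrable lborel (f b)"
  shows "integrable lborel (\<lambda>x::'e. \<Prod>b\<in>Basis. f b (x \<bullet> b))"
    and "(\<integral>x. (\<Prod>b\<in>Basis. f b (x \<bullet> b)) \<partial>(lborel :: 'e measure)) = (\<Prod>b\<in>Basis. \<integral>t. f b t \<partial>lborel)"
proof -
  interpret product_sigma_finite "\<lambda>_::'e. lborel :: real measure" by standard
  have [measurable]: "\<And>b. b \<in> Basis \<Longrightarrow> f b \<in> borel_measurable borel"
    using assms borel_measurable_integrable by fastforce
  have *: "(\<Prod>b\<in>Basis. f b ((\<Sum>c\<in>Basis. g c *\<^sub>R c) \<bullet> b)) = (\<Prod>b\<in>Basis. f b (g b))" for g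
    by simp
  have m: "(\<lambda>f. \<Sum>b\<in>Basis. f b *\<^sub>R b) \<in> (\<Pi>\<^sub>M b\<in>(Basis::'e set). lborel) \<rightarrow>\<^sub>M borel"
    by measurable
  have m2: "(\<lambda>x::'e. \<Prod>b\<in>Basis. f b (x \<bullet> b)) \<in> borel_measurable borel"
    by measurable
  have i: "integrable (\<Pi>\<^sub>M b\<in>(Basis::'e set). lborel) (\<lambda>g. \<Prod>b\<in>Basis. f b (g b))"
    by (rule product_integrable_prod) (use assms in auto)
  show "integrable lborel (\<lambda>x::'e. \<Prod>b\<in>Basis. f b (x \<bullet> b))"
    unfolding lborel_eq[where 'a='e] using i by (subst integrable_distr_eq[OF m m2]) simp
  show "(\<integral>x. (\<Prod>b\<in>Basis. f b (x \<bullet> b)) \<partial>(lborel :: 'e measure)) = (\<Prod>b\<in>Basis. \<integral>t. f b t \<partial>lborel)"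
    unfolding lborel_eq[where 'a='e] using assms
    by (subst integral_distr[OF m m2]) (simp add: product_integral_prod)
qed

definition gdens :: "real^'n \<Rightarrow> real" where
  "gdens x = (\<Prod>i\<in>UNIV. std_normal_density (x $ i))"

lemma gdens_nonneg: "0 \<le> gdens x"
  by (auto simp: gdens_def intro!: prod_nonneg)

lemma gdens_measurable[measurable]: "gdens \<in> borel_measurable borel"
  unfolding gdens_def[abs_def] by measurable

lemma nn_integral_std_gaussian:
  assumes [measurable]: "f \<in> borel_measurable borel"
  shows "(\<integral>\<^sup>+x. f x \<partial>std_gaussian) = (\<integral>\<^sup>+x. ennreal (gdens x) * f x \<partial>lborel)"
  unfolding std_gaussian_def gdens_def[symmetric]
  by (subst nn_integral_density) auto

lemma sets_std_gaussian[measurable_cong, simp]: "sets std_gaussian = sets borel"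
  by (simp add: std_gaussian_def)

lemma space_std_gaussian[simp]: "space std_gaussian = UNIV"
  by (simp add: std_gaussian_def)

lemma gdens_moments:
  fixes k :: "'n::finite \<Rightarrow> nat"
  shows "integrable lborel (\<lambda>x::real^'n. gdens x * (\<Prod>i\<in>UNIV. x $ i ^ k i))"
    and "(\<integral>x. gdens x * (\<Prod>i\<in>UNIV. x $ i ^ k i) \<partial>(lborel :: (real^'n) measure))
           = (\<Prod>i\<in>UNIV. \<integral>t. std_normal_density t * t ^ k i \<partial>lborel)"
proof -
  \<comment> \<open>The exponents are indexed by \<open>'n\<close> but the product runs over
    \<open>Basis\<close>; \<open>THE\<close> recovers the index from the basis vector.\<close>
  define f where "f b t = std_normal_density t * t ^ k (THE i. b = axis i 1)" for b :: "real^'n" and t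
  have fa: "f (axis i 1) t = std_normal_density t * t ^ k i" for i t
    unfolding f_def by (simp add: axis_eq_axis)
  then have fa': "f (axis i 1) = (\<lambda>t. std_normal_density t * t ^ k i)" for i
    by auto
  have int: "integrable lborel (f b)" for b
    using integrable_normal_moment[of 1 0] by (simp add: f_def[abs_def])
  have eq: "gdens x * (\<Prod>i\<in>UNIV. x $ i ^ k i) = (\<Prod>b\<in>Basis. f b (x \<bullet> b))" for x :: "real^'n"
    by (simp add: prod_Basis_vec fa gdens_def prod.distrib inner_axis)
  show "integrable lborel (\<lambda>x::real^'n. gdens x * (\<Prod>i\<in>UNIV. x $ i ^ k i))"
    unfolding eq by (rule lborel_integral_prod_Basis) (rule int)
  show "(\<integral>x. gdens x * (\<Prod>i\<in>UNIV. x $ i ^ k i) \<partial>(lborel :: (real^'n) measure))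
           = (\<Prod>i\<in>UNIV. \<integral>t. std_normal_density t * t ^ k i \<partial>lborel)"
    unfolding eq by (subst lborel_integral_prod_Basis(2)) (auto simp: int prod_Basis_vec fa')
qed

lemma std_normal_moments:
  "(\<integral>t. std_normal_density t * t ^ 0 \<partial>lborel) = 1"
  "(\<integral>t. std_normal_density t * t ^ 1 \<partial>lborel) = 0"
  "(\<integral>t. std_normal_density t * t ^ 2 \<partial>lborel) = 1"
  using integral_normal_moment_even[of 1 0 0] integral_normal_moment_odd[of 1 0 0]
    integral_normal_moment_even[of 1 0 1] by simp_all

lemma gdens_moment_1:
  shows "integrable lborel (\<lambda>x::real^'n. gdens x)" "(\<integral>x. gdens x \<partial>(lborel :: (real^'n) measure)) = 1"
  using gdens_moments[where 'n='n, of "\<lambda>_. 0"] std_normal_moments by simp_all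

lemma gdens_moment_x:
  shows "integrable lborel (\<lambda>x::real^'n. gdens x * x $ i)"
    and "(\<integral>x. gdens x * x $ i \<partial>(lborel :: (real^'n) measure)) = 0"
proof -
  have *: "(\<Prod>j\<in>UNIV. x $ j ^ (if j = i then 1 else 0)) = x $ i" for x :: "real^'n"
    by (subst prod.remove[of _ i]) auto
  show "integrable lborel (\<lambda>x::real^'n. gdens x * x $ i)"
    and "(\<integral>x. gdens x * x $ i \<partial>(lborel :: (real^'n) measure)) = 0"
    using gdens_moments[where 'n='n, of "\<lambda>j. if j = i then 1 else 0"] std_normal_moments
    unfolding * by (auto simp: prod.remove[of UNIV i])
qed

lemma gdens_moment_xx:
  shows "integrable lborel (\<lambda>x::real^'n. gdens x * (x $ i * x $ j))"
    and "(\<integral>x. gdens x * (x $ i * x $ j) \<partial>(lborel :: (real^'n) measure)) = (if i = j then 1 else 0)"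
proof -
  define k where "k l = (if l = i then 1 else 0) + (if l = j then 1 else (0::nat))" for l
  have *: "(\<Prod>l\<in>UNIV. x $ l ^ k l) = x $ i * x $ j" for x :: "real^'n"
    by (simp add: k_def power_add prod.distrib) (simp add: if_distrib cong: if_cong)
  have **: "(\<Prod>l\<in>UNIV. \<integral>t. std_normal_density t * t ^ k l \<partial>lborel) = (if i = j then 1 else 0)"
  proof (cases "i = j")
    case True
    have "(\<integral>t. std_normal_density t * t ^ k l \<partial>lborel) = 1" for l
      using std_normal_moments True by (cases "l = i") (auto simp: k_def numeral_2_eq_2)
    then show ?thesis using True by simp
  next
    case False
    have "(\<integral>t. std_normal_density t * t ^ k i \<partial>lborel) = 0"
      using std_normal_moments False by (auto simp: k_def)
    then show ?thesis using False by (auto simp: prod_zero_iff)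
  qed
  show "integrable lborel (\<lambda>x::real^'n. gdens x * (x $ i * x $ j))"
    and "(\<integral>x. gdens x * (x $ i * x $ j) \<partial>(lborel :: (real^'n) measure)) = (if i = j then 1 else 0)"
    using gdens_moments[where 'n='n, of k] unfolding * ** by auto
qed

lemma prob_space_std_gaussian: "prob_space (std_gaussian :: (real^'n) measure)"
proof
  have "emeasure std_gaussian (space (std_gaussian :: (real^'n) measure)) = (\<integral>\<^sup>+x. 1 \<partial>(std_gaussian :: (real^'n) measure))"
    by simp
  also have "\<dots> = (\<integral>\<^sup>+x. ennreal (gdens x) \<partial>(lborel :: (real^'n) measure))"
    by (subst nn_integral_std_gaussian) auto
  also have "\<dots> = 1"
    using gdens_moment_1 by (subst nn_integral_eq_integral) (auto simp: gdens_nonneg)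
  finally show "emeasure std_gaussian (space (std_gaussian :: (real^'n) measure)) = 1" .
qed

text \<open>Mean 0 and identity covariance in one formula. The offset \<open>a\<close> stands for
  what has accumulated up to the current time, so that an induction over time can integrate out one
  new noise vector per step.\<close>

lemma std_gaussian_affine_square:
  "(\<integral>\<^sup>+x. ennreal ((a + v \<bullet> x)\<^sup>2) \<partial>std_gaussian) = ennreal (a\<^sup>2 + (norm v)\<^sup>2)"
proof -
  have eq: "gdens x * (a + v \<bullet> x)\<^sup>2 = a\<^sup>2 * gdens x + (\<Sum>i\<in>UNIV. 2 * a * v $ i * (gdens x * x $ i))
      + (\<Sum>i\<in>UNIV. \<Sum>j\<in>UNIV. v $ i * v $ j * (gdens x * (x $ i * x $ j)))" for x
  proof -
    have "(\<Sum>i\<in>UNIV. 2 * a * v $ i * (gdens x * x $ i)) = 2 * a * gdens x * (v \<bullet> x)"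
      by (simp add: inner_vec_def sum_distrib_left mult_ac)
    moreover have "(\<Sum>i\<in>UNIV. \<Sum>j\<in>UNIV. v $ i * v $ j * (gdens x * (x $ i * x $ j))) = gdens x * (v \<bullet> x)\<^sup>2"
      by (simp add: inner_vec_def power2_eq_square sum_product sum_distrib_left mult_ac)
    ultimately show ?thesis by (simp add: power2_eq_square algebra_simps)
  qed
  have "has_bochner_integral lborel (\<lambda>x. gdens x * (a + v \<bullet> x)\<^sup>2)
     (a\<^sup>2 * 1 + (\<Sum>i\<in>UNIV. 2 * a * v $ i * 0)
      + (\<Sum>i\<in>UNIV. \<Sum>j\<in>UNIV. v $ i * v $ j * (if i = j then 1 else 0)))"
    unfolding eq
    by (intro has_bochner_integral_add has_bochner_integral_sum has_bochner_integral_mult_right)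
      (simp_all only: has_bochner_integral_iff gdens_moment_1 gdens_moment_x gdens_moment_xx simp_thms)
  also have "a\<^sup>2 * 1 + (\<Sum>i\<in>UNIV. 2 * a * v $ i * 0)
      + (\<Sum>i\<in>UNIV. \<Sum>j\<in>UNIV. v $ i * v $ j * (if i = j then 1 else 0)) = a\<^sup>2 + (norm v)\<^sup>2"
    by (simp add: power2_norm_eq_inner inner_vec_def if_distrib cong: if_cong)
  finally have "has_bochner_integral lborel (\<lambda>x. gdens x * (a + v \<bullet> x)\<^sup>2) (a\<^sup>2 + (norm v)\<^sup>2)" .
  then have int: "integrable lborel (\<lambda>x. gdens x * (a + v \<bullet> x)\<^sup>2)"
    and "(\<integral>x. gdens x * (a + v \<bullet> x)\<^sup>2 \<partial>lborel) = a\<^sup>2 + (norm v)\<^sup>2"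
    by (auto simp: has_bochner_integral_iff)
  then show ?thesis
    using int by (subst nn_integral_std_gaussian)
      (auto simp: gdens_nonneg nn_integral_eq_integral simp flip: ennreal_mult)
qed

lemma gdens_shift: "gdens (x - m) = gdens x * exp (m \<bullet> x - (norm m)\<^sup>2 / 2)"
proof -
  have "std_normal_density (x $ i - m $ i) = std_normal_density (x $ i) * exp (m $ i * x $ i - (m $ i)\<^sup>2 / 2)" for i
    by (simp add: normal_density_def field_simps power2_eq_square flip: exp_add)
  then have "gdens (x - m) = gdens x * exp (\<Sum>i\<in>UNIV. m $ i * x $ i - (m $ i)\<^sup>2 / 2)"
    by (simp add: gdens_def prod.distrib exp_sum)
  also have "(\<Sum>i\<in>UNIV. m $ i * x $ i - (m $ i)\<^sup>2 / 2) = m \<bullet> x - (norm m)\<^sup>2 / 2"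
    by (simp add: sum_subtractf power2_norm_eq_inner inner_vec_def flip: sum_divide_distrib)
      (simp add: power2_eq_square)
  finally show ?thesis .
qed

text \<open>The Cameron-Martin formula for one Gaussian vector. A time step of the system is such a
  shift, with \<open>m\<close> determined by the past.\<close>

lemma std_gaussian_shift:
  assumes [measurable]: "f \<in> borel_measurable borel"
  shows "(\<integral>\<^sup>+x. f (m + x) \<partial>std_gaussian) =
    (\<integral>\<^sup>+x. ennreal (exp (m \<bullet> x - (norm m)\<^sup>2 / 2)) * f x \<partial>std_gaussian)"
proof -
  have "(\<integral>\<^sup>+x. f (m + x) \<partial>std_gaussian) = (\<integral>\<^sup>+x. ennreal (gdens ((m + x) - m)) * f (m + x) \<partial>lborel)"
    by (subst nn_integral_std_gaussian) auto
  also have "\<dots> = (\<integral>\<^sup>+x. ennreal (gdens (x - m)) * f x \<partial>distr lborel borel ((+) m))"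
    by (subst nn_integral_distr) auto
  also have "\<dots> = (\<integral>\<^sup>+x. ennreal (gdens (x - m)) * f x \<partial>lborel)"
    by (simp add: lborel_distr_plus)
  also have "\<dots> = (\<integral>\<^sup>+x. ennreal (exp (m \<bullet> x - (norm m)\<^sup>2 / 2)) * f x \<partial>std_gaussian)"
    by (subst nn_integral_std_gaussian) 
       (auto simp: gdens_shift ennreal_mult gdens_nonneg mult_ac intro!: nn_integral_cong)
  finally show ?thesis .
qed

section \<open>Likelihood and Fisher information of a trajectory\<close>

text \<open>Paths are indexed from 0 like the noise, so \<open>w j\<close> is the normalised state
  at time \<open>j + 1\<close>, and \<open>lag w i\<close> is the state at time
  \<open>i\<close>.\<close>

definition lag :: "(nat \<Rightarrow> real^'n) \<Rightarrow> nat \<Rightarrow> real^'n" where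
  "lag w i = (case i of 0 \<Rightarrow> 0 | Suc j \<Rightarrow> w j)"

lemma lag_simps[simp]: "lag w 0 = 0" "lag w (Suc i) = w i"
  by (auto simp: lag_def)

text \<open>The normalised trajectory, shifted by one so that it lives on the same space as the
  noise and its law can be compared with \<open>noise N\<close>.\<close>

definition innovation_path :: "real^'n^'n \<Rightarrow> nat \<Rightarrow> (nat \<Rightarrow> real^'n) \<Rightarrow> nat \<Rightarrow> real^'n" where
  "innovation_path M N \<epsilon> = (\<lambda>i\<in>{0..<N}. state M (mat 1) \<epsilon> (Suc i))"

text \<open>Logarithm of the density of the law of \<open>innovation_path M N\<close> with respect
  to \<open>noise N\<close>, the law for \<open>M = 0\<close>.\<close>

definition loglik :: "real^'n^'n \<Rightarrow> nat \<Rightarrow> (nat \<Rightarrow> real^'n) \<Rightarrow> real" where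
  "loglik M N w = (\<Sum>i<N. (M *v lag w i) \<bullet> w i - (norm (M *v lag w i))\<^sup>2 / 2)"

definition score :: "real^'n^'n \<Rightarrow> real^'n^'n \<Rightarrow> nat \<Rightarrow> (nat \<Rightarrow> real^'n) \<Rightarrow> real" where
  "score C M N w = (\<Sum>i<N. (C *v lag w i) \<bullet> (w i - M *v lag w i))"

text \<open>The iterate is \<open>C\<close> times the power \<open>l\<close> of \<open>M\<close>. It
  is built by right multiplications because this is what one step back in time does to
  \<open>C *v state\<close>.\<close>

definition info :: "real^'n^'n \<Rightarrow> real^'n^'n \<Rightarrow> nat \<Rightarrow> real" where
  "info C M N = (\<Sum>i<N. \<Sum>l<i. (norm (((\<lambda>X. X ** M) ^^ l) C))\<^sup>2)"

lemma state_cong: "(\<And>j. j < i \<Longrightarrow> \<epsilon> j = \<epsilon>' j) \<Longrightarrow> state A B \<epsilon> i = state A B \<epsilon>' i"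
  by (induction i) auto

lemma lag_innovation_path: "i \<le> N \<Longrightarrow> lag (innovation_path M N \<epsilon>) i = state M (mat 1) \<epsilon> i"
  by (cases i) (auto simp: innovation_path_def)

lemma innovation_path_Suc:
  "innovation_path M (Suc N) (\<epsilon>(N := e)) = (innovation_path M N \<epsilon>)(N := M *v state M (mat 1) \<epsilon> N + e)"
  (is "?l = ?r")
proof
  fix i
  have "state M (mat 1) (\<epsilon>(N := e)) i = state M (mat 1) \<epsilon> i" if "i \<le> N" for i
    using that by (intro state_cong) auto
  then show "?l i = ?r i"
    by (auto simp: innovation_path_def restrict_def less_Suc_eq simp del: state.simps)
       (auto simp: matrix_vector_mul_lid)
qed

section \<open>Measurability of trajectory, likelihood and score\<close>

lemma measurable_matrix_vector_mult[measurable (raw)]: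
  fixes f :: "'a \<Rightarrow> real^'n^'m"
  assumes "f \<in> borel_measurable M" "g \<in> borel_measurable M"
  shows "(\<lambda>x. f x *v g x) \<in> borel_measurable M"
proof -
  have "continuous_on UNIV (\<lambda>p::(real^'n^'m) \<times> (real^'n). fst p *v snd p)"
    unfolding matrix_vector_mult_def
    by (intro continuous_on_vec_lambda continuous_on_sum continuous_intros)
  from borel_measurable_continuous_Pair[OF assms, of "(*v)"] this
  show ?thesis by (auto simp: case_prod_unfold)
qed

lemma measurable_matrix_matrix_mult[measurable (raw)]:
  fixes f :: "'a \<Rightarrow> real^'n^'m" and g :: "'a \<Rightarrow> real^'k^'n"
  assumes "f \<in> borel_measurable M" "g \<in> borel_measurable M"
  shows "(\<lambda>x. f x ** g x) \<in> borel_measurable M"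
proof -
  have "continuous_on UNIV (\<lambda>p::(real^'n^'m) \<times> (real^'k^'n). fst p ** snd p)"
    unfolding matrix_matrix_mult_def
    by (intro continuous_on_vec_lambda continuous_on_sum continuous_intros)
  from borel_measurable_continuous_Pair[OF assms, of "(**)"] this
  show ?thesis by (auto simp: case_prod_unfold)
qed

lemma measurable_noise_component:
  assumes "f \<in> M \<rightarrow>\<^sub>M noise N" "i < N"
  shows "(\<lambda>x. f x i) \<in> borel_measurable M"
proof -
  have "(\<lambda>x. f x i) \<in> M \<rightarrow>\<^sub>M std_gaussian"
    using assms(2) by (intro measurable_compose[OF assms(1)[unfolded noise_def] measurable_component_singleton]) simp
  then show ?thesis unfolding measurable_cong_sets[OF refl sets_std_gaussian] .
qed

lemma measurable_lag:
  assumes "f \<in> M \<rightarrow>\<^sub>M noise N" "i \<le> N"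
  shows "(\<lambda>x. lag (f x) i) \<in> borel_measurable M"
  using assms(2) by (cases i) (auto intro: measurable_noise_component[OF assms(1)])

lemma measurable_state:
  assumes "f \<in> M \<rightarrow>\<^sub>M noise N" and "i \<le> N"
  shows "(\<lambda>x. state A B (f x) i) \<in> borel_measurable M"
  using assms(2)
proof (induction i)
  case (Suc i)
  then show ?case
    by (auto intro!: borel_measurable_add measurable_matrix_vector_mult measurable_noise_component[OF assms(1)])
qed simp

lemma measurable_innovation_path[measurable (raw)]:
  assumes [measurable]: "f \<in> M \<rightarrow>\<^sub>M noise N"
  shows "(\<lambda>x. innovation_path A N (f x)) \<in> M \<rightarrow>\<^sub>M noise N"
  unfolding innovation_path_def noise_def
proof (rule measurable_restrict)
  fix i assume "i \<in> {0..<N}"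
  then have "(\<lambda>x. state A (mat 1) (f x) (Suc i)) \<in> borel_measurable M"
    by (intro measurable_state[OF assms]) auto
  then show "(\<lambda>x. state A (mat 1) (f x) (Suc i)) \<in> M \<rightarrow>\<^sub>M std_gaussian"
    by simp
qed

lemma measurable_loglik[measurable (raw)]:
  assumes [measurable]: "A \<in> borel_measurable M" "f \<in> M \<rightarrow>\<^sub>M noise N"
  shows "(\<lambda>x. loglik (A x) N (f x)) \<in> borel_measurable M"
  unfolding loglik_def
proof (rule borel_measurable_sum)
  fix i assume "i \<in> {..<N}"
  then have [measurable]: "(\<lambda>x. lag (f x) i) \<in> borel_measurable M" "(\<lambda>x. f x i) \<in> borel_measurable M"
    using assms by (auto intro!: measurable_noise_component[OF assms(2)] measurable_lag[OF assms(2)])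
  show "(\<lambda>x. (A x *v lag (f x) i) \<bullet> f x i - (norm (A x *v lag (f x) i))\<^sup>2 / 2) \<in> borel_measurable M"
    by measurable
qed

lemma measurable_score[measurable (raw)]:
  assumes [measurable]: "A \<in> borel_measurable M" "f \<in> M \<rightarrow>\<^sub>M noise N"
  shows "(\<lambda>x. score C (A x) N (f x)) \<in> borel_measurable M"
  unfolding score_def
proof (rule borel_measurable_sum)
  fix i assume "i \<in> {..<N}"
  then have [measurable]: "(\<lambda>x. lag (f x) i) \<in> borel_measurable M" "(\<lambda>x. f x i) \<in> borel_measurable M"
    using assms by (auto intro!: measurable_noise_component[OF assms(2)] measurable_lag[OF assms(2)])
  show "(\<lambda>x. (C *v lag (f x) i) \<bullet> (f x i - A x *v lag (f x) i)) \<in> borel_measurable M"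
    by measurable
qed

section \<open>Change of measure and second moments\<close>

lemma prob_space_noise: "prob_space (noise N :: (nat \<Rightarrow> real^'n) measure)"
  unfolding noise_def by (intro prob_space_PiM prob_space_std_gaussian)

lemma measurable_noise_upd[measurable]:
  "(\<lambda>(\<epsilon>, e). \<epsilon>(N := e)) \<in> noise N \<Otimes>\<^sub>M std_gaussian \<rightarrow>\<^sub>M noise (Suc N)"
  unfolding noise_def atLeast0_lessThan_Suc by (rule measurable_add_dim)

lemma nn_integral_noise_Suc:
  assumes "f \<in> borel_measurable (noise (Suc N))"
  shows "(\<integral>\<^sup>+\<epsilon>. f \<epsilon> \<partial>noise (Suc N)) = (\<integral>\<^sup>+\<epsilon>. \<integral>\<^sup>+e. f (\<epsilon>(N := e)) \<partial>std_gaussian \<partial>noise N)"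
proof -
  interpret prob_space "std_gaussian :: (real^'a) measure" by (rule prob_space_std_gaussian)
  interpret product_sigma_finite "\<lambda>_::nat. std_gaussian :: (real^'a) measure" by standard
  show ?thesis
    using assms unfolding noise_def atLeast0_lessThan_Suc
    by (subst product_nn_integral_insert) auto
qed

text \<open>Given the past, the last coordinate is a Gaussian vector shifted by \<open>M\<close>
  times the previous state. Cameron-Martin turns the shift into the last term of
  \<open>loglik\<close>; the induction hypothesis treats the earlier coordinates.\<close>

lemma nn_integral_innovation_path:
  assumes "f \<in> borel_measurable (noise N)"
  shows "(\<integral>\<^sup>+\<epsilon>. f (innovation_path M N \<epsilon>) \<partial>noise N) = (\<integral>\<^sup>+w. ennreal (exp (loglik M N w)) * f w \<partial>noise N)"
  using assms
proof (induction N arbitrary: f)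
  case 0
  have "innovation_path M 0 \<epsilon> = \<epsilon>" if "\<epsilon> \<in> space (noise 0)" for \<epsilon>
    using that by (auto simp: innovation_path_def noise_def space_PiM)
  then show ?case by (auto simp: loglik_def intro!: nn_integral_cong)
next
  case (Suc N)
  interpret prob_space "std_gaussian :: (real^'a) measure" by (rule prob_space_std_gaussian)
  note Suc.prems[measurable]
  \<comment> \<open>The last coordinate integrated out against its density: a function of the
    earlier path, ready for the induction hypothesis.\<close>
  define g where "g w = (\<integral>\<^sup>+e. ennreal (exp ((M *v lag w N) \<bullet> e - (norm (M *v lag w N))\<^sup>2 / 2)) * f (w(N := e)) \<partial>std_gaussian)" for w
  have [measurable]: "(\<lambda>w. lag w N) \<in> borel_measurable (noise N :: (nat \<Rightarrow> real^'a) measure)"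
    by (rule measurable_lag) auto
  have fm[measurable]: "(\<lambda>(\<epsilon>, e). f (\<epsilon>(N := e))) \<in> borel_measurable (noise N \<Otimes>\<^sub>M std_gaussian)"
    using measurable_compose[OF measurable_noise_upd Suc.prems] by (simp add: case_prod_unfold)
  have gm: "g \<in> borel_measurable (noise N)"
    unfolding g_def[abs_def] by measurable
  have fe: "(\<lambda>e. f (w(N := e))) \<in> borel_measurable std_gaussian" if "w \<in> space (noise N)" for w
    using measurable_compose[OF measurable_Pair1' fm] that by auto
  then have fe': "(\<lambda>e. f (w(N := e))) \<in> borel_measurable borel" if "w \<in> space (noise N)" for w
    using that by simp
  have expm: "(\<lambda>w. ennreal (exp (loglik M K w))) \<in> borel_measurable (noise K)" for K
    by (rule measurable_compose[OF measurable_loglik]) auto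
  have "(\<lambda>\<epsilon>. f (innovation_path M (Suc N) \<epsilon>)) \<in> borel_measurable (noise (Suc N))"
    by (rule measurable_compose[OF measurable_innovation_path Suc.prems]) auto
  from nn_integral_noise_Suc[OF this]
  have "(\<integral>\<^sup>+\<epsilon>. f (innovation_path M (Suc N) \<epsilon>) \<partial>noise (Suc N))
      = (\<integral>\<^sup>+\<epsilon>. \<integral>\<^sup>+e. f ((innovation_path M N \<epsilon>)(N := M *v state M (mat 1) \<epsilon> N + e)) \<partial>std_gaussian \<partial>noise N)"
    by (simp add: innovation_path_Suc)
  also have "\<dots> = (\<integral>\<^sup>+\<epsilon>. g (innovation_path M N \<epsilon>) \<partial>noise N)"
  proof (rule nn_integral_cong)
    fix \<epsilon> :: "nat \<Rightarrow> real^'a" assume "\<epsilon> \<in> space (noise N)"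
    then have "innovation_path M N \<epsilon> \<in> space (noise N)" using measurable_space[OF measurable_innovation_path[OF measurable_ident]] by auto
    from std_gaussian_shift[OF fe'[OF this]]
    show "(\<integral>\<^sup>+e. f ((innovation_path M N \<epsilon>)(N := M *v state M (mat 1) \<epsilon> N + e)) \<partial>std_gaussian) = g (innovation_path M N \<epsilon>)"
      by (simp add: g_def lag_innovation_path)
  qed
  also have "\<dots> = (\<integral>\<^sup>+w. ennreal (exp (loglik M N w)) * g w \<partial>noise N)"
    by (rule Suc.IH[OF gm])
  also have "\<dots> = (\<integral>\<^sup>+w. \<integral>\<^sup>+e. ennreal (exp (loglik M (Suc N) (w(N := e)))) * f (w(N := e)) \<partial>std_gaussian \<partial>noise N)"
  proof (rule nn_integral_cong)
    fix w :: "nat \<Rightarrow> real^'a" assume w: "w \<in> space (noise N)"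
    note fe[OF w, measurable]
    have l: "lag (w(N := e)) i = lag w i" if "i \<le> N" for i e
      using that by (cases i) auto
    have ll: "loglik M (Suc N) (w(N := e)) = loglik M N w + ((M *v lag w N) \<bullet> e - (norm (M *v lag w N))\<^sup>2 / 2)" for e
      by (auto simp: loglik_def l intro!: sum.cong)
    show "ennreal (exp (loglik M N w)) * g w
       = (\<integral>\<^sup>+e. ennreal (exp (loglik M (Suc N) (w(N := e)))) * f (w(N := e)) \<partial>std_gaussian)"
      unfolding g_def ll exp_add
      by (subst nn_integral_cmult[symmetric]) (auto simp: ennreal_mult mult.assoc)
  qed
  also have "\<dots> = (\<integral>\<^sup>+w. ennreal (exp (loglik M (Suc N) w)) * f w \<partial>noise (Suc N))"
    by (rule nn_integral_noise_Suc[symmetric])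
      (intro borel_measurable_times_ennreal Suc.prems expm)
  finally show ?case .
qed

lemma norm_matrix_square: "(norm (C :: real^'n^'m))\<^sup>2 = (\<Sum>i\<in>UNIV. (norm (C $ i))\<^sup>2)"
  by (simp add: norm_vec_def L2_set_def sum_nonneg)

lemma std_gaussian_matrix_square:
  fixes C :: "real^'n^'m"
  shows "(\<integral>\<^sup>+x. ennreal ((norm (a + C *v x))\<^sup>2) \<partial>std_gaussian) = ennreal ((norm a)\<^sup>2 + (norm C)\<^sup>2)"
proof -
  have "(norm (a + C *v x))\<^sup>2 = (\<Sum>i\<in>UNIV. (a $ i + C $ i \<bullet> x)\<^sup>2)" for x
    by (simp add: norm_vec_def L2_set_def sum_nonneg matrix_vector_mul_component)
  moreover have "(\<lambda>x. (a $ i + C $ i \<bullet> x)\<^sup>2) \<in> borel_measurable std_gaussian" for i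
    by (subst measurable_cong_sets[OF sets_std_gaussian refl]) measurable
  ultimately have "(\<integral>\<^sup>+x. ennreal ((norm (a + C *v x))\<^sup>2) \<partial>std_gaussian)
      = (\<Sum>i\<in>UNIV. \<integral>\<^sup>+x. ennreal ((a $ i + C $ i \<bullet> x)\<^sup>2) \<partial>std_gaussian)"
    by (subst nn_integral_sum[symmetric]) (auto simp: sum_ennreal)
  also have "\<dots> = ennreal (\<Sum>i\<in>UNIV. (a $ i)\<^sup>2 + (norm (C $ i))\<^sup>2)"
    by (simp add: std_gaussian_affine_square sum_ennreal del: ennreal_plus)
  also have "(\<Sum>i\<in>UNIV. (a $ i)\<^sup>2 + (norm (C $ i))\<^sup>2) = (norm a)\<^sup>2 + (norm C)\<^sup>2"
    by (simp add: sum.distrib norm_matrix_square) (simp add: norm_vec_def L2_set_def sum_nonneg)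
  finally show ?thesis .
qed

text \<open>The induction generalises over \<open>C\<close>: unrolling the last step replaces
  \<open>C\<close> by \<open>C ** M\<close> on the older state, and the independent new noise adds
  \<open>(norm C)\<^sup>2\<close>.\<close>

lemma state_second_moment:
  "(\<integral>\<^sup>+\<epsilon>. ennreal ((norm (C *v state M (mat 1) \<epsilon> i))\<^sup>2) \<partial>noise i)
     = ennreal (\<Sum>l<i. (norm (((\<lambda>X. X ** M) ^^ l) C))\<^sup>2)"
proof (induction i arbitrary: C)
  case (Suc i)
  interpret prob_space "noise i :: (nat \<Rightarrow> real^'a) measure" by (rule prob_space_noise)
  have [measurable]: "(\<lambda>x. state M (mat 1) x i) \<in> borel_measurable (noise i :: (nat \<Rightarrow> real^'a) measure)"
    by (rule measurable_state) auto
  have m: "(\<lambda>\<epsilon>. ennreal ((norm (C *v state M (mat 1) \<epsilon> K))\<^sup>2)) \<in> borel_measurable (noise K)" for K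
    by (intro measurable_compose[OF _ measurable_ennreal] borel_measurable_power
        measurable_compose[OF _ borel_measurable_norm] borel_measurable_const measurable_matrix_vector_mult measurable_state) auto
  have st: "state M (mat 1) (\<epsilon>(i := e)) i = state M (mat 1) \<epsilon> i" for \<epsilon> e
    by (intro state_cong) auto
  have "(\<integral>\<^sup>+\<epsilon>. ennreal ((norm (C *v state M (mat 1) \<epsilon> (Suc i)))\<^sup>2) \<partial>noise (Suc i))
    = (\<integral>\<^sup>+\<epsilon>. \<integral>\<^sup>+e. ennreal ((norm ((C ** M) *v state M (mat 1) \<epsilon> i + C *v e))\<^sup>2) \<partial>std_gaussian \<partial>noise i)"
    by (subst nn_integral_noise_Suc[OF m]) (simp add: st matrix_vector_right_distrib matrix_vector_mul_assoc)
  also have "\<dots> = (\<integral>\<^sup>+\<epsilon>. ennreal ((norm ((C ** M) *v state M (mat 1) \<epsilon> i))\<^sup>2) + ennreal ((norm C)\<^sup>2) \<partial>noise i)"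
    by (simp add: std_gaussian_matrix_square)
  also have "\<dots> = ennreal (\<Sum>l<i. (norm (((\<lambda>X. X ** M) ^^ l) (C ** M)))\<^sup>2) + ennreal ((norm C)\<^sup>2)"
    by (subst nn_integral_add) (auto simp: Suc.IH emeasure_space_1)
  also have "\<dots> = ennreal (\<Sum>l<Suc i. (norm (((\<lambda>X. X ** M) ^^ l) C))\<^sup>2)"
    by (simp add: sum.lessThan_Suc_shift funpow_Suc_right sum_nonneg del: funpow.simps sum.lessThan_Suc flip: ennreal_plus)
  finally show ?case .
qed simp

text \<open>The summands are martingale differences: \<open>\<epsilon> i\<close> is centred and
  independent of the state it is paired with, so the squares add up. The constant \<open>h\<close>
  will be the logarithmic derivative of the prior.\<close>

lemma score_innovation_path_second_moment:
  "(\<integral>\<^sup>+\<epsilon>. ennreal ((h + (\<Sum>i<N. (C *v state M (mat 1) \<epsilon> i) \<bullet> \<epsilon> i))\<^sup>2) \<partial>noise N)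
     = ennreal (h\<^sup>2 + info C M N)"
proof (induction N)
  case 0
  interpret prob_space "noise 0 :: (nat \<Rightarrow> real^'a) measure" by (rule prob_space_noise)
  show ?case by (simp add: info_def emeasure_space_1)
next
  case (Suc N)
  have m: "(\<lambda>\<epsilon>. ennreal ((h + (\<Sum>i<K. (C *v state M (mat 1) \<epsilon> i) \<bullet> \<epsilon> i))\<^sup>2)) \<in> borel_measurable (noise K)" for K
    by (intro measurable_compose[OF _ measurable_ennreal] borel_measurable_power borel_measurable_add
        borel_measurable_sum borel_measurable_inner borel_measurable_const measurable_matrix_vector_mult
        measurable_state[where N=K] measurable_noise_component[where N=K]) auto
  have m2[measurable]: "(\<lambda>\<epsilon>. ennreal ((norm (C *v state M (mat 1) \<epsilon> N))\<^sup>2)) \<in> borel_measurable (noise N)"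
    by (intro measurable_compose[OF _ measurable_ennreal] borel_measurable_power
        measurable_compose[OF _ borel_measurable_norm] borel_measurable_const measurable_matrix_vector_mult measurable_state) auto
  have st: "state M (mat 1) (\<epsilon>(N := e)) i = state M (mat 1) \<epsilon> i" if "i \<le> N" for \<epsilon> e i
    using that by (intro state_cong) auto
  have eq: "h + (\<Sum>i<Suc N. (C *v state M (mat 1) (\<epsilon>(N := e)) i) \<bullet> (\<epsilon>(N := e)) i)
      = h + (\<Sum>i<N. (C *v state M (mat 1) \<epsilon> i) \<bullet> \<epsilon> i) + (C *v state M (mat 1) \<epsilon> N) \<bullet> e" for \<epsilon> e
    by (auto simp: st intro!: sum.cong)
  have "(\<integral>\<^sup>+\<epsilon>. ennreal ((h + (\<Sum>i<Suc N. (C *v state M (mat 1) \<epsilon> i) \<bullet> \<epsilon> i))\<^sup>2) \<partial>noise (Suc N))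
     = (\<integral>\<^sup>+\<epsilon>. \<integral>\<^sup>+e. ennreal ((h + (\<Sum>i<N. (C *v state M (mat 1) \<epsilon> i) \<bullet> \<epsilon> i)
         + (C *v state M (mat 1) \<epsilon> N) \<bullet> e)\<^sup>2) \<partial>std_gaussian \<partial>noise N)"
    unfolding eq[symmetric] by (rule nn_integral_noise_Suc[OF m])
  also have "\<dots> = (\<integral>\<^sup>+\<epsilon>. ennreal ((h + (\<Sum>i<N. (C *v state M (mat 1) \<epsilon> i) \<bullet> \<epsilon> i))\<^sup>2)
       + ennreal ((norm (C *v state M (mat 1) \<epsilon> N))\<^sup>2) \<partial>noise N)"
    by (simp add: std_gaussian_affine_square)
  also have "\<dots> = ennreal (h\<^sup>2 + info C M N) + ennreal (\<Sum>l<N. (norm (((\<lambda>X. X ** M) ^^ l) C))\<^sup>2)"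
    by (subst nn_integral_add[OF m m2]) (simp only: Suc.IH state_second_moment)
  also have "\<dots> = ennreal (h\<^sup>2 + info C M (Suc N))"
    by (simp add: info_def sum_nonneg add.assoc flip: ennreal_plus)
  finally show ?case .
qed

text \<open>Along the trajectory the residual \<open>w i - M *v lag w i\<close> is the noise
  \<open>\<epsilon> i\<close>, so the change of measure turns the score into the preceding
  martingale.\<close>

lemma score_second_moment:
  "(\<integral>\<^sup>+w. ennreal (exp (loglik M N w)) * ennreal ((h + score C M N w)\<^sup>2) \<partial>noise N)
     = ennreal (h\<^sup>2 + info C M N)"
proof -
  have "score C M N (innovation_path M N \<epsilon>) = (\<Sum>i<N. (C *v state M (mat 1) \<epsilon> i) \<bullet> \<epsilon> i)" for \<epsilon>
    unfolding score_def by (intro sum.cong) (auto simp: lag_innovation_path, simp add: innovation_path_def)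
  then show ?thesis
    by (subst nn_integral_innovation_path[symmetric]) (auto simp: score_innovation_path_second_moment)
qed

section \<open>The van Trees inequality\<close>

lemma integrable_continuous_bounded_support:
  fixes F :: "'e::euclidean_space \<Rightarrow> real"
  assumes "continuous_on UNIV F" "\<And>z. R < norm z \<Longrightarrow> F z = 0"
  shows "integrable lborel F"
proof -
  have "integrable lborel (\<lambda>z. indicator (cball 0 R) z *\<^sub>R F z)"
    using assms(1) by (intro borel_integrable_compact) (auto intro: continuous_on_subset)
  also have "(\<lambda>z. indicator (cball 0 R) z *\<^sub>R F z) = F"
    using assms(2) by (auto simp: fun_eq_iff indicator_def)
  finally show ?thesis .
qed

text \<open>By translation invariance every difference quotient of \<open>F\<close> along
  \<open>b\<close> integrates to 0, and dominated convergence passes this on to the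
  derivative.\<close>

lemma integral_directional_derivative:
  fixes F G :: "'e::euclidean_space \<Rightarrow> real"
  assumes der: "\<And>z. ((\<lambda>t. F (z + t *\<^sub>R b)) has_real_derivative G z) (at 0)"
    and F: "continuous_on UNIV F" and G: "continuous_on UNIV G"
    and suppF: "\<And>z. R < norm z \<Longrightarrow> F z = 0" and suppG: "\<And>z. R < norm z \<Longrightarrow> G z = 0"
  shows "(\<integral>z. G z \<partial>lborel) = 0"
proof -
  have [measurable]: "F \<in> borel_measurable borel" "G \<in> borel_measurable borel"
    using F G by (auto intro: borel_measurable_continuous_onI)
  have intF: "integrable lborel F" and intG: "integrable lborel G"
    using integrable_continuous_bounded_support F G suppF suppG by blast+
  have "bounded (G ` cball 0 R)"
    using G by (intro compact_imp_bounded compact_continuous_image) (auto intro: continuous_on_subset)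
  then obtain K0 where K0: "\<And>z. norm z \<le> R \<Longrightarrow> \<bar>G z\<bar> \<le> K0"
    unfolding bounded_iff by (metis imageI mem_cball_0 real_norm_def)
  define K where "K = max K0 0"
  have K: "\<bar>G z\<bar> \<le> K" "0 \<le> K" for z
    using K0[of z] suppG[of z] by (cases "norm z \<le> R"; force simp: K_def)+
  have der': "((\<lambda>t. F (z + t *\<^sub>R b)) has_real_derivative G (z + s *\<^sub>R b)) (at s)" for z s
    using der[of "z + s *\<^sub>R b"] DERIV_shift[of "\<lambda>t. F (z + t *\<^sub>R b)" "G (z + s *\<^sub>R b)" 0 s]
    by (simp add: algebra_simps)
  define s :: "nat \<Rightarrow> real" where "s n = inverse (real (Suc n))" for n
  have s: "0 < s n" "s n \<le> 1" for n by (auto simp: s_def field_simps)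
  have s0: "s \<longlonglongrightarrow> 0" unfolding s_def by (rule LIMSEQ_inverse_real_of_nat)
  define D where "D n z = (F (s n *\<^sub>R b + z) - F z) / s n" for n z
  have D: "(\<integral>z. D n z \<partial>lborel) = 0" for n
  proof -
    have "integrable lborel (\<lambda>z. F (s n *\<^sub>R b + z))"
      using intF lborel_distr_plus[of "s n *\<^sub>R b"] integrable_distr_eq[of "(+) (s n *\<^sub>R b)" lborel borel F]
      by simp
    moreover have "(\<integral>z. F (s n *\<^sub>R b + z) \<partial>lborel) = (\<integral>z. F z \<partial>lborel)"
      using lborel_distr_plus[of "s n *\<^sub>R b"] integral_distr[of "(+) (s n *\<^sub>R b)" lborel borel F] by simp
    ultimately show ?thesis using intF by (simp add: D_def)
  qed
  have "(\<lambda>n. \<integral>z. D n z \<partial>lborel) \<longlonglongrightarrow> (\<integral>z. G z \<partial>lborel)"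
  proof (rule integral_dominated_convergence[where w = "\<lambda>z. K * indicator (cball 0 (R + norm b)) z"])
    show "G \<in> borel_measurable lborel" by simp
    show "D n \<in> borel_measurable lborel" for n
      by (simp add: D_def[abs_def])
    show "integrable lborel (\<lambda>z. K * indicator (cball 0 (R + norm b)) z)"
      by (intro integrable_mult_right integrable_real_indicator) (use emeasure_lborel_cball_finite[of 0 "R + norm b"] in auto)
    show "AE z in lborel. (\<lambda>n. D n z) \<longlonglongrightarrow> G z"
    proof (rule AE_I2)
      fix z
      have "((\<lambda>h. (F (z + h *\<^sub>R b) - F z) / h) \<longlongrightarrow> G z) (at 0)"
        using der[of z] by (simp add: DERIV_def)
      moreover have "filterlim s (at 0) sequentially"
        using s0 s by (auto simp: filterlim_at intro!: always_eventually) (metis less_irrefl)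
      ultimately have "((\<lambda>n. (F (z + s n *\<^sub>R b) - F z) / s n) \<longlongrightarrow> G z) sequentially"
        by (rule filterlim_compose)
      then show "(\<lambda>n. D n z) \<longlonglongrightarrow> G z" by (simp add: D_def add.commute)
    qed
    \<comment> \<open>The increments are at most 1, so the quotients vanish outside the ball
      enlarged by \<open>norm b\<close>; inside, the mean value theorem bounds them by
      \<open>K\<close>.\<close>
    show "AE z in lborel. norm (D n z) \<le> K * indicator (cball 0 (R + norm b)) z" for n
    proof (rule AE_I2)
      fix z
      show "norm (D n z) \<le> K * indicator (cball 0 (R + norm b)) z"
      proof (cases "norm z \<le> R + norm b")
        case True
        obtain t where "F (z + s n *\<^sub>R b) - F (z + 0 *\<^sub>R b) = (s n - 0) * G (z + t *\<^sub>R b)"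
          using MVT2[of 0 "s n" "\<lambda>t. F (z + t *\<^sub>R b)" "\<lambda>t. G (z + t *\<^sub>R b)"] der' s[of n] by blast
        then have "D n z = G (z + t *\<^sub>R b)" using s[of n] by (simp add: D_def add.commute field_simps)
        then show ?thesis using K True by simp
      next
        case False
        have "norm z \<le> norm (s n *\<^sub>R b + z) + norm (s n *\<^sub>R b)"
          by (metis add_diff_cancel_left' norm_triangle_ineq4 norm_minus_commute add.commute)
        moreover have "norm (s n *\<^sub>R b) \<le> norm b"
          using s[of n] by (simp add: mult_left_le_one_le)
        ultimately have "R < norm (s n *\<^sub>R b + z)" using False by linarith
        moreover have "R < norm z" using False norm_ge_zero[of b] by linarith
        ultimately show ?thesis using False suppF by (simp add: D_def)
      qed
    qed
  qed
  then show ?thesis unfolding D using LIMSEQ_unique tendsto_const by blast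
qed

text \<open>Integration by parts in the direction \<open>b\<close> is used with \<open>\<psi>\<close> constant, so that nothing has to be
  assumed about the integrability of the estimator; the square completes \<open>2 c x y \<le> x\<^sup>2 + c\<^sup>2 y\<^sup>2\<close>.\<close>

lemma van_Trees_pointwise:
  fixes q q' L l :: "'e::euclidean_space \<Rightarrow> real"
  assumes b: "b \<in> Basis" and "0 \<le> c"
    and q: "continuous_on UNIV q" "\<And>z. 0 \<le> q z" "\<And>z. R < norm z \<Longrightarrow> q z = 0"
    and q': "continuous_on UNIV q'" "\<And>z. q z = 0 \<Longrightarrow> q' z = 0"
      "\<And>z. ((\<lambda>t. q (z + t *\<^sub>R b)) has_real_derivative q' z) (at 0)"
    and L: "continuous_on UNIV L" "\<And>z. 0 < L z"
      "\<And>z. ((\<lambda>t. L (z + t *\<^sub>R b)) has_real_derivative L z * l z) (at 0)"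
    and l: "continuous_on UNIV l"
  shows "ennreal (2 * c) * (\<integral>\<^sup>+z. ennreal (L z * q z) \<partial>lborel)
    \<le> (\<integral>\<^sup>+z. ennreal ((\<psi> - z \<bullet> b)\<^sup>2 * (L z * q z)) \<partial>lborel)
      + ennreal (c\<^sup>2) * (\<integral>\<^sup>+z. ennreal (L z * (q z * (l z + q' z / q z)\<^sup>2)) \<partial>lborel)"
proof -
  note [measurable] = borel_measurable_continuous_onI[OF q(1)] borel_measurable_continuous_onI[OF q'(1)]
    borel_measurable_continuous_onI[OF L(1)] borel_measurable_continuous_onI[OF l]
  define F where "F z = (\<psi> - z \<bullet> b) * (L z * q z)" for z
  define H where "H z = (\<psi> - z \<bullet> b) * (L z * (l z * q z + q' z))" for z
  have cF: "continuous_on UNIV F" and cH: "continuous_on UNIV H" and cLq: "continuous_on UNIV (\<lambda>z. L z * q z)"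
    unfolding F_def H_def by (intro continuous_intros q q' L l)+
  have iH: "integrable lborel H" and iLq: "integrable lborel (\<lambda>z. L z * q z)"
    using q(3) q'(2) by (intro integrable_continuous_bounded_support[where R=R] cH cLq; simp add: H_def)+
  have bb: "(z + t *\<^sub>R b) \<bullet> b = z \<bullet> b + t" for z t using b by (simp add: inner_add_left)
  have "((\<lambda>t. F (z + t *\<^sub>R b)) has_real_derivative H z - L z * q z) (at 0)" for z
    unfolding F_def bb
    by (rule derivative_eq_intros q' L refl | simp)+ (simp add: H_def algebra_simps)
  then have "(\<integral>z. H z - L z * q z \<partial>lborel) = 0"
    using q(3) q'(2)
    by (intro integral_directional_derivative[where R=R and F=F and b=b] cF continuous_on_diff cH cLq)
       (auto simp: F_def H_def)
  \<comment> \<open>Integration by parts: the mass of \<open>L q\<close> equals the integral of the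
    error \<open>\<psi> - z \<bullet> b\<close> against the derivative of \<open>L q\<close> along
    \<open>b\<close>.\<close>
  then have eq: "(\<integral>z. L z * q z \<partial>lborel) = (\<integral>z. H z \<partial>lborel)"
    using iH iLq by simp
  have pw: "2 * c * H z \<le> (\<psi> - z \<bullet> b)\<^sup>2 * (L z * q z) + c\<^sup>2 * (L z * (q z * (l z + q' z / q z)\<^sup>2))" for z
  proof (cases "q z = 0")
    case True then show ?thesis using q'(2)[OF True] by (simp add: H_def)
  next
    case False
    define x y where "x = \<psi> - z \<bullet> b" and "y = l z + q' z / q z"
    have "0 \<le> (L z * q z) * (x - c * y)\<^sup>2" using L(2)[of z] q(2)[of z] by simp
    moreover have "l z * q z + q' z = q z * y" using False by (simp add: y_def field_simps)
    ultimately show ?thesis unfolding H_def x_def[symmetric] y_def[symmetric]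
      by (simp add: power2_eq_square algebra_simps)
  qed
  have "ennreal (2 * c) * (\<integral>\<^sup>+z. ennreal (L z * q z) \<partial>lborel) = ennreal (2 * c * (\<integral>z. L z * q z \<partial>lborel))"
    using iLq L(2) q(2) \<open>0 \<le> c\<close>
    by (subst nn_integral_eq_integral) (auto simp: less_imp_le ennreal_mult)
  also have "\<dots> = ennreal (\<integral>z. 2 * c * H z \<partial>lborel)" by (simp add: eq)
  also have "\<dots> \<le> (\<integral>\<^sup>+z. ennreal (2 * c * H z) \<partial>lborel)"
  proof -
    have i: "integrable lborel (\<lambda>z. 2 * c * H z)" using iH by simp
    have "(\<integral>z. 2 * c * H z \<partial>lborel) \<le> (\<integral>z. max 0 (2 * c * H z) \<partial>lborel)"
      using i by (intro integral_mono integrable_max) auto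
    also have "ennreal \<dots> = (\<integral>\<^sup>+z. ennreal (max 0 (2 * c * H z)) \<partial>lborel)"
      using i by (intro nn_integral_eq_integral[symmetric] integrable_max) auto
    finally show ?thesis by (simp add: ennreal_leI)
  qed
  also have "\<dots> \<le> (\<integral>\<^sup>+z. ennreal ((\<psi> - z \<bullet> b)\<^sup>2 * (L z * q z))
       + ennreal (c\<^sup>2) * ennreal (L z * (q z * (l z + q' z / q z)\<^sup>2)) \<partial>lborel)"
    using pw L(2) q(2) by (intro nn_integral_mono)
      (simp add: less_imp_le ennreal_leI flip: ennreal_mult ennreal_plus)
  also have "\<dots> = (\<integral>\<^sup>+z. ennreal ((\<psi> - z \<bullet> b)\<^sup>2 * (L z * q z)) \<partial>lborel)
      + ennreal (c\<^sup>2) * (\<integral>\<^sup>+z. ennreal (L z * (q z * (l z + q' z / q z)\<^sup>2)) \<partial>lborel)"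
    by (subst nn_integral_add) (auto simp: nn_integral_cmult)
  finally show ?thesis .
qed

lemma loglik_has_derivative:
  "((\<lambda>t. loglik (M + t *\<^sub>R C) N w) has_real_derivative score C M N w) (at 0)"
proof -
  have *: "loglik (M + t *\<^sub>R C) N w = (\<Sum>i<N. ((M *v lag w i) \<bullet> w i - (norm (M *v lag w i))\<^sup>2 / 2)
     + t * ((C *v lag w i) \<bullet> (w i - M *v lag w i)) - t\<^sup>2 * (norm (C *v lag w i))\<^sup>2 / 2)" for t
    unfolding loglik_def
    by (intro sum.cong refl) (simp add: matrix_vector_mult_add_rdistrib scaleR_matrix_vector_assoc[symmetric]
        power2_norm_eq_inner power2_eq_square[of t]
        inner_add inner_diff inner_commute field_simps)
  show ?thesis unfolding * score_def
    by (auto intro!: derivative_eq_intros)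
qed

lemma continuous_on_matrix_vector_mult[continuous_intros]:
  fixes f :: "'a::topological_space \<Rightarrow> real^'n^'m"
  assumes "continuous_on S f" "continuous_on S g"
  shows "continuous_on S (\<lambda>x. f x *v g x)"
  unfolding matrix_vector_mult_def
  by (intro continuous_on_vec_lambda continuous_on_sum continuous_intros assms)

section \<open>The risk as an integral against the noise\<close>

lemma S2_norm_eq_norm: "S2_norm W = norm W"
proof -
  have "trace (transpose W ** W) = (\<Sum>i\<in>UNIV. \<Sum>k\<in>UNIV. (W $ k $ i)\<^sup>2)"
    by (simp add: trace_def matrix_matrix_mult_def transpose_def power2_eq_square)
  also have "\<dots> = (norm W)\<^sup>2"
    by (subst sum.swap) (simp add: norm_vec_def L2_set_def sum_nonneg)
  finally show ?thesis by (simp add: S2_norm_def)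
qed

text \<open>Conjugation stated as \<open>A ** B = B ** M\<close>: the noise matrix becomes the
  identity without an inverse being written.\<close>

lemma state_conj:
  assumes "A ** B = B ** M"
  shows "state A B \<epsilon> i = B *v state M (mat 1) \<epsilon> i"
proof (induction i)
  case (Suc i)
  then show ?case using assms by (simp add: matrix_vector_mul_assoc matrix_vector_right_distrib)
qed simp

text \<open>Undoes both normalisations: the factor \<open>B\<close> and the index shift of
  paths.\<close>

definition obs_of :: "real^'n^'n \<Rightarrow> nat \<Rightarrow> (nat \<Rightarrow> real^'n) \<Rightarrow> nat \<Rightarrow> real^'n" where
  "obs_of B N w = (\<lambda>i\<in>{1..N}. B *v w (i - 1))"

lemma measurable_obs_of[measurable]: "obs_of B N \<in> noise N \<rightarrow>\<^sub>M obs_space N"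
  unfolding obs_of_def
  by (intro measurable_restrict measurable_matrix_vector_mult borel_measurable_const
      measurable_noise_component[where N=N]) auto

text \<open>For every parameter the risk is an integral against the same measure
  \<open>noise N\<close>. This is what permits the integrals over parameter and path to be
  exchanged.\<close>

lemma risk2_eq:
  assumes "A ** B = B ** M" and [measurable]: "Ahat \<in> borel_measurable (obs_space N)"
  shows "risk2 B N Ahat A = (\<integral>\<^sup>+w. ennreal (exp (loglik M N w)) * ennreal ((norm (Ahat (obs_of B N w) - A))\<^sup>2) \<partial>noise N)"
proof -
  have eq: "restrict (state A B \<epsilon>) {1..N} = obs_of B N (innovation_path M N \<epsilon>)" for \<epsilon>
  proof
    fix i
    show "restrict (state A B \<epsilon>) {1..N} i = obs_of B N (innovation_path M N \<epsilon>) i"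
      by (cases i) (auto simp: state_conj[OF assms(1)] obs_of_def innovation_path_def simp del: state.simps)
  qed
  have m: "(\<lambda>\<epsilon>. obs_of B N (innovation_path M N \<epsilon>)) \<in> noise N \<rightarrow>\<^sub>M obs_space N"
    by (rule measurable_compose[OF measurable_innovation_path measurable_obs_of]) auto
  have m2: "(\<lambda>x. ennreal ((S2_norm (Ahat x - A))\<^sup>2)) \<in> borel_measurable (obs_space N)"
    unfolding S2_norm_eq_norm by measurable
  have "risk2 B N Ahat A = (\<integral>\<^sup>+\<epsilon>. ennreal ((norm (Ahat (obs_of B N (innovation_path M N \<epsilon>)) - A))\<^sup>2) \<partial>noise N)"
    unfolding risk2_def traj_law_def eq using m2 by (subst nn_integral_distr[OF m]) (simp_all add: S2_norm_eq_norm)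
  also have "\<dots> = (\<integral>\<^sup>+w. ennreal (exp (loglik M N w)) * ennreal ((norm (Ahat (obs_of B N w) - A))\<^sup>2) \<partial>noise N)"
    by (rule nn_integral_innovation_path) (rule measurable_compose[OF measurable_obs_of], measurable)
  finally show ?thesis .
qed

lemma nn_integral_exp_loglik: "(\<integral>\<^sup>+w. ennreal (exp (loglik M N w)) \<partial>noise N) = 1"
proof -
  interpret prob_space "noise N :: (nat \<Rightarrow> real^'a) measure" by (rule prob_space_noise)
  show ?thesis using nn_integral_innovation_path[of "\<lambda>_. 1" N M] by (simp add: emeasure_space_1)
qed

lemma info_nonneg: "0 \<le> info C M N"
  by (simp add: info_def sum_nonneg)

text \<open>The density is unnormalised: everything is homogeneous in \<open>q\<close>, and the mass
  \<open>Q\<close> cancels only at the end of \<open>prior_risk_bound\<close>.\<close>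

locale smooth_prior =
  fixes q :: "'e::euclidean_space \<Rightarrow> real" and dq :: "'e \<Rightarrow> 'e \<Rightarrow> real" and R Q :: real
  assumes continuous_q: "continuous_on UNIV q"
    and q_nonneg: "0 \<le> q z"
    and q_support: "R < norm z \<Longrightarrow> q z = 0"
    and continuous_dq: "b \<in> Basis \<Longrightarrow> continuous_on UNIV (dq b)"
    and dq_eq_0: "b \<in> Basis \<Longrightarrow> q z = 0 \<Longrightarrow> dq b z = 0"
    and dq_derivative: "b \<in> Basis \<Longrightarrow> ((\<lambda>t. q (z + t *\<^sub>R b)) has_real_derivative dq b z) (at 0)"
    and q_integral: "(\<integral>\<^sup>+z. ennreal (q z) \<partial>lborel) = ennreal Q"
    and Q_pos: "0 < Q"
begin

lemma measurable_q[measurable]: "q \<in> borel_measurable borel"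
  using continuous_q by (rule borel_measurable_continuous_onI)

lemma measurable_dq: "b \<in> Basis \<Longrightarrow> dq b \<in> borel_measurable borel"
  using continuous_dq by (rule borel_measurable_continuous_onI)

text \<open>The inequality for a fixed path is integrated over all paths and the order of
  integration is swapped, all integrands being nonnegative. The second moment of the score plus
  \<open>dq b z / q z\<close> then splits by \<open>score_second_moment\<close> into
  \<open>info\<close> and a square, the score being centred.\<close>

lemma van_Trees_coordinate:
  fixes \<Phi> :: "'e \<Rightarrow> real^'n^'n" and M0 :: "real^'n^'n"
  assumes lin: "linear \<Phi>" and b: "b \<in> Basis" and c: "0 \<le> c"
    and \<psi>[measurable]: "\<psi> \<in> borel_measurable (noise N)"
  shows "ennreal (2 * c) * ennreal Q
    \<le> (\<integral>\<^sup>+z. ennreal (q z) * (\<integral>\<^sup>+w. ennreal (exp (loglik (M0 + \<Phi> z) N w)) * ennreal ((\<psi> w - z \<bullet> b)\<^sup>2) \<partial>noise N) \<partial>lborel)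
      + ennreal (c\<^sup>2) * (\<integral>\<^sup>+z. ennreal (q z * info (\<Phi> b) (M0 + \<Phi> z) N + (dq b z)\<^sup>2 / q z) \<partial>lborel)"
    (is "?lhs \<le> ?r1 + ennreal (c\<^sup>2) * ?r2")
proof -
  interpret noise: prob_space "noise N :: (nat \<Rightarrow> real^'n) measure" by (rule prob_space_noise)
  interpret P: pair_sigma_finite "lborel :: 'e measure" "noise N :: (nat \<Rightarrow> real^'n) measure" ..
  define M where "M z = M0 + \<Phi> z" for z
  define L where "L w z = exp (loglik (M z) N w)" for w z
  define l where "l w z = score (\<Phi> b) (M z) N w" for w z
  define h where "h z = dq b z / q z" for z
  have c\<Phi>: "continuous_on UNIV \<Phi>" using lin by (simp add: linear_continuous_on linear_conv_bounded_linear)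
  have cM: "continuous_on UNIV M" unfolding M_def by (intro continuous_intros c\<Phi>)
  have [measurable]: "M \<in> borel_measurable borel" "dq b \<in> borel_measurable borel" "h \<in> borel_measurable borel"
    using cM measurable_dq[OF b] unfolding h_def[abs_def] by (auto intro: borel_measurable_continuous_onI)
  have mL[measurable]: "(\<lambda>x. loglik (M (fst x)) N (snd x)) \<in> borel_measurable (lborel \<Otimes>\<^sub>M noise N)"
    by (rule measurable_loglik) measurable
  have ml[measurable]: "(\<lambda>x. score (\<Phi> b) (M (fst x)) N (snd x)) \<in> borel_measurable (lborel \<Otimes>\<^sub>M noise N)"
    by (rule measurable_score) measurable
  have mLw[measurable]: "(\<lambda>w. ennreal (L w z)) \<in> borel_measurable (noise N)" for z
    unfolding L_def by (rule measurable_compose[OF measurable_loglik]) measurable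
  have mlw[measurable]: "(\<lambda>w. l w z) \<in> borel_measurable (noise N)" for z
    unfolding l_def by (rule measurable_score) measurable
  have [measurable]: "L w \<in> borel_measurable borel" "l w \<in> borel_measurable borel" 
    if "w \<in> space (noise N)" for w
    unfolding L_def[abs_def] l_def[abs_def]
    using measurable_compose[OF measurable_Pair2'[OF that] mL] measurable_compose[OF measurable_Pair2'[OF that] ml]
    by simp_all
  have cont: "continuous_on UNIV (L w)" "continuous_on UNIV (l w)" for w
    unfolding L_def[abs_def] l_def[abs_def] loglik_def score_def
    by (intro continuous_intros cM; simp)+
  have Mb: "M (z + t *\<^sub>R b) = M z + t *\<^sub>R \<Phi> b" for z t
    by (simp add: M_def linear_add[OF lin] linear_cmul[OF lin])
  have derL: "((\<lambda>t. L w (z + t *\<^sub>R b)) has_real_derivative L w z * l w z) (at 0)" for w z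
    unfolding L_def l_def Mb using DERIV_fun_exp[OF loglik_has_derivative] by simp
  have "ennreal (2 * c) * (\<integral>\<^sup>+z. ennreal (L w z * q z) \<partial>lborel)
    \<le> (\<integral>\<^sup>+z. ennreal ((\<psi> w - z \<bullet> b)\<^sup>2 * (L w z * q z)) \<partial>lborel)
      + ennreal (c\<^sup>2) * (\<integral>\<^sup>+z. ennreal (L w z * (q z * (l w z + h z)\<^sup>2)) \<partial>lborel)" for w
    unfolding h_def
    by (rule van_Trees_pointwise[OF b c continuous_q q_nonneg q_support continuous_dq[OF b]
          dq_eq_0[OF b] dq_derivative[OF b] cont(1) _ derL cont(2)]) (auto simp: L_def)
  then have pw: "(\<integral>\<^sup>+w. ennreal (2 * c) * (\<integral>\<^sup>+z. ennreal (L w z * q z) \<partial>lborel) \<partial>noise N)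
    \<le> (\<integral>\<^sup>+w. (\<integral>\<^sup>+z. ennreal ((\<psi> w - z \<bullet> b)\<^sup>2 * (L w z * q z)) \<partial>lborel)
      + ennreal (c\<^sup>2) * (\<integral>\<^sup>+z. ennreal (L w z * (q z * (l w z + h z)\<^sup>2)) \<partial>lborel) \<partial>noise N)"
    by (intro nn_integral_mono)
  have m1: "(\<lambda>(z, w). ennreal (L w z * q z)) \<in> borel_measurable (lborel \<Otimes>\<^sub>M noise N)"
    and m2: "(\<lambda>(z, w). ennreal ((\<psi> w - z \<bullet> b)\<^sup>2 * (L w z * q z))) \<in> borel_measurable (lborel \<Otimes>\<^sub>M noise N)"
    and m3: "(\<lambda>(z, w). ennreal (L w z * (q z * (l w z + h z)\<^sup>2))) \<in> borel_measurable (lborel \<Otimes>\<^sub>M noise N)"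
    unfolding L_def l_def case_prod_unfold by measurable
  have int: "(\<lambda>w. \<integral>\<^sup>+z. f z w \<partial>lborel) \<in> borel_measurable (noise N)"
    if "(\<lambda>(z, w). f z w) \<in> borel_measurable (lborel \<Otimes>\<^sub>M noise N)" for f :: "'e \<Rightarrow> _ \<Rightarrow> ennreal"
    using lborel.borel_measurable_nn_integral[OF measurable_pair_swap[OF that, simplified]] by simp
  have L0: "0 \<le> L w z" for w z by (simp add: L_def)
  have "?lhs = ennreal (2 * c) * (\<integral>\<^sup>+z. ennreal (q z) * (\<integral>\<^sup>+w. ennreal (L w z) \<partial>noise N) \<partial>lborel)"
    by (simp add: L_def nn_integral_exp_loglik q_integral)
  also have "\<dots> = ennreal (2 * c) * (\<integral>\<^sup>+z. \<integral>\<^sup>+w. ennreal (L w z * q z) \<partial>noise N \<partial>lborel)"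
    by (subst nn_integral_cmult[symmetric]) (auto simp: ennreal_mult L_def q_nonneg mult.commute)
  also have "\<dots> = ennreal (2 * c) * (\<integral>\<^sup>+w. \<integral>\<^sup>+z. ennreal (L w z * q z) \<partial>lborel \<partial>noise N)"
    by (subst P.Fubini'[OF m1]) simp
  also have "\<dots> = (\<integral>\<^sup>+w. ennreal (2 * c) * (\<integral>\<^sup>+z. ennreal (L w z * q z) \<partial>lborel) \<partial>noise N)"
    by (rule nn_integral_cmult[symmetric]) (rule int[OF m1])
  also note pw
  also have "(\<integral>\<^sup>+w. (\<integral>\<^sup>+z. ennreal ((\<psi> w - z \<bullet> b)\<^sup>2 * (L w z * q z)) \<partial>lborel)
      + ennreal (c\<^sup>2) * (\<integral>\<^sup>+z. ennreal (L w z * (q z * (l w z + h z)\<^sup>2)) \<partial>lborel) \<partial>noise N)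
    = (\<integral>\<^sup>+w. \<integral>\<^sup>+z. ennreal ((\<psi> w - z \<bullet> b)\<^sup>2 * (L w z * q z)) \<partial>lborel \<partial>noise N)
      + ennreal (c\<^sup>2) * (\<integral>\<^sup>+w. \<integral>\<^sup>+z. ennreal (L w z * (q z * (l w z + h z)\<^sup>2)) \<partial>lborel \<partial>noise N)"
    using int[OF m2] int[OF m3] by (subst nn_integral_add) (auto simp: nn_integral_cmult)
  also have "(\<integral>\<^sup>+w. \<integral>\<^sup>+z. ennreal ((\<psi> w - z \<bullet> b)\<^sup>2 * (L w z * q z)) \<partial>lborel \<partial>noise N)
    = (\<integral>\<^sup>+z. \<integral>\<^sup>+w. ennreal ((\<psi> w - z \<bullet> b)\<^sup>2 * (L w z * q z)) \<partial>noise N \<partial>lborel)"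
    by (rule P.Fubini'[OF m2])
  also have "\<dots> = ?r1"
    by (subst nn_integral_cmult[symmetric])
      (auto simp: ennreal_mult L0 q_nonneg mult_ac M_def L_def intro!: nn_integral_cong)
  also have "(\<integral>\<^sup>+w. \<integral>\<^sup>+z. ennreal (L w z * (q z * (l w z + h z)\<^sup>2)) \<partial>lborel \<partial>noise N)
    = (\<integral>\<^sup>+z. \<integral>\<^sup>+w. ennreal (L w z * (q z * (l w z + h z)\<^sup>2)) \<partial>noise N \<partial>lborel)"
    by (rule P.Fubini'[OF m3])
  also have "\<dots> = (\<integral>\<^sup>+z. ennreal (q z) * (\<integral>\<^sup>+w. ennreal (exp (loglik (M z) N w)) * ennreal ((h z + score (\<Phi> b) (M z) N w)\<^sup>2) \<partial>noise N) \<partial>lborel)"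
    using mLw mlw by (subst nn_integral_cmult[symmetric])
      (auto simp: ennreal_mult L0 q_nonneg mult_ac add.commute simp flip: L_def l_def intro!: nn_integral_cong)
  also have "\<dots> = ?r2"
  proof (rule nn_integral_cong)
    fix z
    \<comment> \<open>Where \<open>q\<close> vanishes so does \<open>dq b\<close>, and division by 0
      gives 0 on both sides.\<close>
    have "q z * ((h z)\<^sup>2 + info (\<Phi> b) (M z) N) = q z * info (\<Phi> b) (M z) N + (dq b z)\<^sup>2 / q z"
      by (cases "q z = 0") (auto simp: h_def dq_eq_0[OF b] field_simps power2_eq_square)
    then show "ennreal (q z) * (\<integral>\<^sup>+w. ennreal (exp (loglik (M z) N w)) * ennreal ((h z + score (\<Phi> b) (M z) N w)\<^sup>2) \<partial>noise N)
      = ennreal (q z * info (\<Phi> b) (M0 + \<Phi> z) N + (dq b z)\<^sup>2 / q z)"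
      unfolding score_second_moment M_def[symmetric]
      by (simp add: q_nonneg info_nonneg del: ennreal_plus flip: ennreal_mult)
  qed
  finally show ?thesis .
qed

text \<open>\<open>\<psi> b\<close> extracts from an estimated matrix an estimate of the coordinate
  \<open>z \<bullet> b\<close>, and \<open>a b\<close> is the weight of its squared error in the
  Frobenius loss. Each coordinate has its own van Trees bound; the mean over the prior is at most
  the supremum over \<open>C\<close>.\<close>

theorem prior_risk_bound:
  fixes \<Phi> :: "'e \<Rightarrow> real^'n^'n" and M0 B :: "real^'n^'n" and A :: "'e \<Rightarrow> real^'n^'n"
    and V a :: "'e \<Rightarrow> real" and \<psi> :: "'e \<Rightarrow> real^'n^'n \<Rightarrow> real"
  assumes lin: "linear \<Phi>"
    and Ahat[measurable]: "Ahat \<in> borel_measurable (obs_space N)"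
    and A: "\<And>z. A z ** B = B ** (M0 + \<Phi> z)" "continuous_on UNIV A"
    and \<psi>: "\<And>b. b \<in> Basis \<Longrightarrow> \<psi> b \<in> borel_measurable borel"
    and a: "\<And>b. b \<in> Basis \<Longrightarrow> 0 \<le> a b"
      "\<And>W z. (\<Sum>b\<in>Basis. a b * (\<psi> b W - z \<bullet> b)\<^sup>2) \<le> (norm (W - A z))\<^sup>2"
    and V: "\<And>b. b \<in> Basis \<Longrightarrow> 0 < V b"
      "\<And>b. b \<in> Basis \<Longrightarrow> (\<integral>\<^sup>+z. ennreal (q z * info (\<Phi> b) (M0 + \<Phi> z) N + (dq b z)\<^sup>2 / q z) \<partial>lborel) \<le> ennreal (V b * Q)"
    and C: "\<And>z. 0 < q z \<Longrightarrow> A z \<in> C"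
  shows "ennreal (\<Sum>b\<in>Basis. a b / V b) \<le> (SUP A\<in>C. risk2 B N Ahat A)"
proof -
  define S where "S = (SUP A\<in>C. risk2 B N Ahat A)"
  define X where "X w = Ahat (obs_of B N w)" for w
  have [measurable]: "X \<in> borel_measurable (noise N)"
    unfolding X_def[abs_def] by (rule measurable_compose[OF measurable_obs_of]) measurable
  define M where "M z = M0 + \<Phi> z" for z
  have cM: "continuous_on UNIV M" unfolding M_def
    using lin by (intro continuous_intros) (simp add: linear_continuous_on linear_conv_bounded_linear)
  have [measurable]: "M \<in> borel_measurable borel" "A \<in> borel_measurable borel"
    using cM A(2) by (auto intro: borel_measurable_continuous_onI)
  define D where "D b z = (\<integral>\<^sup>+w. ennreal (exp (loglik (M z) N w)) * ennreal ((\<psi> b (X w) - z \<bullet> b)\<^sup>2) \<partial>noise N)" for b z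
  interpret noise: prob_space "noise N :: (nat \<Rightarrow> real^'n) measure" by (rule prob_space_noise)
  have mL[measurable]: "(\<lambda>x. loglik (M (fst x)) N (snd x)) \<in> borel_measurable (lborel \<Otimes>\<^sub>M noise N)"
    by (rule measurable_loglik) measurable
  have mLw: "(\<lambda>w. ennreal (exp (loglik (M z) N w))) \<in> borel_measurable (noise N)" for z
    by (rule measurable_compose[OF measurable_loglik]) measurable
  have mD[measurable]: "D b \<in> borel_measurable borel" if b: "b \<in> Basis" for b
  proof -
    note \<psi>[OF b, measurable]
    have "(\<lambda>(z, w). ennreal (exp (loglik (M z) N w)) * ennreal ((\<psi> b (X w) - z \<bullet> b)\<^sup>2)) \<in> borel_measurable (lborel \<Otimes>\<^sub>M noise N)"
      unfolding case_prod_unfold by measurable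
    from noise.borel_measurable_nn_integral[OF this]
    show ?thesis unfolding D_def[abs_def] by simp
  qed
  have lower: "ennreal (Q / V b) \<le> (\<integral>\<^sup>+z. ennreal (q z) * D b z \<partial>lborel)" if b: "b \<in> Basis" for b
  proof -
    note \<psi>[OF b, measurable]
    \<comment> \<open>\<open>c = 1 / V b\<close> maximises \<open>2 * c - c\<^sup>2 * V b\<close>.
      The left side is a sum so that one copy cancels against the information term, without
      subtraction in \<open>ennreal\<close>.\<close>
    have "ennreal (Q / V b) + ennreal (Q / V b) = ennreal (2 * (1 / V b)) * ennreal Q"
      using V(1)[OF b] Q_pos by (simp flip: ennreal_plus ennreal_mult)
    also have "\<dots> \<le> (\<integral>\<^sup>+z. ennreal (q z) * D b z \<partial>lborel) + ennreal ((1 / V b)\<^sup>2) *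
       (\<integral>\<^sup>+z. ennreal (q z * info (\<Phi> b) (M0 + \<Phi> z) N + (dq b z)\<^sup>2 / q z) \<partial>lborel)"
      using van_Trees_coordinate[OF lin b, of "1 / V b" "\<lambda>w. \<psi> b (X w)" N M0] V(1)[OF b]
      by (simp add: D_def M_def)
    also have "\<dots> \<le> (\<integral>\<^sup>+z. ennreal (q z) * D b z \<partial>lborel) + ennreal ((1 / V b)\<^sup>2) * ennreal (V b * Q)"
      by (intro add_mono mult_left_mono V(2) b) auto
    also have "ennreal ((1 / V b)\<^sup>2) * ennreal (V b * Q) = ennreal (Q / V b)"
      using V(1)[OF b] Q_pos by (simp add: power2_eq_square flip: ennreal_mult)
    finally show ?thesis by (simp add: ennreal_add_left_cancel_le add.commute)
  qed
  have risk: "(\<Sum>b\<in>Basis. ennreal (a b) * D b z) \<le> risk2 B N Ahat (A z)" for z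
  proof -
    have "(\<Sum>b\<in>Basis. ennreal (a b) * D b z)
      = (\<integral>\<^sup>+w. ennreal (exp (loglik (M z) N w)) * ennreal (\<Sum>b\<in>Basis. a b * (\<psi> b (X w) - z \<bullet> b)\<^sup>2) \<partial>noise N)"
    proof -
      have *: "ennreal (exp (loglik (M z) N w)) * ennreal (\<Sum>b\<in>Basis. a b * (\<psi> b (X w) - z \<bullet> b)\<^sup>2)
        = (\<Sum>b\<in>Basis. ennreal (a b) * (ennreal (exp (loglik (M z) N w)) * ennreal ((\<psi> b (X w) - z \<bullet> b)\<^sup>2)))" for w
        by (subst sum_ennreal[symmetric]) (auto simp: a(1) sum_distrib_left ennreal_mult mult_ac)
      have m: "(\<lambda>w. ennreal (exp (loglik (M z) N w)) * ennreal ((\<psi> b (X w) - z \<bullet> b)\<^sup>2)) \<in> borel_measurable (noise N)"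
        if "b \<in> Basis" for b
        using \<psi>[OF that] mLw by measurable
      show ?thesis unfolding * D_def
        using m by (subst nn_integral_sum) (auto simp: nn_integral_cmult)
    qed
    also have "\<dots> \<le> (\<integral>\<^sup>+w. ennreal (exp (loglik (M z) N w)) * ennreal ((norm (X w - A z))\<^sup>2) \<partial>noise N)"
      by (intro nn_integral_mono mult_left_mono ennreal_leI a(2)) auto
    also have "\<dots> = risk2 B N Ahat (A z)"
      unfolding M_def X_def by (rule risk2_eq[OF A(1) Ahat, symmetric])
    finally show ?thesis .
  qed
  have "ennreal (\<Sum>b\<in>Basis. a b / V b) * ennreal Q = (\<Sum>b\<in>Basis. ennreal (a b) * ennreal (Q / V b))"
  proof -
    have "ennreal (\<Sum>b\<in>Basis. a b / V b) * ennreal Q = ennreal (\<Sum>b\<in>Basis. a b * (Q / V b))"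
    proof -
      have "(\<Sum>b\<in>Basis. a b / V b) * Q = (\<Sum>b\<in>Basis. a b * (Q / V b))"
        unfolding sum_distrib_right by (intro sum.cong) auto
      moreover have "0 \<le> (\<Sum>b\<in>Basis. a b / V b)"
        using V(1) a(1) by (intro sum_nonneg divide_nonneg_nonneg) (auto simp: less_imp_le)
      ultimately show ?thesis using Q_pos by (simp flip: ennreal_mult)
    qed
    also have "\<dots> = (\<Sum>b\<in>Basis. ennreal (a b * (Q / V b)))"
      using V(1) a(1) Q_pos by (subst sum_ennreal) (auto simp: less_imp_le)
    also have "\<dots> = (\<Sum>b\<in>Basis. ennreal (a b) * ennreal (Q / V b))"
      using V(1) a(1) Q_pos by (intro sum.cong refl ennreal_mult) (auto simp: less_imp_le)
    finally show ?thesis .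
  qed
  also have "\<dots> \<le> (\<Sum>b\<in>Basis. ennreal (a b) * (\<integral>\<^sup>+z. ennreal (q z) * D b z \<partial>lborel))"
    by (intro sum_mono mult_left_mono lower) auto
  also have "\<dots> = (\<integral>\<^sup>+z. ennreal (q z) * (\<Sum>b\<in>Basis. ennreal (a b) * D b z) \<partial>lborel)"
  proof -
    have "(\<Sum>b\<in>Basis. ennreal (a b) * (\<integral>\<^sup>+z. ennreal (q z) * D b z \<partial>lborel))
      = (\<Sum>b\<in>Basis. \<integral>\<^sup>+z. ennreal (a b) * (ennreal (q z) * D b z) \<partial>lborel)"
      by (intro sum.cong refl nn_integral_cmult[symmetric]) simp
    also have "\<dots> = (\<integral>\<^sup>+z. (\<Sum>b\<in>Basis. ennreal (a b) * (ennreal (q z) * D b z)) \<partial>lborel)"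
      by (rule nn_integral_sum[symmetric]) simp
    finally show ?thesis by (simp add: sum_distrib_left mult.left_commute)
  qed
  also have "\<dots> \<le> (\<integral>\<^sup>+z. S * ennreal (q z) \<partial>lborel)"
  proof (rule nn_integral_mono)
    fix z
    show "ennreal (q z) * (\<Sum>b\<in>Basis. ennreal (a b) * D b z) \<le> S * ennreal (q z)"
    \<comment> \<open>Only where the prior is positive is \<open>A z\<close> known to lie in
      \<open>C\<close>.\<close>
    proof (cases "q z = 0")
      case False
      then have "A z \<in> C" using C q_nonneg[of z] by (simp add: less_le)
      then have "risk2 B N Ahat (A z) \<le> S" unfolding S_def by (rule SUP_upper)
      then show ?thesis using risk[of z] by (subst mult.commute) (intro mult_right_mono, auto)
    qed simp
  qed
  also have "\<dots> = S * ennreal Q"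
    by (simp add: nn_integral_cmult q_integral)
  finally have "ennreal (\<Sum>b\<in>Basis. a b / V b) * ennreal Q \<le> S * ennreal Q" .
  then show ?thesis unfolding S_def[symmetric]
    using Q_pos by (simp add: ennreal_mult_le_mult_iff mult.commute[of _ "ennreal Q"])
qed

end

section \<open>A prior on the unit ball\<close>

text \<open>The delicate point is 0: there the difference quotient is
  \<open>max 0 h ^ (k - 1)\<close>, which tends to 0 because \<open>k \<ge> 2\<close>.\<close>

lemma DERIV_max0_power:
  fixes x :: real
  assumes "2 \<le> k"
  shows "((\<lambda>t. max 0 t ^ k) has_real_derivative real k * max 0 x ^ (k - 1)) (at x)"
proof -
  consider "x > 0" | "x < 0" | "x = 0" by linarith
  then show ?thesis
  proof cases
    case 1
    have "((\<lambda>t. t ^ k) has_real_derivative real k * max 0 x ^ (k - 1)) (at x)"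
      using 1 by (auto intro!: derivative_eq_intros)
    then show ?thesis
      by (rule has_field_derivative_transform_within_open[where S="{0<..}"]) (use 1 in auto)
  next
    case 2
    have "((\<lambda>t. 0) has_real_derivative real k * max 0 x ^ (k - 1)) (at x)"
      using 2 assms by (simp add: max_def zero_power)
    then show ?thesis
      by (rule has_field_derivative_transform_within_open[where S="{..<0}"])
        (use 2 assms in \<open>auto simp: max_def zero_power\<close>)
  next
    case 3
    have "(max 0 h ^ k - max 0 0 ^ k) / h = max 0 h ^ (k - 1)" if "h \<noteq> 0" for h :: real
      using that assms by (cases k) (auto simp: max_def)
    then have "eventually (\<lambda>h. max 0 h ^ (k - 1) = (max 0 (0 + h) ^ k - max 0 0 ^ k) / h) (at (0::real))"
      by (auto simp: eventually_at_filter)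
    moreover have "((\<lambda>h::real. max 0 h ^ (k - 1)) \<longlongrightarrow> max 0 0 ^ (k - 1)) (at 0)"
      by (intro tendsto_intros)
    ultimately show ?thesis using 3 assms unfolding DERIV_def
      by (simp add: zero_power tendsto_cong)
  qed
qed

text \<open>Differentiation lowers the exponent by one and brings out a coordinate, so the integrals
  needed below reduce to those of \<open>bump\<close> by recursion in \<open>k\<close>.\<close>

definition bump :: "nat \<Rightarrow> 'e::euclidean_space \<Rightarrow> real" where
  "bump k z = max 0 (1 - (norm z)\<^sup>2) ^ k"

lemma bump_nonneg: "0 \<le> bump k z"
  by (simp add: bump_def)

lemma continuous_on_bump[continuous_intros]: "continuous_on S (bump k)"
  unfolding bump_def[abs_def] by (intro continuous_intros)

lemma bump_eq_0: "0 < k \<Longrightarrow> bump k z = 0 \<longleftrightarrow> 1 \<le> norm z"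
  using abs_square_le_1[of "norm z"] power2_eq_1_iff[of "norm z"] norm_ge_zero[of z]
  by (auto simp: bump_def max_def abs_le_square_iff[of 1, simplified] simp del: norm_ge_zero)

lemma bump_outside: "0 < k \<Longrightarrow> 1 \<le> norm z \<Longrightarrow> bump k z = 0"
  by (simp add: bump_eq_0)

lemma bump_derivative:
  assumes "2 \<le> k"
  shows "((\<lambda>t. bump k (z + t *\<^sub>R b)) has_real_derivative - 2 * real k * (z \<bullet> b) * bump (k - 1) z) (at 0)"
proof -
  have "((\<lambda>t. 1 - (norm (z + t *\<^sub>R b))\<^sup>2) has_real_derivative - 2 * (z \<bullet> b)) (at 0)"
    unfolding power2_norm_eq_inner inner_add
    by (auto intro!: derivative_eq_intros simp: inner_commute)
  from DERIV_chain[OF DERIV_max0_power[OF assms] this] show ?thesis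
    unfolding bump_def o_def by (simp add: mult_ac)
qed

definition bump_integral :: "'e::euclidean_space itself \<Rightarrow> nat \<Rightarrow> real" where
  "bump_integral _ k = (\<integral>z. bump k z \<partial>(lborel :: 'e measure))"

lemma integrable_bump_mult:
  fixes f :: "'e::euclidean_space \<Rightarrow> real"
  assumes "0 < k" "continuous_on UNIV f"
  shows "integrable lborel (\<lambda>z. f z * bump k z)"
  using assms by (intro integrable_continuous_bounded_support[where R=1] continuous_intros) (auto simp: bump_eq_0)

lemma integrable_bump: "0 < k \<Longrightarrow> integrable lborel (bump k)"
  using integrable_bump_mult[of k "\<lambda>_. 1"] by simp

text \<open>The derivative along \<open>b\<close> of \<open>(z \<bullet> b) * bump (k + 1) z\<close>
  integrates to 0.\<close>

lemma bump_second_moment: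
  fixes b :: "'e::euclidean_space"
  assumes "0 < k" "b \<in> Basis"
  shows "2 * real (k + 1) * (\<integral>z. (z \<bullet> b)\<^sup>2 * bump k z \<partial>lborel) = bump_integral TYPE('e) (k + 1)"
proof -
  define G where "G z = bump (k + 1) z - 2 * real (k + 1) * ((z \<bullet> b)\<^sup>2 * bump k z)" for z :: 'e
  have "((\<lambda>t. ((z + t *\<^sub>R b) \<bullet> b) * bump (k + 1) (z + t *\<^sub>R b)) has_real_derivative G z) (at 0)" for z
  proof -
    have "((\<lambda>t. (z \<bullet> b + t) * bump (k + 1) (z + t *\<^sub>R b)) has_real_derivative
        1 * bump (k + 1) (z + 0 *\<^sub>R b) + (- 2 * real (k + 1) * (z \<bullet> b) * bump (k + 1 - 1) z) * (z \<bullet> b + 0)) (at 0)"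
      using assms by (intro DERIV_mult bump_derivative) (auto intro!: derivative_eq_intros)
    then show ?thesis using assms by (simp add: G_def inner_add_left power2_eq_square algebra_simps)
  qed
  then have "(\<integral>z. G z \<partial>lborel) = 0"
    using assms unfolding G_def
    by (intro integral_directional_derivative[where R=1 and F="\<lambda>z. (z \<bullet> b) * bump (k + 1) z" and b=b] continuous_intros)
      (auto simp: bump_outside)
  moreover have "integrable lborel (\<lambda>z::'e. bump (k + 1) z)" "integrable lborel (\<lambda>z. (z \<bullet> b)\<^sup>2 * bump k z)"
    using assms by (auto intro!: integrable_bump integrable_bump_mult continuous_intros)
  ultimately show ?thesis by (simp add: G_def bump_integral_def)
qed

text \<open>Inside the ball \<open>bump (k + 1)\<close> is \<open>bump k\<close> times
  \<open>1 - (norm z)\<^sup>2\<close>, so the two integrals differ by the sum of the second moments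
  of all coordinates.\<close>

lemma bump_integral_Suc:
  assumes "0 < k"
  shows "bump_integral TYPE('e::euclidean_space) k = (1 + DIM('e) / (2 * real (k + 1))) * bump_integral TYPE('e) (k + 1)"
proof -
  have "(norm z)\<^sup>2 * bump k z = bump k z - bump (k + 1) z" for z :: 'e
    using assms by (cases "norm z \<le> 1") 
      (auto simp: bump_def max_def abs_square_le_1 algebra_simps zero_power)
  then have "(\<Sum>b\<in>Basis. (z \<bullet> b)\<^sup>2 * bump k z) = bump k z - bump (k + 1) z" for z :: 'e
    by (simp add: sum_distrib_right[symmetric] flip: norm_eq_sqrt_inner power2_norm_eq_inner euclidean_inner[of z z, folded power2_eq_square])
  then have "bump_integral TYPE('e) k - bump_integral TYPE('e) (k + 1) = (\<integral>z. (\<Sum>b\<in>Basis. (z \<bullet> b)\<^sup>2 * bump k z) \<partial>(lborel :: 'e measure))"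
    using assms unfolding bump_integral_def
    by (subst Bochner_Integration.integral_diff[symmetric]) (auto intro!: integrable_bump)
  also have "\<dots> = (\<Sum>b\<in>Basis. (\<integral>z. (z \<bullet> b)\<^sup>2 * bump k z \<partial>(lborel :: 'e measure)))"
    using assms by (intro Bochner_Integration.integral_sum integrable_bump_mult continuous_intros)
  also have "\<dots> = (\<Sum>b\<in>(Basis :: 'e set). bump_integral TYPE('e) (k + 1) / (2 * real (k + 1)))"
    using bump_second_moment[OF assms] by (intro sum.cong) (auto simp: field_simps)
  finally show ?thesis by (simp add: field_simps)
qed

lemma bump_integral_pos: "0 < k \<Longrightarrow> 0 < bump_integral TYPE('e::euclidean_space) k"
proof -
  assume k: "0 < k"
  have "(3/4) ^ k * indicator (ball 0 (1/2)) z \<le> bump k z" for z :: 'e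
  proof (cases "norm z < 1/2")
    case True
    then have "(norm z)\<^sup>2 \<le> (1/2)\<^sup>2" by (intro power_mono) auto
    then show ?thesis using True by (auto simp: bump_def power2_eq_square intro!: power_mono)
  qed (auto simp: bump_nonneg)
  then have "(\<integral>z. (3/4) ^ k * indicator (ball 0 (1/2)) z \<partial>(lborel :: 'e measure)) \<le> bump_integral TYPE('e) k"
    unfolding bump_integral_def using k emeasure_lborel_ball_finite[of "0::'e" "1/2"]
    by (intro integral_mono integrable_bump integrable_mult_right integrable_real_indicator) auto
  then have "(3/4) ^ k * measure (lborel :: 'e measure) (ball 0 (1/2)) \<le> bump_integral TYPE('e) k" by simp
  moreover have "0 < (3/4) ^ k * measure (lborel :: 'e measure) (ball 0 (1/2))"
    by (intro mult_pos_pos content_ball_pos) auto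
  ultimately show ?thesis by (rule less_le_trans[rotated])
qed

lemma bump_smooth_prior:
  assumes "3 \<le> p"
  shows "smooth_prior (bump p :: 'e::euclidean_space \<Rightarrow> real)
    (\<lambda>b z. - 2 * real p * (z \<bullet> b) * bump (p - 1) z) 1 (bump_integral TYPE('e) p)"
proof
  show "(\<integral>\<^sup>+z. ennreal (bump p (z :: 'e)) \<partial>lborel) = ennreal (bump_integral TYPE('e) p)"
    unfolding bump_integral_def using assms
    by (intro nn_integral_eq_integral integrable_bump) (auto simp: bump_nonneg)
  show "((\<lambda>t. bump p (z + t *\<^sub>R b)) has_real_derivative - 2 * real p * (z \<bullet> b) * bump (p - 1) z) (at 0)"
    for b z :: 'e
    using assms by (intro bump_derivative) simp
qed (use assms in \<open>auto simp: bump_nonneg bump_eq_0 bump_integral_pos intro!: continuous_intros\<close>)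

text \<open>The square of \<open>bump (p - 1)\<close> divided by \<open>bump p\<close> is
  \<open>bump (p - 2)\<close>, which is why \<open>p \<ge> 3\<close>. Its second moment is led back
  to \<open>bump_integral\<close> at \<open>p\<close> by \<open>bump_second_moment\<close>, the
  source of \<open>p - 1\<close>, and \<open>bump_integral_Suc\<close>, the source of
  \<open>2 * p + DIM('e)\<close>.\<close>

lemma bump_information:
  fixes b :: "'e::euclidean_space"
  assumes p: "3 \<le> p" and b: "b \<in> Basis"
    and n: "\<And>z. norm z < 1 \<Longrightarrow> f z \<le> n" "0 \<le> n"
  shows "(\<integral>\<^sup>+z. ennreal (bump p z * f z + (- 2 * real p * (z \<bullet> b) * bump (p - 1) z)\<^sup>2 / bump p z) \<partial>lborel)
    \<le> ennreal ((n + real p * (2 * real p + DIM('e)) / (real p - 1)) * bump_integral TYPE('e) p)"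
proof -
  have le: "bump p z * f z + (- 2 * real p * (z \<bullet> b) * bump (p - 1) z)\<^sup>2 / bump p z
    \<le> n * bump p z + 4 * (real p)\<^sup>2 * ((z \<bullet> b)\<^sup>2 * bump (p - 2) z)" for z
  proof (cases "norm z < 1")
    case True
    then have "bump p z * f z \<le> n * bump p z" using n by (simp add: mult.commute mult_right_mono bump_nonneg)
    moreover have "(bump (p - 1) z)\<^sup>2 = bump p z * bump (p - 2) z"
    proof -
      have "(p - 1) * 2 = p + (p - 2)" using p by simp
      then show ?thesis unfolding bump_def power_mult[symmetric] power_add[symmetric] by simp
    qed
    moreover have "bump p z \<noteq> 0" using True p by (simp add: bump_eq_0)
    ultimately show ?thesis by (simp add: power_mult_distrib)
  next
    case False
    then have "bump p z = 0" using p by (simp add: bump_eq_0)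
    then show ?thesis by (simp add: bump_nonneg)
  qed
  have int: "integrable lborel (\<lambda>z. n * bump p z + 4 * (real p)\<^sup>2 * ((z \<bullet> b)\<^sup>2 * bump (p - 2) z))"
    using p by (intro Bochner_Integration.integrable_add integrable_mult_right integrable_bump integrable_bump_mult continuous_intros) auto
  have "(\<integral>\<^sup>+z. ennreal (bump p z * f z + (- 2 * real p * (z \<bullet> b) * bump (p - 1) z)\<^sup>2 / bump p z) \<partial>lborel)
    \<le> (\<integral>\<^sup>+z. ennreal (n * bump p z + 4 * (real p)\<^sup>2 * ((z \<bullet> b)\<^sup>2 * bump (p - 2) z)) \<partial>lborel)"
    using le by (intro nn_integral_mono ennreal_leI)
  also have "\<dots> = ennreal (\<integral>z. n * bump p z + 4 * (real p)\<^sup>2 * ((z \<bullet> b)\<^sup>2 * bump (p - 2) z) \<partial>lborel)"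
    using n(2) by (intro nn_integral_eq_integral int) (auto simp: bump_nonneg)
  also have "(\<integral>z. n * bump p z + 4 * (real p)\<^sup>2 * ((z \<bullet> b)\<^sup>2 * bump (p - 2) z) \<partial>lborel)
    = n * bump_integral TYPE('e) p + 4 * (real p)\<^sup>2 * (\<integral>z. (z \<bullet> b)\<^sup>2 * bump (p - 2) z \<partial>lborel)"
    using p by (subst Bochner_Integration.integral_add)
      (auto simp: bump_integral_def intro!: integrable_mult_right integrable_bump integrable_bump_mult continuous_intros)
  also have "4 * (real p)\<^sup>2 * (\<integral>z. (z \<bullet> b)\<^sup>2 * bump (p - 2) z \<partial>lborel)
    = real p * (2 * real p + DIM('e)) / (real p - 1) * bump_integral TYPE('e) p"
  proof -
    define X where "X = (\<integral>z. (z \<bullet> b)\<^sup>2 * bump (p - 2) z \<partial>lborel)"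
    have 1: "2 * (real p - 1) * X = bump_integral TYPE('e) (p - 1)"
      using bump_second_moment[of "p - 2" b] b p by (simp add: X_def of_nat_diff Suc_diff_Suc numeral_2_eq_2)
    have 2: "bump_integral TYPE('e) (p - 1) = (1 + DIM('e) / (2 * real p)) * bump_integral TYPE('e) p"
      using bump_integral_Suc[of "p - 1", where 'e='e] p by simp
    have p1: "real p - 1 \<noteq> 0" "real p \<noteq> 0" using p by auto
    have "X = bump_integral TYPE('e) (p - 1) / (2 * (real p - 1))" using 1 p1 by (simp add: field_simps)
    then show ?thesis unfolding X_def[symmetric] 2 using p1
      by (simp add: power2_eq_square field_simps)
  qed
  finally show ?thesis by (simp add: algebra_simps)
qed

section \<open>Singular values and the Frobenius norm\<close>

text \<open>The orthogonal complement \<open>W\<close> of \<open>S\<close> is invariant under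
  \<open>P\<close>, as \<open>S\<close> consists of eigenvectors. A maximiser of the quadratic form
  of \<open>P\<close> on the unit sphere of \<open>W\<close> is then an eigenvector.\<close>

lemma symmetric_eigenvector_orthogonal:
  fixes P :: "real^'n^'n"
  assumes sym: "transpose P = P" and fin: "finite S" "card S < CARD('n)"
    and eig: "\<And>v. v \<in> S \<Longrightarrow> \<exists>l. P *v v = l *\<^sub>R v"
  obtains x l where "norm x = 1" "\<And>v. v \<in> S \<Longrightarrow> x \<bullet> v = 0" "P *v x = l *\<^sub>R x"
proof -
  define W where "W = {x. \<forall>v\<in>S. x \<bullet> v = 0}"
  have adj: "(P *v x) \<bullet> y = x \<bullet> (P *v y)" for x y
    using dot_lmul_matrix[of x P y] transpose_matrix_vector[of P x] sym by simp
  have W: "x + t *\<^sub>R y \<in> W" "t *\<^sub>R x \<in> W" "x - y \<in> W" if "x \<in> W" "y \<in> W" for x y t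
    using that by (auto simp: W_def inner_add_left inner_diff_left)
  have PW: "P *v x \<in> W" if "x \<in> W" for x
    using that eig by (fastforce simp: W_def adj)
  have "dim S < DIM(real^'n)"
    using fin dim_le_card'[of S] by simp
  then obtain x0 where x0: "x0 \<noteq> 0" "\<And>y. y \<in> span S \<Longrightarrow> orthogonal x0 y"
    using orthogonal_to_subspace_exists by blast
  have "closed W" 
  proof -
    have "W = (\<Inter>v\<in>S. {x. x \<bullet> v = 0})" by (auto simp: W_def)
    then show ?thesis by (auto intro!: closed_INT closed_Collect_eq continuous_intros)
  qed
  then have "compact (W \<inter> sphere 0 1)" by (rule closed_Int_compact[OF _ compact_sphere])
  moreover have "x0 /\<^sub>R norm x0 \<in> W \<inter> sphere 0 1"
    using x0 by (auto simp: W_def orthogonal_def span_base)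
  moreover have "continuous_on (W \<inter> sphere 0 1) (\<lambda>x. x \<bullet> (P *v x))"
    by (intro continuous_intros)
  ultimately obtain x where x: "x \<in> W \<inter> sphere 0 1" 
    and max: "\<And>y. y \<in> W \<inter> sphere 0 1 \<Longrightarrow> y \<bullet> (P *v y) \<le> x \<bullet> (P *v x)"
    using continuous_attains_sup[of "W \<inter> sphere 0 1" "\<lambda>x. x \<bullet> (P *v x)"] by blast
  define l where "l = x \<bullet> (P *v x)"
  have xx: "x \<bullet> x = 1" using x by (simp add: norm_eq_1)
  have le: "u \<bullet> (P *v u) \<le> l * (u \<bullet> u)" if "u \<in> W" for u
  proof (cases "u = 0")
    case False
    have "(u /\<^sub>R norm u) \<bullet> (P *v (u /\<^sub>R norm u)) \<le> l"
      unfolding l_def using W(2)[OF that that] False by (intro max) auto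
    then have "(u \<bullet> (P *v u)) / (norm u)\<^sup>2 \<le> l"
      by (simp add: matrix_vector_mult_scaleR field_simps power2_eq_square)
    then show ?thesis using False by (simp add: field_simps power2_norm_eq_inner)
  qed simp
  \<comment> \<open>The residual of the eigenvalue equation. Moving \<open>x\<close> along
    \<open>y\<close> would gain \<open>2 * t * (y \<bullet> y)\<close> to first order, against
    maximality unless \<open>y = 0\<close>.\<close>
  define y where "y = P *v x - l *\<^sub>R x"
  have yW: "y \<in> W" using x PW[of x] W(1)[of "P *v x" x "-l"] by (simp add: y_def)
  have key: "2 * t * (y \<bullet> y) \<le> t\<^sup>2 * (l * (y \<bullet> y) - y \<bullet> (P *v y))" for t
  proof -
    have e: "x \<bullet> (P *v y) = (P *v x) \<bullet> y" "y \<bullet> (P *v x) = (P *v x) \<bullet> y"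
      by (rule adj[symmetric]) (rule inner_commute)
    have 1: "(x + t *\<^sub>R y) \<bullet> (P *v (x + t *\<^sub>R y)) \<le> l * ((x + t *\<^sub>R y) \<bullet> (x + t *\<^sub>R y))"
      using le[OF W(1)] x yW by blast
    have 2: "(x + t *\<^sub>R y) \<bullet> (P *v (x + t *\<^sub>R y)) = l + 2 * t * ((P *v x) \<bullet> y) + t\<^sup>2 * (y \<bullet> (P *v y))"
      by (simp add: l_def matrix_vector_right_distrib matrix_vector_mult_scaleR inner_add e power2_eq_square)
        (simp add: algebra_simps)
    have 3: "(x + t *\<^sub>R y) \<bullet> (x + t *\<^sub>R y) = 1 + 2 * t * (x \<bullet> y) + t\<^sup>2 * (y \<bullet> y)"
      by (simp add: xx inner_add inner_commute[of y x] power2_eq_square) (simp add: algebra_simps)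
    have 4: "(P *v x) \<bullet> y - l * (x \<bullet> y) = y \<bullet> y"
      by (subst (3) y_def) (simp add: inner_diff_left)
    have "2 * t * ((P *v x) \<bullet> y - l * (x \<bullet> y)) \<le> t\<^sup>2 * (l * (y \<bullet> y) - y \<bullet> (P *v y))"
      using 1 unfolding 2 3 by (simp add: algebra_simps)
    then show ?thesis unfolding 4 .
  qed
  have "y \<bullet> y = 0"
  proof (rule ccontr)
    assume "y \<bullet> y \<noteq> 0"
    then have p: "0 < y \<bullet> y" by simp
    \<comment> \<open>A positive bound of the coefficient of \<open>t\<^sup>2\<close>; for
      \<open>t = (y \<bullet> y) / c\<close> the linear term wins.\<close>
    define c where "c = \<bar>l * (y \<bullet> y) - y \<bullet> (P *v y)\<bar> + 1"
    have c: "0 < c" "l * (y \<bullet> y) - y \<bullet> (P *v y) \<le> c" by (auto simp: c_def)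
    have "2 * ((y \<bullet> y) / c) * (y \<bullet> y) \<le> ((y \<bullet> y) / c)\<^sup>2 * c"
      using key[of "(y \<bullet> y) / c"] mult_left_mono[OF c(2), of "((y \<bullet> y) / c)\<^sup>2"] by simp
    then have "2 * (y \<bullet> y)\<^sup>2 / c \<le> (y \<bullet> y)\<^sup>2 / c" using c(1) by (simp add: power2_eq_square)
    then show False using c(1) p by (simp add: divide_le_cancel)
  qed
  then have "P *v x = l *\<^sub>R x" by (simp add: y_def)
  then show thesis using that[of x l] x by (auto simp: W_def)
qed

theorem symmetric_spectral:
  fixes P :: "real^'n^'n"
  assumes sym: "transpose P = P"
  obtains e :: "'n \<Rightarrow> real^'n" and l :: "'n \<Rightarrow> real"
  where "\<And>i j. e i \<bullet> e j = (if i = j then 1 else 0)" "\<And>j. P *v e j = l j *\<^sub>R e j"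
proof -
  have "k \<le> CARD('n) \<Longrightarrow> \<exists>S. finite S \<and> card S = k \<and> (\<forall>v\<in>S. \<forall>w\<in>S. v \<bullet> w = (if v = w then 1 else 0))
      \<and> (\<forall>v\<in>S. \<exists>l. P *v v = l *\<^sub>R v)" for k
  proof (induction k)
    case (Suc k)
    then obtain S where S: "finite S" "card S = k" "\<forall>v\<in>S. \<forall>w\<in>S. v \<bullet> w = (if v = w then 1 else 0)"
      "\<forall>v\<in>S. \<exists>l. P *v v = l *\<^sub>R v" by auto
    obtain x l where x: "norm x = 1" "\<And>v. v \<in> S \<Longrightarrow> x \<bullet> v = 0" "P *v x = l *\<^sub>R x"
    proof (rule symmetric_eigenvector_orthogonal[OF sym S(1)])
      show "card S < CARD('n)" using S(2) Suc.prems by simp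
    qed (use S(4) in auto)
    have xx: "x \<bullet> x = 1" using x(1) by (simp add: norm_eq_1)
    then have "x \<notin> S" using x(2) by force
    then show ?case using S x xx
      by (intro exI[of _ "insert x S"]) (auto simp: inner_commute)
  qed (auto intro!: exI[of _ "{}"])
  then obtain S where S: "finite S" "card S = CARD('n)" "\<forall>v\<in>S. \<forall>w\<in>S. v \<bullet> w = (if v = w then 1 else 0)"
      "\<forall>v\<in>S. \<exists>l. P *v v = l *\<^sub>R v" by blast
  then obtain e :: "'n \<Rightarrow> real^'n" where e: "bij_betw e UNIV S"
    using finite_same_card_bij[of "UNIV :: 'n set" S] by auto
  then have eS: "e j \<in> S" and inj: "e i = e j \<longleftrightarrow> i = j" for i j
    by (auto simp: bij_betw_def inj_def)
  have "\<forall>j. \<exists>l. P *v e j = l *\<^sub>R e j" using S(4) eS by blast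
  from choice[OF this] obtain l where "\<forall>j. P *v e j = l j *\<^sub>R e j" by blast
  then show thesis using that[of e l] S(3) eS inj by simp
qed

definition diag_mat :: "('n \<Rightarrow> real) \<Rightarrow> real^'n^'n" where
  "diag_mat f = (\<chi> i j. if i = j then f i else 0)"

lemma diag_mat_mult_right: "(X ** diag_mat f) $ i $ j = X $ i $ j * f j"
  by (simp add: matrix_matrix_mult_def diag_mat_def if_distrib cong: if_cong)

lemma diag_mat_mult_left: "(diag_mat f ** X) $ i $ j = f i * X $ i $ j"
  by (simp add: matrix_matrix_mult_def diag_mat_def if_distrib[of "\<lambda>x. x * _"] cong: if_cong)

lemma diag_mat_mult: "diag_mat f ** diag_mat g = diag_mat (\<lambda>i. f i * g i)"
  by (simp add: vec_eq_iff diag_mat_mult_left) (simp add: diag_mat_def)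

lemma diag_mat_1: "diag_mat (\<lambda>_. 1) = mat 1"
  by (simp add: diag_mat_def mat_def)

lemma transpose_diag_mat[simp]: "transpose (diag_mat f) = diag_mat f"
  by (auto simp: diag_mat_def transpose_def vec_eq_iff)

lemma symmetric_diagonalization:
  fixes P :: "real^'n^'n"
  assumes "transpose P = P"
  obtains U l where "orthogonal_matrix U" "P ** U = U ** diag_mat l"
proof -
  obtain e :: "'n \<Rightarrow> real^'n" and l where e: "\<And>i j. e i \<bullet> e j = (if i = j then 1 else 0)"
    and l: "\<And>j. P *v e j = l j *\<^sub>R e j"
    using symmetric_spectral[OF assms] by blast
  define U :: "real^'n^'n" where "U = (\<chi> i j. e j $ i)"
  have "transpose U ** U = mat 1"
    using e by (simp add: U_def transpose_def matrix_matrix_mult_def mat_def vec_eq_iff inner_vec_def)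
  then have "orthogonal_matrix U" by (simp add: orthogonal_matrix)
  moreover have "P ** U = U ** diag_mat l"
    using l by (simp add: vec_eq_iff diag_mat_mult_right)
      (simp add: U_def matrix_matrix_mult_def matrix_vector_mult_def mult.commute)
  ultimately show thesis by (rule that)
qed

text \<open>If \<open>U\<close> diagonalises \<open>B ** transpose B\<close>, the columns of
  \<open>transpose B ** U\<close> are orthogonal with squared norms \<open>l i\<close>, positive
  because \<open>B\<close> is invertible. Scaled to unit length they form \<open>V\<close>.\<close>

lemma invertible_SVD:
  fixes B :: "real^'n^'n"
  assumes "invertible B"
  obtains U V s where "orthogonal_matrix U" "orthogonal_matrix V" "\<And>i. 0 < s i" "B ** V = U ** diag_mat s"
proof -
  obtain U l where U: "orthogonal_matrix U" and l: "(B ** transpose B) ** U = U ** diag_mat l"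
    using symmetric_diagonalization[of "B ** transpose B"] by (auto simp: matrix_transpose_mul)
  have UU: "transpose U ** U = mat 1" using U by (simp add: orthogonal_matrix)
  define C where "C = transpose B ** U"
  have CC: "transpose C ** C = diag_mat l"
  proof -
    have "transpose C ** C = transpose U ** ((B ** transpose B) ** U)"
      by (simp add: C_def matrix_transpose_mul matrix_mul_assoc)
    also have "\<dots> = (transpose U ** U) ** diag_mat l" by (simp only: l matrix_mul_assoc)
    finally show ?thesis by (simp add: UU)
  qed
  have "l i > 0" for i
  proof -
    have "l i = (transpose C ** C) $ i $ i" by (simp add: CC diag_mat_def)
    also have "\<dots> = (\<Sum>k\<in>UNIV. (C $ k $ i)\<^sup>2)"
      by (simp add: matrix_matrix_mult_def transpose_def power2_eq_square)
    finally have li: "l i = (\<Sum>k\<in>UNIV. (C $ k $ i)\<^sup>2)" .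
    have "invertible (transpose B)" "invertible U"
      using assms U by (auto simp: invertible_det_nz dest: det_orthogonal_matrix)
    then have "invertible C" unfolding C_def by (rule invertible_mult)
    then have "inj ((*v) C)" by (rule inj_matrix_vector_mult)
    then have "C *v axis i 1 \<noteq> 0"
      using injD[of "(*v) C" "axis i 1" 0] by (auto simp: axis_eq_0_iff)
    then obtain k where "C $ k $ i \<noteq> 0"
      by (auto simp: vec_eq_iff matrix_vector_mult_basis column_def)
    then have "0 < (C $ k $ i)\<^sup>2" by simp
    also have "\<dots> \<le> l i" unfolding li by (intro member_le_sum) auto
    finally show ?thesis .
  qed
  note lpos = this
  define s where "s i = sqrt (l i)" for i
  have s: "0 < s i" "s i * s i = l i" for i using lpos[of i] by (auto simp: s_def)
  define V where "V = C ** diag_mat (\<lambda>i. 1 / s i)"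
  have "transpose V ** V = diag_mat (\<lambda>i. 1 / s i) ** (transpose C ** C) ** diag_mat (\<lambda>i. 1 / s i)"
    by (simp add: V_def matrix_transpose_mul matrix_mul_assoc)
  also have "\<dots> = diag_mat (\<lambda>i. 1 / s i * l i * (1 / s i))"
    by (simp add: CC diag_mat_mult)
  also have "\<dots> = mat 1" using s lpos by (simp add: s(2)[symmetric] less_imp_neq[symmetric] flip: diag_mat_1)
  finally have "orthogonal_matrix V" by (simp add: orthogonal_matrix)
  moreover have "B ** V = U ** diag_mat s"
  proof -
    have "B ** V = (B ** transpose B) ** U ** diag_mat (\<lambda>i. 1 / s i)"
      by (simp add: V_def C_def matrix_mul_assoc)
    also have "\<dots> = U ** (diag_mat l ** diag_mat (\<lambda>i. 1 / s i))"
      by (simp only: l matrix_mul_assoc)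
    also have "diag_mat l ** diag_mat (\<lambda>i. 1 / s i) = diag_mat s"
      using s(1) by (simp add: diag_mat_mult s(2)[symmetric] less_imp_neq[symmetric])
    finally show ?thesis .
  qed
  ultimately show thesis using that U s(1) by blast
qed

text \<open>\<open>s_min\<close> is a \<open>Min\<close>, so the set of singular values must be
  shown finite and nonempty. An eigenvector of the Gram matrix cannot be orthogonal to a whole
  orthonormal eigenbasis; hence its eigenvalue is one of the finitely many
  \<open>l j\<close>.\<close>

lemma s_min_ge:
  fixes A :: "real^'n^'n"
  assumes "0 \<le> s" and "\<And>v. s * norm v \<le> norm (A *v v)"
  shows "s \<le> s_min A"
proof -
  let ?G = "transpose A ** A"
  have sym: "transpose ?G = ?G" by (simp add: matrix_transpose_mul)
  obtain e :: "'n \<Rightarrow> real^'n" and l where e: "\<And>i j. e i \<bullet> e j = (if i = j then 1 else 0)"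
    and l: "\<And>j. ?G *v e j = l j *\<^sub>R e j"
    using symmetric_spectral[OF sym] by blast
  have adj: "(?G *v x) \<bullet> y = x \<bullet> (?G *v y)" for x y
  proof -
    have "?G *v x = x v* ?G" using transpose_matrix_vector[of ?G x] unfolding sym .
    then show ?thesis by (simp only: dot_lmul_matrix)
  qed
  have e0: "e i \<noteq> 0" for i using e[of i i] by auto
  have "singular_values A \<subseteq> range (\<lambda>j. sqrt (l j))"
  proof
    fix x assume "x \<in> singular_values A"
    then obtain \<mu> v where v: "x = sqrt \<mu>" "v \<noteq> 0" "?G *v v = \<mu> *\<^sub>R v"
      unfolding singular_values_def by blast
    have "\<exists>j. v \<bullet> e j \<noteq> 0"
    proof (rule ccontr)
      assume none: "\<not> ?thesis"
      have "v \<in> span (range e)"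
      proof -
        have ind: "independent (range e)"
        proof (rule pairwise_orthogonal_independent)
          show "pairwise orthogonal (range e)" using e by (auto simp: pairwise_def orthogonal_def)
          show "0 \<notin> range e" using e0 by auto
        qed
        have "e i = e j \<Longrightarrow> i = j" for i j using e[of i j] e[of i i] by (auto split: if_splits)
        then have "card (range e) = CARD('n)" by (simp add: card_image inj_def)
        then have "dim (UNIV :: (real^'n) set) \<le> card (range e)" by simp
        from card_ge_dim_independent[OF subset_UNIV ind this] show ?thesis by auto
      qed
      from orthogonal_to_span[OF this, of v] none have "orthogonal v v" by (auto simp: orthogonal_def)
      then show False using v(2) by (simp add: orthogonal_self)
    qed
    then obtain j where "v \<bullet> e j \<noteq> 0" by blast
    moreover have "\<mu> * (v \<bullet> e j) = l j * (v \<bullet> e j)"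
      using adj[of v "e j"] unfolding v(3) l by simp
    ultimately show "x \<in> range (\<lambda>j. sqrt (l j))" using v(1) by auto
  qed
  then have fin: "finite (singular_values A)" by (rule finite_subset) auto
  have "sqrt (l j) \<in> singular_values A" for j
    using l[of j] e0[of j] unfolding singular_values_def by blast
  then have ne: "singular_values A \<noteq> {}" by blast
  have "s \<le> x" if xA: "x \<in> singular_values A" for x
  proof -
    obtain \<mu> v where v: "x = sqrt \<mu>" "v \<noteq> 0" "?G *v v = \<mu> *\<^sub>R v"
      using xA unfolding singular_values_def by blast
    have "(norm (A *v v))\<^sup>2 = ((A *v v) v* A) \<bullet> v"
      by (simp only: power2_norm_eq_inner dot_lmul_matrix)
    also have "\<dots> = v \<bullet> (?G *v v)"
      by (simp only: transpose_matrix_vector[symmetric] matrix_vector_mul_assoc inner_commute)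
    also have "\<dots> = \<mu> * (norm v)\<^sup>2" by (simp add: v(3) power2_norm_eq_inner)
    finally have nv: "(norm (A *v v))\<^sup>2 = \<mu> * (norm v)\<^sup>2" .
    have "(s * norm v)\<^sup>2 \<le> \<mu> * (norm v)\<^sup>2"
      unfolding nv[symmetric] using assms by (intro power_mono) auto
    then have "s\<^sup>2 \<le> \<mu>" using v(2) by (simp add: power_mult_distrib)
    then show ?thesis unfolding v(1) by (rule real_le_rsqrt)
  qed
  then show ?thesis unfolding s_min_def using fin ne by simp
qed

section \<open>Frobenius norm inequalities\<close>

lemma norm_matrix_entries: "(norm (C :: real^'n^'m))\<^sup>2 = (\<Sum>i\<in>UNIV. \<Sum>j\<in>UNIV. (C $ i $ j)\<^sup>2)"
  by (simp add: norm_vec_def L2_set_def sum_nonneg)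

lemma norm_transpose: "norm (transpose (C :: real^'n^'m)) = norm C"
proof -
  have "(norm (transpose C))\<^sup>2 = (norm C)\<^sup>2"
    by (simp add: norm_matrix_entries transpose_def) (rule sum.swap)
  then show ?thesis by simp
qed

lemma norm_matrix_vector_le: "norm (C *v x) \<le> norm (C :: real^'n^'m) * norm x"
proof -
  have "(norm (C *v x))\<^sup>2 = (\<Sum>i\<in>UNIV. (C $ i \<bullet> x)\<^sup>2)"
    by (simp add: norm_vec_def L2_set_def sum_nonneg matrix_vector_mul_component)
  also have "\<dots> \<le> (\<Sum>i\<in>UNIV. (norm (C $ i) * norm x)\<^sup>2)"
    by (intro sum_mono) (simp add: Cauchy_Schwarz_ineq2 abs_le_square_iff[symmetric] abs_mult)
  also have "\<dots> = (norm C * norm x)\<^sup>2"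
    by (simp add: norm_matrix_square power_mult_distrib sum_distrib_right)
  finally show ?thesis by (rule power2_le_imp_le) simp
qed

lemma norm_matrix_mult_le: "norm ((C :: real^'n^'m) ** (D :: real^'k^'n)) \<le> norm C * norm D"
proof -
  have "(C ** D) $ i = transpose D *v (C $ i)" for i
    by (simp add: matrix_matrix_mult_def matrix_vector_mult_def transpose_def vec_eq_iff mult.commute)
  then have "(norm (C ** D))\<^sup>2 = (\<Sum>i\<in>UNIV. (norm (transpose D *v (C $ i)))\<^sup>2)"
    by (simp add: norm_matrix_square)
  also have "\<dots> \<le> (\<Sum>i\<in>UNIV. (norm D * norm (C $ i))\<^sup>2)"
    using norm_matrix_vector_le[of "transpose D"] by (intro sum_mono power_mono) (auto simp: norm_transpose)
  also have "\<dots> = (norm C * norm D)\<^sup>2"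
    by (simp add: norm_matrix_square[of C] power_mult_distrib sum_distrib_left mult.commute)
  finally show ?thesis by (rule power2_le_imp_le) simp
qed

lemma norm_orthogonal_mult:
  assumes "orthogonal_matrix (U :: real^'n^'n)"
  shows "norm (U *v x) = norm x" "norm (U ** X) = norm (X :: real^'n^'n)" "norm (X ** U) = norm X"
proof -
  have *: "norm (U *v x) = norm x" if "orthogonal_matrix U" for x and U :: "real^'n^'n"
    using that orthogonal_transformation_matrix[of "(*v) U"] by (simp add: orthogonal_transformation)
  have **: "norm (U ** X) = norm X" if "orthogonal_matrix U" for X U :: "real^'n^'n"
  proof -
    have "transpose (U ** X) $ i = U *v (transpose X $ i)" for i
      by (simp add: matrix_matrix_mult_def matrix_vector_mult_def transpose_def vec_eq_iff)
    then have "(norm (transpose (U ** X)))\<^sup>2 = (norm (transpose X))\<^sup>2"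
      by (simp add: norm_matrix_square *[OF that])
    then show ?thesis by (simp add: norm_transpose)
  qed
  show "norm (U *v x) = norm x" "norm (U ** X) = norm X" using * ** assms by auto
  have "orthogonal_matrix (transpose U)" using assms by simp
  from **[OF this, of "transpose X"] show "norm (X ** U) = norm X"
    by (simp add: norm_transpose flip: matrix_transpose_mul)
qed

section \<open>Full-dimensional perturbations of a homothety\<close>

lemma info_le:
  fixes M :: "real^'n^'n"
  assumes "\<And>X :: real^'n^'n. norm (X ** M) \<le> \<tau> * norm X" "0 \<le> \<tau>"
  shows "info C M N \<le> (norm C)\<^sup>2 * (\<Sum>i<N. \<Sum>l<i. \<tau> ^ (2 * l))"
proof -
  have "norm (((\<lambda>X. X ** M) ^^ l) C) \<le> \<tau> ^ l * norm C" for l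
  proof (induction l)
    case (Suc l)
    have "norm (((\<lambda>X. X ** M) ^^ Suc l) C) \<le> \<tau> * norm (((\<lambda>X. X ** M) ^^ l) C)"
      using assms(1) by simp
    also have "\<dots> \<le> \<tau> * (\<tau> ^ l * norm C)" using Suc assms(2) by (rule mult_left_mono)
    finally show ?case by (simp add: mult.assoc)
  qed simp
  then have "(norm (((\<lambda>X. X ** M) ^^ l) C))\<^sup>2 \<le> (norm C)\<^sup>2 * \<tau> ^ (2 * l)" for l
    using power_mono[of "norm (((\<lambda>X. X ** M) ^^ l) C)" "\<tau> ^ l * norm C" 2]
    by (simp add: power_mult_distrib power_mult mult.commute)
  then show ?thesis unfolding info_def sum_distrib_left by (intro sum_mono)
qed

lemma Basis_matrixE:
  assumes "e \<in> (Basis :: (real^'n^'m) set)"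
  obtains j k where "e = axis j (axis k 1)"
  using assms by (auto simp: Basis_vec_def)

lemma sum_Basis_matrix:
  fixes f :: "real^'n^'m \<Rightarrow> real"
  shows "(\<Sum>e\<in>Basis. f e) = (\<Sum>j\<in>UNIV. \<Sum>k\<in>UNIV. f (axis j (axis k 1)))"
proof -
  have eq: "(Basis :: (real^'n^'m) set) = (\<lambda>(j, k). axis j (axis k 1)) ` UNIV"
    by (auto simp: Basis_vec_def)
  have "inj (\<lambda>(j::'m, k::'n). axis j (axis k (1::real)))"
    by (auto simp: inj_def axis_eq_axis)
  then have "(\<Sum>e\<in>Basis. f e) = (\<Sum>x\<in>UNIV. f (case x of (j, k) \<Rightarrow> axis j (axis k 1)))"
    unfolding eq by (subst sum.reindex) auto
  then show ?thesis by (simp add: sum.cartesian_product case_prod_unfold)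
qed

definition hadamard :: "('m \<Rightarrow> 'n \<Rightarrow> real) \<Rightarrow> real^'n^'m \<Rightarrow> real^'n^'m" where
  "hadamard f z = (\<chi> j k. f j k * z $ j $ k)"

lemma norm_hadamard_le:
  assumes "\<And>j k. \<bar>f j k\<bar> \<le> 1"
  shows "norm (hadamard f z) \<le> norm z"
proof -
  have "(norm (hadamard f z))\<^sup>2 \<le> (norm z)\<^sup>2"
    unfolding norm_matrix_entries hadamard_def
  proof (simp, intro sum_mono)
    fix j k
    have "\<bar>f j k * z $ j $ k\<bar> \<le> \<bar>z $ j $ k\<bar>"
      using mult_right_mono[OF assms[of j k], of "\<bar>z $ j $ k\<bar>"] by (simp add: abs_mult)
    then show "(f j k * z $ j $ k)\<^sup>2 \<le> (z $ j $ k)\<^sup>2" by (simp add: abs_le_square_iff)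
  qed
  then show ?thesis by (rule power2_le_imp_le) simp
qed

lemma linear_hadamard: "linear (hadamard f)"
  by (rule linearI) (auto simp: hadamard_def vec_eq_iff algebra_simps)

lemma hadamard_axis: "hadamard f (axis j (axis k 1)) = f j k *\<^sub>R axis j (axis k 1)"
  by (auto simp: hadamard_def vec_eq_iff axis_def)

lemma matrix_mult_scaleR:
  fixes A :: "real^'n^'m" and B :: "real^'k^'n"
  shows "A ** (c *\<^sub>R B) = c *\<^sub>R (A ** B)" "(c *\<^sub>R A) ** B = c *\<^sub>R (A ** B)"
  by (simp_all add: matrix_matrix_mult_def vec_eq_iff sum_distrib_left mult_ac)

lemma matrix_add_mult:
  fixes A :: "real^'n^'m" and C :: "real^'k^'n"
  shows "(A + B) ** C = A ** C + B ** C" "(A - B) ** C = A ** C - B ** C"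
  by (simp_all add: matrix_matrix_mult_def vec_eq_iff sum.distrib sum_subtractf algebra_simps)

lemma linear_conjugation:
  fixes X Y :: "real^'n^'n"
  assumes "linear f"
  shows "linear (\<lambda>z. c *\<^sub>R (X ** f z ** Y))"
  using assms
  by (intro linearI) (simp_all add: linear_add linear_cmul matrix_add_ldistrib matrix_add_mult matrix_mult_scaleR scaleR_add_right)

text \<open>With \<open>t = J / n\<close> this is a lower bound for
  \<open>1 / (u + t) + u / (1 + t)\<close>, which is smallest where \<open>u + t\<close> is the
  square root of \<open>1 + t\<close>. Replacing that root by \<open>1 + t / 2\<close> leaves
  \<open>4 / (2 + t) - t / (1 + t)\<close>. The factor \<open>3/4\<close> makes room for the second
  order terms: with \<open>J = \<alpha> * n\<close> the minimum would fall below the required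
  value.\<close>

lemma pair_sum_bound:
  fixes u t n \<alpha> :: real
  assumes n: "0 < n" and \<alpha>: "0 < \<alpha>" "\<alpha> < 1" and J: "0 \<le> J" "J \<le> 3/4 * \<alpha> * n" and u: "0 < u" "u \<le> 1"
  shows "2 / ((1 + \<alpha>) * n) \<le> 1 / (u * n + J) + u / (n + J)"
proof -
  define t where "t = J / n"
  have t: "0 \<le> t" "4/3 * t \<le> \<alpha>" "J = t * n"
    using n J by (auto simp: t_def field_simps)
  then have t34: "t \<le> 3/4" using \<alpha> by linarith
  have "6 / (3 + 4 * t) \<le> 4 / (2 + t) - t / (1 + t)"
  proof -
    have "t\<^sup>2 \<le> (3/4)\<^sup>2" using t t34 by (intro power_mono) auto
    then have "0 \<le> t * (4 - t - 4 * t\<^sup>2)"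
      using t t34 by (intro mult_nonneg_nonneg) (auto simp: power2_eq_square)
    then have "6 * ((2 + t) * (1 + t)) \<le> (4 + 2 * t - t\<^sup>2) * (3 + 4 * t)"
      by (simp add: power2_eq_square algebra_simps)
    then have "6 / (3 + 4 * t) \<le> (4 + 2 * t - t\<^sup>2) / ((2 + t) * (1 + t))"
      using t(1) by (intro frac_le_eq[THEN iffD2] divide_nonpos_pos) auto
    also have "\<dots> = 4 / (2 + t) - t / (1 + t)"
      using t(1) by (simp add: diff_frac_eq) (simp add: power2_eq_square algebra_simps)
    finally show ?thesis .
  qed
  moreover have "2 / (1 + \<alpha>) \<le> 6 / (3 + 4 * t)"
    using t \<alpha> by (simp add: field_simps)
  moreover have "4 / (2 + t) - t / (1 + t) \<le> 1 / (u + t) + u / (1 + t)"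
  proof -
    \<comment> \<open>The convex function \<open>1 / y\<close> is bounded below by its tangent at
      \<open>y = 1 / c = 1 + t / 2\<close>, close to the minimiser.\<close>
    define c where "c = 2 / (2 + t)"
    have c: "0 < c" using t by (simp add: c_def)
    have "2 * c - c\<^sup>2 * (u + t) \<le> 1 / (u + t)"
    proof -
      have "0 \<le> (1 - c * (u + t))\<^sup>2 / (u + t)" using u t by simp
      also have "\<dots> = 1 / (u + t) - 2 * c + c\<^sup>2 * (u + t)"
        using u t by (simp add: field_simps power2_eq_square)
      finally show ?thesis by simp
    qed
    moreover have "c\<^sup>2 \<le> 1 / (1 + t)"
    proof -
      have "4 * (1 + t) \<le> (2 + t)\<^sup>2" by (simp add: power2_eq_square algebra_simps)
      then show ?thesis using t by (simp add: c_def power_divide field_simps)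
    qed
    then have "c\<^sup>2 * (u + t) \<le> 1 / (1 + t) * (u + t)" using u t by (intro mult_right_mono) auto
    moreover have "1 / (1 + t) * (u + t) = u / (1 + t) + t / (1 + t)" by (simp add: add_divide_distrib)
    moreover have "2 * c = 4 / (2 + t)" by (simp add: c_def)
    ultimately show ?thesis by linarith
  qed
  ultimately have "2 / (1 + \<alpha>) \<le> 1 / (u + t) + u / (1 + t)" by linarith
  then have "2 / (1 + \<alpha>) / n \<le> (1 / (u + t) + u / (1 + t)) / n"
    using n by (intro divide_right_mono) auto
  also have "\<dots> = 1 / (u * n + J) + u / (n + J)"
    using n t by (simp add: t(3) add_divide_distrib flip: distrib_right) (simp add: field_simps)
  finally show ?thesis by simp
qed

lemma norm_square_Basis_matrix: "(norm (W :: real^'n^'m))\<^sup>2 = (\<Sum>e\<in>Basis. (W \<bullet> e)\<^sup>2)"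
  unfolding power2_norm_eq_inner by (subst euclidean_inner) (simp add: power2_eq_square)

lemma hadamard_inner_Basis:
  assumes "e = axis j (axis k (1::real))"
  shows "hadamard f z \<bullet> e = f j k * (z \<bullet> e)"
  by (simp add: assms hadamard_def inner_axis)

text \<open>The weights \<open>min 1 (s j / s k)\<close> keep the entries of the perturbation small both in the
  coordinates of \<open>A\<close>, where the smallest singular value is controlled, and in those of
  \<open>B\<inverse> A B\<close>, where the growth of the normalised trajectory is controlled.\<close>

lemma ball_prior_bound:
  fixes B :: "real^'n^'n"
  defines "p \<equiv> CARD('n) + 2" and "D \<equiv> real CARD('n) ^ 2"
  assumes B: "invertible B" and R: "0 < R" "R \<le> r"
    and n: "0 < n" "(\<Sum>i<N. \<Sum>l<i. (r + R) ^ (2 * l)) \<le> n"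
    and s: "\<And>i. 0 < s i" and K: "K = real p * (2 * real p + D) / (real p - 1)"
    and svd: "orthogonal_matrix U" "orthogonal_matrix V" "B ** V = U ** diag_mat s"
  shows "ennreal (\<Sum>j\<in>UNIV. \<Sum>k\<in>UNIV. (min 1 (s j / s k))\<^sup>2 / ((min 1 (s k / s j))\<^sup>2 * n + K / R\<^sup>2))
    \<le> minimax_risk2 B N (class_C (r - R))"
  unfolding minimax_risk2_def
proof (rule INF_greatest)
  fix Ahat :: "(nat \<Rightarrow> real^'n) \<Rightarrow> real^'n^'n" assume Ahat: "Ahat \<in> borel_measurable (obs_space N)"
  define a b where "a j k = min 1 (s j / s k)" and "b j k = min 1 (s k / s j)" for j k
  have a: "0 < a j k" "a j k \<le> 1" and b: "0 < b j k" "b j k \<le> 1" for j k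
    using s by (auto simp: a_def b_def)
  \<comment> \<open>This relation between the two families of weights makes the two perturbations
    conjugate under \<open>B\<close>.\<close>
  have ab: "a j k * s k = s j * b j k" for j k
    using s[of j] s[of k] by (auto simp: a_def b_def min_def field_simps)
  define M0 :: "real^'n^'n" where "M0 = r *\<^sub>R mat 1"
  define \<Phi> where "\<Phi> z = R *\<^sub>R (V ** hadamard b z ** transpose V)" for z
  define A where "A z = M0 + R *\<^sub>R (U ** hadamard a z ** transpose U)" for z
  have U: "transpose U ** U = mat 1" "U ** transpose U = mat 1" and V: "transpose V ** V = mat 1" "V ** transpose V = mat 1"
    using svd by (auto simp: orthogonal_matrix_def)
  have B_eq: "B = U ** diag_mat s ** transpose V"
    using svd(3) by (metis V(2) matrix_mul_assoc matrix_mul_rid)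
  have AB: "A z ** B = B ** (M0 + \<Phi> z)" for z
  proof -
    have 1: "hadamard a z ** diag_mat s = diag_mat s ** hadamard b z"
    proof -
      have "a j k * z $ j $ k * s k = s j * (b j k * z $ j $ k)" for j k
        using ab[of j k] by (metis mult.assoc mult.commute)
      then show ?thesis by (simp add: vec_eq_iff diag_mat_mult_left diag_mat_mult_right hadamard_def)
    qed
    have "U ** hadamard a z ** transpose U ** B = U ** hadamard a z ** (transpose U ** U) ** diag_mat s ** transpose V"
      by (simp only: B_eq matrix_mul_assoc)
    also have "\<dots> = U ** (hadamard a z ** diag_mat s) ** transpose V"
      by (simp only: U matrix_mul_rid matrix_mul_assoc)
    also have "\<dots> = U ** diag_mat s ** (transpose V ** V) ** hadamard b z ** transpose V"
      by (simp only: 1 V matrix_mul_rid matrix_mul_assoc)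
    also have "\<dots> = B ** (V ** hadamard b z ** transpose V)"
      by (simp only: B_eq matrix_mul_assoc)
    finally have 2: "U ** hadamard a z ** transpose U ** B = B ** (V ** hadamard b z ** transpose V)" .
    show ?thesis unfolding A_def \<Phi>_def M0_def
      by (simp only: matrix_add_mult matrix_add_ldistrib matrix_mult_scaleR matrix_mul_lid matrix_mul_rid 2)
  qed
  have linA: "linear (\<lambda>z. R *\<^sub>R (U ** hadamard a z ** transpose U))" and lin\<Phi>: "linear \<Phi>"
    unfolding \<Phi>_def by (intro linear_conjugation linear_hadamard)+
  have contA: "continuous_on UNIV A"
    unfolding A_def using linA
    by (intro continuous_on_add continuous_on_const) (simp only: linear_continuous_on linear_conv_bounded_linear)
  have normUa: "norm (U ** hadamard a z ** transpose U) \<le> norm z" for z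
    using norm_hadamard_le[of a z] a svd(1) by (simp add: norm_orthogonal_mult less_imp_le)
  have normVb: "norm (V ** hadamard b z ** transpose V) \<le> norm z" for z
    using norm_hadamard_le[of b z] b svd(2) by (simp add: norm_orthogonal_mult less_imp_le)
  interpret smooth_prior "bump p :: real^'n^'n \<Rightarrow> real" "\<lambda>e z. - 2 * real p * (z \<bullet> e) * bump (p - 1) z" 1
    "bump_integral TYPE(real^'n^'n) p"
    by (rule bump_smooth_prior) (simp add: p_def Suc_le_eq)
  have D: "real DIM(real^'n^'n) = D" by (simp add: D_def power2_eq_square)
  have p1: "0 < real p - 1" by (simp add: p_def)
  have K0: "0 < K" unfolding K using p1 by (intro divide_pos_pos mult_pos_pos add_pos_nonneg) (auto simp: D_def p_def)
  \<comment> \<open>Turns weights indexed by \<open>(j, k)\<close> into functions on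
    \<open>Basis\<close>, the index set in \<open>prior_risk_bound\<close>.\<close>
  define c where "c f e = (\<Sum>j\<in>UNIV. \<Sum>k\<in>UNIV. f j k * (e $ j $ k))" for f :: "'n \<Rightarrow> 'n \<Rightarrow> real" and e :: "real^'n^'n"
  have c: "c f (axis j (axis k 1)) = f j k" for f j k
  proof -
    have "c f (axis j (axis k 1)) = (\<Sum>j'\<in>UNIV. \<Sum>k'\<in>UNIV. if j' = j then (if k' = k then f j k else 0) else 0)"
      unfolding c_def by (intro sum.cong) (auto simp: axis_def)
    also have "\<dots> = (\<Sum>j'\<in>UNIV. if j' = j then f j k else 0)"
      by (intro sum.cong) auto
    finally show ?thesis by simp
  qed
  \<comment> \<open>Inverts \<open>A z\<close> entry by entry: remove the centre, rotate by
    \<open>U\<close>, divide by the scale \<open>R * a j k\<close>.\<close>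
  define \<psi> where "\<psi> e W = (transpose U ** (W - M0) ** U) \<bullet> e / (R * c a e)" for e and W :: "real^'n^'n"
  have info: "info (\<Phi> e) (M0 + \<Phi> z) N \<le> R\<^sup>2 * (c b e)\<^sup>2 * n" if e: "e \<in> Basis" and z: "norm z < 1" for e z
  proof -
    obtain j k where jk: "e = axis j (axis k 1)" using Basis_matrixE[OF e] by blast
    have "norm (X ** (M0 + \<Phi> z)) \<le> (r + R) * norm X" for X :: "real^'n^'n"
    proof -
      have "norm (X ** (M0 + \<Phi> z)) \<le> norm (X ** M0) + norm (X ** \<Phi> z)"
        unfolding matrix_add_ldistrib by (rule norm_triangle_ineq)
      also have "norm (X ** M0) = r * norm X" using R by (simp add: M0_def matrix_mult_scaleR)
      also have "norm (X ** \<Phi> z) \<le> norm X * norm (\<Phi> z)" by (rule norm_matrix_mult_le)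
      also have "norm X * norm (\<Phi> z) \<le> norm X * R"
        using normVb[of z] z R(1) by (intro mult_left_mono) (simp_all add: \<Phi>_def mult_left_le)
      finally show ?thesis by (simp add: algebra_simps)
    qed
    then have "info (\<Phi> e) (M0 + \<Phi> z) N \<le> (norm (\<Phi> e))\<^sup>2 * (\<Sum>i<N. \<Sum>l<i. (r + R) ^ (2 * l))"
      using R by (intro info_le) auto
    also have "norm (\<Phi> e) = R * c b e"
      unfolding jk c \<Phi>_def hadamard_axis using R(1) b[of j k] svd(2) norm_Basis[OF e]
      by (simp add: norm_orthogonal_mult jk)
    also have "(R * c b e)\<^sup>2 * (\<Sum>i<N. \<Sum>l<i. (r + R) ^ (2 * l)) \<le> (R * c b e)\<^sup>2 * n"
      using n(2) by (rule mult_left_mono) simp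
    finally show ?thesis by (simp add: power_mult_distrib)
  qed
  have "ennreal (\<Sum>e\<in>Basis. R\<^sup>2 * (c a e)\<^sup>2 / (R\<^sup>2 * (c b e)\<^sup>2 * n + K)) \<le> (SUP A\<in>class_C (r - R). risk2 B N Ahat A)"
  proof (rule prior_risk_bound[OF lin\<Phi> Ahat AB contA])
    show "\<psi> e \<in> borel_measurable borel" for e
      unfolding \<psi>_def[abs_def] by measurable
    show "0 \<le> R\<^sup>2 * (c a e)\<^sup>2" for e by simp
    show "(\<Sum>e\<in>Basis. R\<^sup>2 * (c a e)\<^sup>2 * (\<psi> e W - z \<bullet> e)\<^sup>2) \<le> (norm (W - A z))\<^sup>2" for W z
    proof -
      have "transpose U ** (W - A z) ** U = transpose U ** (W - M0) ** U - R *\<^sub>R ((transpose U ** U) ** hadamard a z ** (transpose U ** U))"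
      proof -
        have "W - A z = (W - M0) - R *\<^sub>R (U ** hadamard a z ** transpose U)" by (simp add: A_def)
        moreover have "transpose U ** (X - Y) = transpose U ** X - transpose U ** Y" for X Y :: "real^'n^'n"
          using matrix_add_ldistrib[of "transpose U" "X - Y" Y] by (simp add: algebra_simps)
        ultimately show ?thesis
          by (simp only: matrix_add_mult matrix_mult_scaleR matrix_mul_assoc)
      qed
      then have eq: "transpose U ** (W - A z) ** U = transpose U ** (W - M0) ** U - R *\<^sub>R hadamard a z"
        by (simp add: U)
      have "(norm (W - A z))\<^sup>2 = (norm (transpose U ** (W - A z) ** U))\<^sup>2"
        using svd(1) by (simp add: norm_orthogonal_mult)
      also have "\<dots> = (\<Sum>e\<in>Basis. ((transpose U ** (W - M0) ** U) \<bullet> e - R * (hadamard a z \<bullet> e))\<^sup>2)"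
        unfolding eq norm_square_Basis_matrix by (simp add: inner_diff_left)
      also have "\<dots> = (\<Sum>e\<in>Basis. R\<^sup>2 * (c a e)\<^sup>2 * (\<psi> e W - z \<bullet> e)\<^sup>2)"
      proof (rule sum.cong[OF refl])
        fix e :: "real^'n^'n" assume e: "e \<in> Basis"
        obtain j k where jk: "e = axis j (axis k 1)" using Basis_matrixE[OF e] by blast
        have "(transpose U ** (W - M0) ** U) \<bullet> e - R * (hadamard a z \<bullet> e) = R * a j k * (\<psi> e W - z \<bullet> e)"
          unfolding \<psi>_def hadamard_inner_Basis[OF jk] using R(1) a[of j k] by (simp add: jk c field_simps)
        then show "((transpose U ** (W - M0) ** U) \<bullet> e - R * (hadamard a z \<bullet> e))\<^sup>2 = R\<^sup>2 * (c a e)\<^sup>2 * (\<psi> e W - z \<bullet> e)\<^sup>2"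
          by (simp add: jk c power_mult_distrib)
      qed
      finally show ?thesis by simp
    qed
    show "0 < R\<^sup>2 * (c b e)\<^sup>2 * n + K" for e
      using K0 n(1) by (intro add_nonneg_pos mult_nonneg_nonneg) auto
    show "(\<integral>\<^sup>+z. ennreal (bump p z * info (\<Phi> e) (M0 + \<Phi> z) N + (- 2 * real p * (z \<bullet> e) * bump (p - 1) z)\<^sup>2 / bump p z) \<partial>lborel)
      \<le> ennreal ((R\<^sup>2 * (c b e)\<^sup>2 * n + K) * bump_integral TYPE(real^'n^'n) p)" if "e \<in> Basis" for e
      unfolding K D[symmetric] using info[OF that] n(1)
      by (intro bump_information that) (auto simp: p_def Suc_le_eq)
    show "A z \<in> class_C (r - R)" if "0 < bump p z" for z
    proof -
      have z: "norm z < 1" using that bump_eq_0[of p z] by (force simp: p_def)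
      have "r - R \<le> s_min (A z)"
      proof (rule s_min_ge)
        fix v :: "real^'n"
        have "r * norm v = norm (r *\<^sub>R v)" using R by simp
        also have "r *\<^sub>R v = A z *v v - R *\<^sub>R ((U ** hadamard a z ** transpose U) *v v)"
          by (simp add: A_def M0_def matrix_vector_mult_add_rdistrib flip: scaleR_matrix_vector_assoc)
        also have "norm \<dots> \<le> norm (A z *v v) + R * norm ((U ** hadamard a z ** transpose U) *v v)"
          using norm_triangle_ineq4[of "A z *v v"] R(1) by (metis abs_of_pos norm_scaleR)
        also have "norm ((U ** hadamard a z ** transpose U) *v v) \<le> norm (U ** hadamard a z ** transpose U) * norm v"
          by (rule norm_matrix_vector_le)
        also have "\<dots> \<le> 1 * norm v"
          using z normUa[of z] by (intro mult_right_mono) auto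
        finally show "(r - R) * norm v \<le> norm (A z *v v)" using R(1) by (simp add: algebra_simps)
      qed (use R in simp)
      then show ?thesis by (simp add: class_C_def)
    qed
  qed
  also have "(\<Sum>e\<in>Basis. R\<^sup>2 * (c a e)\<^sup>2 / (R\<^sup>2 * (c b e)\<^sup>2 * n + K))
    = (\<Sum>j\<in>UNIV. \<Sum>k\<in>UNIV. (a j k)\<^sup>2 / ((b j k)\<^sup>2 * n + K / R\<^sup>2))"
  proof -
    have "R\<^sup>2 * (a j k)\<^sup>2 / (R\<^sup>2 * (b j k)\<^sup>2 * n + K) = (a j k)\<^sup>2 / ((b j k)\<^sup>2 * n + K / R\<^sup>2)" for j k
    proof -
      have "R\<^sup>2 * (b j k)\<^sup>2 * n + K = R\<^sup>2 * ((b j k)\<^sup>2 * n + K / R\<^sup>2)" using R(1) by (simp add: algebra_simps)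
      then show ?thesis using R(1) by simp
    qed
    then show ?thesis by (simp add: sum_Basis_matrix c)
  qed
  finally show "ennreal (\<Sum>j\<in>UNIV. \<Sum>k\<in>UNIV. (min 1 (s j / s k))\<^sup>2 / ((min 1 (s k / s j))\<^sup>2 * n + K / R\<^sup>2))
    \<le> (SUP A\<in>class_C (r - R). risk2 B N Ahat A)" unfolding a_def b_def .
qed

lemma card_ge_2_if_neq: "(j :: 'n::finite) \<noteq> k \<Longrightarrow> 2 \<le> CARD('n)"
  using card_mono[of UNIV "{j, k}"] by simp

text \<open>The double sum of \<open>ball_prior_bound\<close> is symmetrised, so that
  \<open>(j, k)\<close> and \<open>(k, j)\<close> are treated together. On the diagonal
  \<open>J \<le> \<alpha> * n\<close> suffices; the condition with \<open>3/4\<close> serves the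
  pairs \<open>j \<noteq> k\<close>, which exist only in dimension at least 2.\<close>

lemma ball_prior_minimax:
  fixes B :: "real^'n^'n"
  defines "d \<equiv> real CARD('n)"
  assumes B: "invertible B" and R: "0 < R" "R \<le> r"
    and n: "0 < n" "(\<Sum>i<N. \<Sum>l<i. (r + R) ^ (2 * l)) \<le> n"
    and \<alpha>: "0 < \<alpha>" "\<alpha> < 1"
    and K: "(d + 2) * (d\<^sup>2 + 2 * d + 4) / (d + 1) \<le> \<alpha> * n * R\<^sup>2"
      "2 \<le> CARD('n) \<Longrightarrow> (d + 2) * (d\<^sup>2 + 2 * d + 4) / (d + 1) \<le> 3/4 * \<alpha> * n * R\<^sup>2"
  shows "ennreal (d\<^sup>2 / ((1 + \<alpha>) * n)) \<le> minimax_risk2 B N (class_C (r - R))"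
proof -
  obtain U V s where svd: "orthogonal_matrix U" "orthogonal_matrix V" "B ** V = U ** diag_mat s"
    and s: "\<And>i::'n. 0 < s i" using invertible_SVD[OF B] by metis
  define L where "L = (d + 2) * (d\<^sup>2 + 2 * d + 4) / (d + 1)"
  have d: "0 < d" by (simp add: d_def)
  have L: "0 \<le> L" unfolding L_def using d by (intro divide_nonneg_nonneg mult_nonneg_nonneg) auto
  define J where "J = L / R\<^sup>2"
  have J: "0 \<le> J" "J \<le> \<alpha> * n" "2 \<le> CARD('n) \<Longrightarrow> J \<le> 3/4 * \<alpha> * n"
    using L K R(1) by (auto simp: J_def L_def[symmetric] pos_divide_le_eq)
  define f where "f j k = (min 1 (s j / s k))\<^sup>2 / ((min 1 (s k / s j))\<^sup>2 * n + J)" for j k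
  have pair: "2 / ((1 + \<alpha>) * n) \<le> f j k + f k j" if jk: "s k \<le> s j" for j k
  proof (cases "j = k")
    case True
    have "n + J \<le> (1 + \<alpha>) * n" using J by (simp add: algebra_simps)
    then have "1 / ((1 + \<alpha>) * n) \<le> 1 / (n + J)" using n(1) J(1) by (intro divide_left_mono mult_pos_pos) (use \<alpha> in auto)
    then show ?thesis using True s[of k] by (simp add: f_def)
  next
    case False
    define u where "u = (s k / s j)\<^sup>2"
    have q: "0 < s k / s j" "s k / s j \<le> 1" "1 \<le> s j / s k"
      using s[of j] s[of k] jk by auto
    then have u: "0 < u" "u \<le> 1" unfolding u_def by (auto intro!: power_le_one zero_less_power)
    have "f j k = 1 / (u * n + J)" "f k j = u / (n + J)"
      using q by (simp_all add: f_def u_def min_def)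
    then show ?thesis
      using pair_sum_bound[OF n(1) \<alpha> J(1) J(3)[OF card_ge_2_if_neq[OF False]] u] by simp
  qed
  have pair': "2 / ((1 + \<alpha>) * n) \<le> f j k + f k j" for j k
    using pair[of k j] pair[of j k] by (cases "s k \<le> s j") auto
  have "d\<^sup>2 * (2 / ((1 + \<alpha>) * n)) = (\<Sum>j\<in>(UNIV::'n set). \<Sum>k\<in>(UNIV::'n set). 2 / ((1 + \<alpha>) * n))"
    by (simp add: d_def power2_eq_square)
  also have "\<dots> \<le> (\<Sum>j\<in>UNIV. \<Sum>k\<in>UNIV. f j k + f k j)"
    by (intro sum_mono pair')
  also have "\<dots> = 2 * (\<Sum>j\<in>UNIV. \<Sum>k\<in>UNIV. f j k)"
    by (simp add: sum.distrib) (rule sum.swap)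
  finally have "d\<^sup>2 * (2 / ((1 + \<alpha>) * n)) \<le> 2 * (\<Sum>j\<in>UNIV. \<Sum>k\<in>UNIV. f j k)" .
  moreover have "d\<^sup>2 * (2 / ((1 + \<alpha>) * n)) = 2 * (d\<^sup>2 / ((1 + \<alpha>) * n))" by simp
  ultimately have le: "d\<^sup>2 / ((1 + \<alpha>) * n) \<le> (\<Sum>j\<in>UNIV. \<Sum>k\<in>UNIV. f j k)" by linarith
  have LK: "L = real (CARD('n) + 2) * (2 * real (CARD('n) + 2) + real CARD('n) ^ 2) / (real (CARD('n) + 2) - 1)"
    by (simp add: L_def d_def algebra_simps)
  show ?thesis
    using order_trans[OF ennreal_leI[OF le] ball_prior_bound[OF B R n s LK svd, folded J_def, folded f_def]] .
qed

text \<open>The left side is the information of the prior with exponent \<open>d + 2\<close> in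
  dimension \<open>d\<^sup>2\<close>. Its comparison with \<open>(d + 2)\<^sup>2\<close> amounts to
  \<open>2 \<le> d\<close>; at \<open>d = 1\<close> it equals \<open>21/2\<close>, which is
  \<open>7/6 * 9\<close>.\<close>

lemma prior_information_le:
  fixes d :: real
  shows "d = 1 \<Longrightarrow> (d + 2) * (d\<^sup>2 + 2 * d + 4) / (d + 1) \<le> 7/6 * (d + 2)\<^sup>2"
    and "2 \<le> d \<Longrightarrow> (d + 2) * (d\<^sup>2 + 2 * d + 4) / (d + 1) \<le> (d + 2)\<^sup>2"
proof -
  assume d: "2 \<le> d"
  then have "d\<^sup>2 + 2 * d + 4 \<le> (d + 2) * (d + 1)"
    by (simp add: power2_eq_square algebra_simps)
  then have "(d + 2) * (d\<^sup>2 + 2 * d + 4) \<le> (d + 2) * ((d + 2) * (d + 1))"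
    using d by (intro mult_left_mono) auto
  then show "(d + 2) * (d\<^sup>2 + 2 * d + 4) / (d + 1) \<le> (d + 2)\<^sup>2"
    using d by (simp add: pos_divide_le_eq power2_eq_square mult_ac)
qed (simp add: power2_eq_square)

section \<open>The cases \<open>s < 1\<close> and \<open>s > 1\<close>\<close>

lemma CARD_cases: 
  obtains "CARD('n::finite) = 1" | "2 \<le> CARD('n)"
  using zero_less_card_finite[where 'a='n] by linarith

text \<open>\<open>4/3\<close> is the reciprocal of \<open>3/4\<close> and exceeds the
  \<open>7/6\<close> of dimension 1, so that one condition serves every dimension.\<close>

lemma prior_information_bounds:
  fixes X :: real
  defines "d \<equiv> real CARD('n::finite)"
  assumes "4/3 * (d + 2)\<^sup>2 \<le> X"
  shows "(d + 2) * (d\<^sup>2 + 2 * d + 4) / (d + 1) \<le> X"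
    and "2 \<le> CARD('n) \<Longrightarrow> (d + 2) * (d\<^sup>2 + 2 * d + 4) / (d + 1) \<le> 3/4 * X"
proof -
  have p: "0 \<le> (d + 2)\<^sup>2" by simp
  show 2: "(d + 2) * (d\<^sup>2 + 2 * d + 4) / (d + 1) \<le> 3/4 * X" if "2 \<le> CARD('n)"
  proof -
    have "2 \<le> d" using that by (simp add: d_def)
    from prior_information_le(2)[OF this] assms(2) show ?thesis by linarith
  qed
  show "(d + 2) * (d\<^sup>2 + 2 * d + 4) / (d + 1) \<le> X"
  proof (cases rule: CARD_cases[where 'n='n])
    case 1
    then have "d = 1" by (simp add: d_def)
    from prior_information_le(1)[OF this] assms(2) p show ?thesis by linarith
  next
    case 2
    then have "2 \<le> d" by (simp add: d_def)
    from prior_information_le(2)[OF this] assms(2) p show ?thesis by linarith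
  qed
qed

text \<open>\<open>R\<close> and \<open>r\<close> satisfy \<open>r - R = s\<close> and
  \<open>r + R = (s + 1) / 2 < 1\<close>, so the inner geometric sums are bounded uniformly in
  \<open>i\<close>. As \<open>R = (1 - s) / 4\<close>, the hypothesis on \<open>N\<close> says
  \<open>(d + 2)\<^sup>2 \<le> \<alpha> * real N * R\<^sup>2\<close>.\<close>

lemma minimax_stable:
  fixes B :: "real^'n^'n"
  defines "d \<equiv> real CARD('n)"
  assumes B: "invertible B" and N: "0 < N"
    and s: "0 \<le> s" "s < 1" and \<alpha>: "0 < \<alpha>" "\<alpha> < 1"
    and le: "16 * (d + 2)\<^sup>2 / (\<alpha> * (1 - s)\<^sup>2) \<le> real N"
  shows "ennreal (d\<^sup>2 * (1 - (s + 1)\<^sup>2 / 4) / ((1 + \<alpha>) * real N)) \<le> minimax_risk2 B N (class_C s)"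
proof -
  define R r x n where "R = (1 - s) / 4" and "r = (1 + 3 * s) / 4" and "x = ((s + 1) / 2)\<^sup>2" and "n = real N / (1 - x)"
  have x: "1/4 \<le> x" "x < 1"
  proof -
    have "(1/2)\<^sup>2 \<le> x" unfolding x_def using s by (intro power_mono) auto
    then show "1/4 \<le> x" by (simp add: power2_eq_square)
    have "x < 1\<^sup>2" unfolding x_def using s by (intro power_strict_mono) auto
    then show "x < 1" by simp
  qed
  have rR: "r + R = (s + 1) / 2" "r - R = s + (1 - s) / 4 - (1 - s) / 4" by (simp_all add: r_def R_def field_simps)
  have geo: "(\<Sum>l<i. x ^ l) \<le> 1 / (1 - x)" for i
    using x by (simp add: sum_gp_strict divide_right_mono)
  have "(\<Sum>i<N. \<Sum>l<i. (r + R) ^ (2 * l)) = (\<Sum>i<N. \<Sum>l<i. x ^ l)"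
    by (simp add: rR x_def power_mult)
  also have "\<dots> \<le> (\<Sum>i<N. 1 / (1 - x))" by (intro sum_mono geo)
  finally have sum: "(\<Sum>i<N. \<Sum>l<i. (r + R) ^ (2 * l)) \<le> n" by (simp add: n_def)
  have n0: "0 < n" using N x by (simp add: n_def)
  have "4/3 * (d + 2)\<^sup>2 \<le> \<alpha> * n * R\<^sup>2"
  proof -
    have "(d + 2)\<^sup>2 \<le> \<alpha> * real N * R\<^sup>2"
      using le \<alpha> s by (simp add: R_def power_divide pos_divide_le_eq mult_ac)
    then have "4/3 * (d + 2)\<^sup>2 \<le> 4/3 * (\<alpha> * real N * R\<^sup>2)" by simp
    \<comment> \<open>The missing factor \<open>4/3\<close> comes from the geometric series, since
      \<open>x \<ge> 1/4\<close>.\<close>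
    also have "\<dots> \<le> 1 / (1 - x) * (\<alpha> * real N * R\<^sup>2)"
      using x \<alpha> by (intro mult_right_mono) (auto simp: field_simps)
    finally show ?thesis by (simp add: n_def mult_ac)
  qed
  note K = prior_information_bounds[where 'n='n, folded d_def, OF this]
  have "ennreal (d\<^sup>2 / ((1 + \<alpha>) * n)) \<le> minimax_risk2 B N (class_C (r - R))"
    unfolding d_def using s K by (intro ball_prior_minimax[OF B _ _ n0 sum \<alpha>]) (auto simp: R_def r_def d_def mult_ac)
  moreover have "d\<^sup>2 / ((1 + \<alpha>) * n) = d\<^sup>2 * (1 - (s + 1)\<^sup>2 / 4) / ((1 + \<alpha>) * real N)"
    by (simp add: n_def x_def power_divide)
  ultimately show ?thesis using rR by simp
qed

text \<open>With \<open>R = 1/2\<close> and \<open>r = s + 1/2\<close> the growth factor is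
  \<open>s + 1\<close>, and \<open>n\<close> results from summing a geometric series twice. As
  \<open>n\<close> is at least of order \<open>4 ^ N\<close>, a logarithmic condition on
  \<open>N\<close> is enough.\<close>

lemma minimax_explosive:
  fixes B :: "real^'n^'n"
  defines "d \<equiv> real CARD('n)"
  assumes B: "invertible B"
    and s: "1 < s" and \<alpha>: "0 < \<alpha>" "\<alpha> < 1"
    and le: "log 2 ((d + 2) / \<alpha>) + 3 \<le> real N"
  shows "ennreal (d\<^sup>2 * ((s + 1)\<^sup>2 - 1)\<^sup>2 / ((1 + \<alpha>) * (s + 1) ^ (2 * N))) \<le> minimax_risk2 B N (class_C s)"
proof -
  define x n y where "x = (s + 1)\<^sup>2" and "n = x ^ N / (x - 1)\<^sup>2" and "y = (d + 2) / \<alpha>"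
  have d: "1 \<le> d" using zero_less_card_finite[where 'a='n] by (simp add: d_def Suc_le_eq)
  have x: "4 < x"
  proof -
    have "2\<^sup>2 < x" unfolding x_def using s by (intro power_strict_mono) auto
    then show ?thesis by simp
  qed
  have y\<alpha>: "y * \<alpha> = d + 2" using \<alpha> by (simp add: y_def)
  have y: "d + 2 \<le> y"
    unfolding y_def using d \<alpha> by (subst pos_le_divide_eq) (auto intro!: mult_left_le)
  have y3: "3 \<le> y" using y d by linarith
  have "1 < log 2 y" using y3 by (simp add: less_log_iff)
  then have N4: "4 < N" using le unfolding y_def[symmetric] by linarith
  have yN: "y \<le> 2 ^ (N - 3)"
  proof -
    have "log 2 y \<le> real (N - 3)" using le N4 unfolding y_def[symmetric] by (simp add: of_nat_diff)
    then show ?thesis using y3 by (simp add: log_le_iff powr_realpow)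
  qed
  have geo: "(\<Sum>l<i. x ^ l) \<le> x ^ i / (x - 1)" for i
    using x by (subst geometric_sum) (auto intro!: divide_right_mono)
  have "(\<Sum>i<N. \<Sum>l<i. x ^ l) \<le> (\<Sum>i<N. x ^ i / (x - 1))"
    by (intro sum_mono geo)
  also have "\<dots> = (\<Sum>i<N. x ^ i) / (x - 1)" by (simp add: sum_divide_distrib)
  also have "\<dots> \<le> x ^ N / (x - 1) / (x - 1)"
    using x by (intro divide_right_mono geo) simp
  finally have sum: "(\<Sum>i<N. \<Sum>l<i. ((s + 1/2) + 1/2) ^ (2 * l)) \<le> n"
    by (simp add: n_def x_def power_mult power2_eq_square add.assoc)
  have n0: "0 < n" using x by (simp add: n_def)
  have "64/9 * y\<^sup>2 \<le> n"
  proof -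
    \<comment> \<open>That is, \<open>n\<close> is at least its value at \<open>x = 4\<close>. In
      the variable \<open>w = x / 4\<close> the fourth power suffices, and
      \<open>4 < N\<close>.\<close>
    have "4 ^ N * (x - 1)\<^sup>2 \<le> 9 * x ^ N"
    proof -
      define w where "w = x / 4"
      have w: "1 < w" using x by (simp add: w_def)
      have "(4 * w - 1)\<^sup>2 \<le> (3 * w\<^sup>2)\<^sup>2"
      proof (rule power_mono)
        have "0 \<le> (3 * w - 1) * (w - 1)" using w by simp
        then show "4 * w - 1 \<le> 3 * w\<^sup>2" by (simp add: power2_eq_square algebra_simps)
      qed (use w in simp)
      also have "\<dots> = 9 * w ^ 4" by (simp add: power_mult_distrib flip: power_mult)
      also have "\<dots> \<le> 9 * w ^ N" using w N4 by (intro mult_left_mono power_increasing) auto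
      finally have "4 ^ N * (4 * w - 1)\<^sup>2 \<le> 4 ^ N * (9 * w ^ N)" by (rule mult_left_mono) simp
      then show ?thesis by (simp add: w_def power_divide)
    qed
    then have "4 ^ N / 9 \<le> n" using x by (simp add: n_def pos_le_divide_eq pos_divide_le_eq mult_ac)
    \<comment> \<open>The summand 3 in the hypothesis on \<open>N\<close> yields the factor
      \<open>4 ^ 3\<close>; after division by 9 and by \<open>1 / R\<^sup>2 = 4\<close> there
      remains \<open>16/9\<close>, more than \<open>4/3\<close>.\<close>
    moreover have "64 * y\<^sup>2 \<le> 4 ^ N"
    proof -
      have "y\<^sup>2 \<le> (2 ^ (N - 3))\<^sup>2" using y3 yN by (intro power_mono) auto
      also have "\<dots> = 4 ^ (N - 3)" by (simp flip: power_mult power_mult_distrib add: power2_eq_square mult.commute)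
      finally have "64 * y\<^sup>2 \<le> 4 ^ 3 * 4 ^ (N - 3)" by simp
      also have "\<dots> = 4 ^ N" using N4 by (subst power_add[symmetric]) simp
      finally show ?thesis .
    qed
    ultimately show ?thesis by linarith
  qed
  then have "64/9 * y\<^sup>2 * \<alpha> \<le> n * \<alpha>" using \<alpha> by (intro mult_right_mono) auto
  moreover have "(d + 2)\<^sup>2 \<le> y\<^sup>2 * \<alpha>"
  proof -
    have "y\<^sup>2 * \<alpha> = (d + 2) * y" by (simp add: power2_eq_square flip: y\<alpha>)
    moreover have "(d + 2) * (d + 2) \<le> (d + 2) * y" using y d by (intro mult_left_mono) auto
    moreover have "(d + 2)\<^sup>2 = (d + 2) * (d + 2)" by (rule power2_eq_square)
    ultimately show ?thesis by linarith
  qed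
  moreover have "\<alpha> * n * (1/2)\<^sup>2 = n * \<alpha> * (1/4)" by (simp add: power2_eq_square)
  moreover have "64/9 * y\<^sup>2 * \<alpha> = 64/9 * (y\<^sup>2 * \<alpha>)" by simp
  ultimately have "4/3 * (d + 2)\<^sup>2 \<le> \<alpha> * n * (1/2)\<^sup>2"
    using zero_le_power2[of "d + 2"] by linarith
  note K = prior_information_bounds[where 'n='n, folded d_def, OF this]
  have "ennreal (d\<^sup>2 / ((1 + \<alpha>) * n)) \<le> minimax_risk2 B N (class_C ((s + 1/2) - 1/2))"
    unfolding d_def using s K by (intro ball_prior_minimax[OF B _ _ n0 sum \<alpha>]) (auto simp: d_def mult_ac)
  moreover have "d\<^sup>2 / ((1 + \<alpha>) * n) = d\<^sup>2 * ((s + 1)\<^sup>2 - 1)\<^sup>2 / ((1 + \<alpha>) * (s + 1) ^ (2 * N))"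
    by (simp add: n_def x_def power_mult)
  ultimately show ?thesis by simp
qed

section \<open>Diagonal perturbations of the identity\<close>

text \<open>The outer square makes \<open>(quartic' t)\<^sup>2 / quartic t\<close> the polynomial
  \<open>4 * (3 - 2 * t)\<^sup>2\<close> on the support, and the factor \<open>t\<^sup>2\<close>
  cancels the denominator in \<open>double_geometric_le\<close>.\<close>

definition quartic :: "real \<Rightarrow> real" where
  "quartic t = max 0 (t * (3 - t)) ^ 2"

definition quartic' :: "real \<Rightarrow> real" where
  "quartic' t = 2 * max 0 (t * (3 - t)) * (3 - 2 * t)"

lemma quartic_nonneg: "0 \<le> quartic t"
  by (simp add: quartic_def)

lemma quartic_pos_iff: "0 < quartic t \<longleftrightarrow> 0 < t \<and> t < 3"
proof -
  have "0 < quartic t \<longleftrightarrow> 0 < t * (3 - t)"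
    by (cases "0 < t * (3 - t)") (auto simp: quartic_def max_def)
  then show ?thesis by (auto simp: zero_less_mult_iff)
qed

lemma quartic_eq: "0 \<le> t \<Longrightarrow> t \<le> 3 \<Longrightarrow> quartic t = t\<^sup>2 * (3 - t)\<^sup>2"
  by (simp add: quartic_def max_def power_mult_distrib mult_nonneg_nonneg)

lemma quartic'_eq_0: "quartic t = 0 \<Longrightarrow> quartic' t = 0"
  by (simp add: quartic_def quartic'_def)

lemma DERIV_quartic: "(quartic has_real_derivative quartic' t) (at t)"
proof -
  have "((\<lambda>t. t * (3 - t)) has_real_derivative 3 - 2 * t) (at t)"
    by (auto intro!: derivative_eq_intros)
  from DERIV_chain[OF DERIV_max0_power[of 2] this] show ?thesis
    unfolding quartic_def[abs_def] quartic'_def o_def by simp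
qed

lemma continuous_on_quartic: "continuous_on S quartic" "continuous_on S quartic'"
  unfolding quartic_def[abs_def] quartic'_def[abs_def] by (intro continuous_intros)+

lemma measurable_quartic[measurable]: "quartic \<in> borel_measurable borel" "quartic' \<in> borel_measurable borel"
  using continuous_on_quartic by (auto intro: borel_measurable_continuous_onI)

lemma nn_integral_quartic: "(\<integral>\<^sup>+t. ennreal (quartic t) \<partial>lborel) = ennreal (81/10)"
proof -
  define F :: "real \<Rightarrow> real" where "F t = 3 * t ^ 3 - 3/2 * t ^ 4 + t ^ 5 / 5" for t
  have "(\<integral>\<^sup>+t. ennreal (quartic t) \<partial>lborel) = (\<integral>\<^sup>+t. ennreal (t\<^sup>2 * (3 - t)\<^sup>2) * indicator {0..3} t \<partial>lborel)"
  proof (rule nn_integral_cong)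
    fix t :: real
    show "ennreal (quartic t) = ennreal (t\<^sup>2 * (3 - t)\<^sup>2) * indicator {0..3} t"
      using quartic_pos_iff[of t] quartic_nonneg[of t] quartic_eq[of t]
      by (cases "0 \<le> t \<and> t \<le> 3") (auto simp: indicator_def not_le order.strict_iff_order)
  qed
  also have "\<dots> = ennreal (F 3 - F 0)"
  proof (rule nn_integral_FTC_Icc)
    show "(F has_real_derivative t\<^sup>2 * (3 - t)\<^sup>2) (at t)" for t
      unfolding F_def by (auto intro!: derivative_eq_intros simp: power2_eq_square power3_eq_cube eval_nat_numeral algebra_simps)
  qed auto
  finally show ?thesis by (simp add: F_def)
qed

definition cube_prior :: "'e::euclidean_space \<Rightarrow> real" where
  "cube_prior z = (\<Prod>c\<in>Basis. quartic (z \<bullet> c))"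

definition cube_prior' :: "'e::euclidean_space \<Rightarrow> 'e \<Rightarrow> real" where
  "cube_prior' b z = quartic' (z \<bullet> b) * (\<Prod>c\<in>Basis - {b}. quartic (z \<bullet> c))"

lemma cube_prior_remove: "b \<in> Basis \<Longrightarrow> cube_prior z = quartic (z \<bullet> b) * (\<Prod>c\<in>Basis - {b}. quartic (z \<bullet> c))"
  unfolding cube_prior_def by (rule prod.remove) auto

lemma cube_prior_pos: "0 < cube_prior z \<Longrightarrow> c \<in> Basis \<Longrightarrow> 0 < z \<bullet> c \<and> z \<bullet> c < 3"
  using quartic_pos_iff quartic_nonneg unfolding cube_prior_def
  by (metis finite_Basis less_le prod_zero_iff)

lemma cube_smooth_prior:
  "smooth_prior (cube_prior :: 'e::euclidean_space \<Rightarrow> real) cube_prior' (3 * real DIM('e)) ((81/10) ^ DIM('e))"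
proof
  show nonneg: "0 \<le> cube_prior z" for z :: 'e
    unfolding cube_prior_def by (intro prod_nonneg) (simp add: quartic_nonneg)
  show "continuous_on UNIV (cube_prior :: 'e \<Rightarrow> real)"
    unfolding cube_prior_def[abs_def]
    by (intro continuous_on_prod continuous_on_compose2[OF continuous_on_quartic(1)[of UNIV]] continuous_intros) auto
  show "continuous_on UNIV (cube_prior' b)" for b :: 'e
    unfolding cube_prior'_def[abs_def]
    by (intro continuous_on_mult continuous_on_prod continuous_on_compose2[OF continuous_on_quartic(1)[of UNIV]]
        continuous_on_compose2[OF continuous_on_quartic(2)[of UNIV]] continuous_intros) auto
  show "cube_prior z = 0" if "3 * real DIM('e) < norm z" for z :: 'e
  proof (rule ccontr)
    assume "cube_prior z \<noteq> 0"
    then have "0 < cube_prior z" using nonneg[of z] by simp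
    then have "\<bar>z \<bullet> c\<bar> \<le> 3" if "c \<in> Basis" for c using cube_prior_pos[of z c] that by auto
    then have "(\<Sum>c\<in>Basis. \<bar>z \<bullet> c\<bar>) \<le> (\<Sum>c\<in>(Basis :: 'e set). 3)" by (intro sum_mono)
    then show False using norm_le_l1[of z] that by simp
  qed
  show "cube_prior' b z = 0" if "b \<in> Basis" "cube_prior z = 0" for b z :: 'e
    using that quartic'_eq_0[of "z \<bullet> b"] by (auto simp: cube_prior_remove[of b] cube_prior'_def)
  show "((\<lambda>t. cube_prior (z + t *\<^sub>R b)) has_real_derivative cube_prior' b z) (at 0)" if b: "b \<in> Basis" for b z :: 'e
  proof -
    have "(z + t *\<^sub>R b) \<bullet> c = z \<bullet> c" if "c \<in> Basis - {b}" for t c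
      using that b by (auto simp: inner_add_left inner_Basis)
    then have "(\<Prod>c\<in>Basis - {b}. quartic ((z + t *\<^sub>R b) \<bullet> c)) = (\<Prod>c\<in>Basis - {b}. quartic (z \<bullet> c))" for t
      by (intro prod.cong refl) auto
    then have eq: "cube_prior (z + t *\<^sub>R b) = quartic (z \<bullet> b + t) * (\<Prod>c\<in>Basis - {b}. quartic (z \<bullet> c))" for t
      unfolding cube_prior_remove[OF b] using b by (simp add: inner_add_left[of z "t *\<^sub>R b" b])
    have "((\<lambda>t. quartic (z \<bullet> b + t)) has_real_derivative quartic' (z \<bullet> b)) (at 0)"
      using DERIV_quartic[of "z \<bullet> b"] DERIV_shift[of quartic "quartic' (z \<bullet> b)" 0 "z \<bullet> b"] by (simp add: add.commute)
    then show ?thesis unfolding eq cube_prior'_def by (rule DERIV_cmult_right)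
  qed
  have "(\<integral>\<^sup>+z. ennreal (cube_prior (z :: 'e)) \<partial>lborel) = (\<Prod>c\<in>(Basis :: 'e set). (\<integral>\<^sup>+t. ennreal (quartic t) \<partial>lborel))"
    unfolding cube_prior_def
    by (subst nn_integral_lborel_prod[symmetric]) (auto simp: prod_ennreal quartic_nonneg)
  then show "(\<integral>\<^sup>+z. ennreal (cube_prior (z :: 'e)) \<partial>lborel) = ennreal ((81/10) ^ DIM('e))"
    by (simp add: nn_integral_quartic ennreal_power)
qed simp

text \<open>The information along \<open>b\<close> depends on \<open>z \<bullet> b\<close> only, so
  the integrand is a product over coordinates. All factors but one contribute the mass
  \<open>81/10\<close> of \<open>quartic\<close>, and \<open>V\<close> is free of the
  dimension.\<close>

lemma cube_information:
  fixes b :: "'e::euclidean_space"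
  assumes b: "b \<in> Basis" and [measurable]: "f \<in> borel_measurable borel" and f: "\<And>t. 0 \<le> t \<Longrightarrow> 0 \<le> f t"
    and V: "(\<integral>\<^sup>+t. ennreal (quartic t * f t + (quartic' t)\<^sup>2 / quartic t) \<partial>lborel) \<le> ennreal (V * (81/10))" "0 \<le> V"
  shows "(\<integral>\<^sup>+z. ennreal (cube_prior z * f (z \<bullet> b) + (cube_prior' b z)\<^sup>2 / cube_prior z) \<partial>lborel)
    \<le> ennreal (V * (81/10) ^ DIM('e))"
proof -
  define g where "g t = quartic t * f t + (quartic' t)\<^sup>2 / quartic t" for t
  have qf: "0 \<le> quartic t * f t" for t
    using f[of t] quartic_pos_iff[of t] quartic_nonneg[of t] by (cases "0 < t") (auto simp: less_le)
  then have g0: "0 \<le> g t" for t unfolding g_def using quartic_nonneg by (intro add_nonneg_nonneg) auto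
  have [measurable]: "g \<in> borel_measurable borel" unfolding g_def[abs_def] by measurable
  define h where "h c = (if c = b then g else quartic)" for c
  have "cube_prior z * f (z \<bullet> b) + (cube_prior' b z)\<^sup>2 / cube_prior z = (\<Prod>c\<in>Basis. h c (z \<bullet> c))" for z
  proof -
    define P where "P = (\<Prod>c\<in>Basis - {b}. quartic (z \<bullet> c))"
    have "(\<Prod>c\<in>Basis. h c (z \<bullet> c)) = g (z \<bullet> b) * (\<Prod>c\<in>Basis - {b}. h c (z \<bullet> c))"
      using b by (subst prod.remove[of _ b]) (auto simp: h_def)
    also have "(\<Prod>c\<in>Basis - {b}. h c (z \<bullet> c)) = P" unfolding P_def by (intro prod.cong) (auto simp: h_def)
    finally show ?thesis
      unfolding cube_prior_remove[OF b] cube_prior'_def P_def[symmetric] g_def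
      by (cases "P = 0") (simp_all add: power2_eq_square field_simps)
  qed
  then have "(\<integral>\<^sup>+z. ennreal (cube_prior z * f (z \<bullet> b) + (cube_prior' b z)\<^sup>2 / cube_prior z) \<partial>lborel)
    = (\<integral>\<^sup>+z. (\<Prod>c\<in>Basis. ennreal (h c (z \<bullet> c))) \<partial>lborel)"
    by (subst prod_ennreal) (auto simp: h_def g0 quartic_nonneg)
  also have "\<dots> = (\<Prod>c\<in>Basis. (\<integral>\<^sup>+t. ennreal (h c t) \<partial>lborel))"
    by (rule nn_integral_lborel_prod) (auto simp: h_def)
  also have "\<dots> = (\<integral>\<^sup>+t. ennreal (g t) \<partial>lborel) * (\<Prod>c\<in>Basis - {b}. (\<integral>\<^sup>+t. ennreal (h c t) \<partial>lborel))"
    using b by (subst prod.remove[of _ b]) (auto simp: h_def)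
  also have "(\<Prod>c\<in>Basis - {b}. (\<integral>\<^sup>+t. ennreal (h c t) \<partial>lborel)) = (\<Prod>c\<in>Basis - {b}. ennreal (81/10))"
    by (intro prod.cong refl) (auto simp: h_def nn_integral_quartic)
  also have "\<dots> = ennreal ((81/10) ^ (DIM('e) - 1))"
    using b by (simp add: ennreal_power)
  also have "(\<integral>\<^sup>+t. ennreal (g t) \<partial>lborel) * ennreal ((81/10) ^ (DIM('e) - 1)) \<le> ennreal (V * (81/10)) * ennreal ((81/10) ^ (DIM('e) - 1))"
    using V(1) unfolding g_def by (rule mult_right_mono) simp
  also have "\<dots> = ennreal (V * ((81/10) * (81/10) ^ (DIM('e) - 1)))"
    using V(2) by (simp add: mult.assoc flip: ennreal_mult)
  also have "(81/10::real) * (81/10) ^ (DIM('e) - 1) = (81/10) ^ DIM('e)"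
    using DIM_positive[where 'a='e] by (simp flip: power_Suc)
  finally show ?thesis .
qed

text \<open>By \<open>1 + x \<le> exp x\<close> the terms are at most powers of
  \<open>exp a\<close>, and by \<open>a \<le> exp a - 1\<close> each geometric sum is at most the
  matching integral. The right side is \<open>N\<^sup>2\<close> times the integral of
  \<open>exp (2 * t * y)\<close> over \<open>0 \<le> y \<le> x \<le> 1\<close>.\<close>

lemma double_geometric_le:
  fixes t :: real
  assumes "0 < t" "0 < N"
  shows "(\<Sum>i<N. \<Sum>l<i. (1 + t / real N) ^ (2 * l)) \<le> (real N)\<^sup>2 * ((exp (2 * t) - 1 - 2 * t) / (4 * t\<^sup>2))"
proof -
  define a where "a = 2 * t / real N"
  have a: "0 < a" using assms by (simp add: a_def)
  have aexp: "a \<le> exp a - 1" using exp_ge_add_one_self[of a] by linarith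
  have geo: "(\<Sum>l<i. exp a ^ l) \<le> (exp (a * real i) - 1) / a" for i
  proof -
    have "(\<Sum>l<i. exp a ^ l) = (exp (a * real i) - 1) / (exp a - 1)"
      using a by (subst geometric_sum) (auto simp: exp_of_nat2_mult)
    also have "\<dots> \<le> (exp (a * real i) - 1) / a"
      using a aexp by (intro divide_left_mono mult_pos_pos) auto
    finally show ?thesis .
  qed
  have "(1 + t / real N) ^ (2 * l) \<le> exp a ^ l" for l
  proof -
    have "(1 + t / real N)\<^sup>2 \<le> (exp (t / real N))\<^sup>2"
      using assms by (intro power_mono exp_ge_add_one_self) auto
    also have "\<dots> = exp a" by (simp add: a_def power2_eq_square flip: exp_add)
    finally have "((1 + t / real N)\<^sup>2) ^ l \<le> exp a ^ l" by (intro power_mono) auto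
    then show ?thesis by (simp add: power_mult)
  qed
  then have "(\<Sum>i<N. \<Sum>l<i. (1 + t / real N) ^ (2 * l)) \<le> (\<Sum>i<N. \<Sum>l<i. exp a ^ l)"
    by (intro sum_mono)
  also have "\<dots> \<le> (\<Sum>i<N. (exp a ^ i - 1) / a)"
    using geo by (intro sum_mono) (simp add: exp_of_nat2_mult)
  also have "\<dots> = ((\<Sum>i<N. exp a ^ i) - real N) / a"
    by (simp add: sum_divide_distrib[symmetric] sum_subtractf)
  also have "\<dots> \<le> ((exp (a * real N) - 1) / a - real N) / a"
    using a by (intro divide_right_mono diff_right_mono geo) auto
  also have "\<dots> = (real N)\<^sup>2 * ((exp (2 * t) - 1 - 2 * t) / (4 * t\<^sup>2))"
    using assms by (simp add: a_def field_simps power2_eq_square)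
  finally show ?thesis .
qed

section \<open>Explicit constants for \<open>s = 1\<close>\<close>

lemma exp_6_le: "exp 6 \<le> (405::real)"
proof -
  have "exp (1::real) ^ 6 \<le> (272/100) ^ 6" using e_less_272 by (intro power_mono) auto
  also have "\<dots> \<le> 405" by (simp add: power_divide)
  finally show ?thesis by (simp flip: exp_of_nat_mult)
qed

text \<open>On \<open>[0, 3]\<close> the integrand is at most an elementary function
  \<open>h\<close> with integral \<open>(exp 6 + 461) / 16\<close>. By \<open>exp_6_le\<close> this
  is at most 54.125; divided by the mass 8.1 and rounded up it gives 6.69.\<close>

lemma quartic_information:
  assumes N: "0 < N"
  shows "(\<integral>\<^sup>+t. ennreal (quartic t * ((\<Sum>i<N. \<Sum>l<i. (1 + t / real N) ^ (2 * l)) / (real N)\<^sup>2) + (quartic' t)\<^sup>2 / quartic t) \<partial>lborel)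
    \<le> ennreal (669/100 * (81/10))"
proof -
  define h where "h t = (exp (2 * t) - 1 - 2 * t) * (3 - t)\<^sup>2 / 4 + 4 * (3 - 2 * t)\<^sup>2" for t :: real
  define F where "F t = (exp (2 * t) * ((3 - t)\<^sup>2 / 2 + (3 - t) / 2 + 1/4)
      - (9 * t + 6 * t\<^sup>2 - 11/3 * t ^ 3 + t ^ 4 / 2)) / 4 - 2/3 * (3 - 2 * t) ^ 3" for t :: real
  have h0: "0 \<le> h t" for t
  proof -
    have "0 \<le> exp (2 * t) - 1 - 2 * t" using exp_ge_add_one_self[of "2 * t"] by linarith
    then show ?thesis unfolding h_def by (intro add_nonneg_nonneg divide_nonneg_nonneg mult_nonneg_nonneg) auto
  qed
  have hm: "h \<in> borel_measurable borel"
    unfolding h_def[abs_def] by measurable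
  have "(\<integral>\<^sup>+t. ennreal (quartic t * ((\<Sum>i<N. \<Sum>l<i. (1 + t / real N) ^ (2 * l)) / (real N)\<^sup>2) + (quartic' t)\<^sup>2 / quartic t) \<partial>lborel)
    \<le> (\<integral>\<^sup>+t. ennreal (h t) * indicator {0..3} t \<partial>lborel)"
  proof (rule nn_integral_mono)
    fix t :: real
    show "ennreal (quartic t * ((\<Sum>i<N. \<Sum>l<i. (1 + t / real N) ^ (2 * l)) / (real N)\<^sup>2) + (quartic' t)\<^sup>2 / quartic t)
      \<le> ennreal (h t) * indicator {0..3} t"
    proof (cases "0 < t \<and> t < 3")
      case True
      define S where "S = (\<Sum>i<N. \<Sum>l<i. (1 + t / real N) ^ (2 * l)) / (real N)\<^sup>2"
      have "S \<le> (exp (2 * t) - 1 - 2 * t) / (4 * t\<^sup>2)"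
        using double_geometric_le[of t N] True N unfolding S_def by (simp add: pos_divide_le_eq mult.commute)
      then have "quartic t * S \<le> quartic t * ((exp (2 * t) - 1 - 2 * t) / (4 * t\<^sup>2))"
        by (intro mult_left_mono quartic_nonneg)
      also have "\<dots> = (exp (2 * t) - 1 - 2 * t) * (3 - t)\<^sup>2 / 4"
        using True by (simp add: quartic_eq)
      finally have 1: "quartic t * S \<le> (exp (2 * t) - 1 - 2 * t) * (3 - t)\<^sup>2 / 4" .
      have "(quartic' t)\<^sup>2 / quartic t = 4 * (3 - 2 * t)\<^sup>2"
        using True by (simp add: quartic'_def quartic_def max_def power_mult_distrib not_le zero_less_mult_iff)
      then show ?thesis using 1 True unfolding S_def[symmetric] by (auto simp: h_def intro!: ennreal_leI)
    next
      case False
      then have "\<not> 0 < quartic t" by (simp add: quartic_pos_iff)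
      then have "quartic t = 0" using quartic_nonneg[of t] by linarith
      then show ?thesis by simp
    qed
  qed
  also have "\<dots> = ennreal (F 3 - F 0)"
  proof (rule nn_integral_FTC_Icc)
    show "(F has_real_derivative h t) (at t)" for t
      unfolding F_def h_def
      by (auto intro!: derivative_eq_intros simp: power2_eq_square power3_eq_cube eval_nat_numeral field_simps)
  qed (use h0 hm in auto)
  also have "F 3 - F 0 = exp 6 / 16 + 461 / 16"
    by (simp add: F_def power2_eq_square power3_eq_cube field_simps)
  also have "ennreal (exp 6 / 16 + 461 / 16) \<le> ennreal (669/100 * (81/10))"
    using exp_6_le by (intro ennreal_leI) linarith
  finally show ?thesis .
qed

text \<open>For \<open>u = sqrt d\<close> the square of \<open>u + 1 / u\<close> exceeds
  \<open>d + 2\<close> only by \<open>1 / d\<close>, so the logarithm is at most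
  \<open>2 * ln (u + 1 / u)\<close>, and a tangent of \<open>ln\<close> reduces everything to a
  quadratic inequality in \<open>u\<close>. Near \<open>d = 10\<close> the two sides are within five
  per cent of each other, hence the careful decimals.\<close>

lemma log_square_le:
  fixes d :: real
  assumes "0 < d"
  shows "669/100 * d * (ln (d + 2))\<^sup>2 \<le> 3 * (d + 2)\<^sup>2"
proof (cases "ln (d + 2) \<le> 0")
  case True
  then show ?thesis using assms by simp
next
  case False
  \<comment> \<open>The tangent to \<open>ln\<close> is taken at \<open>exp (6/5)\<close>, about
    3.3, not far from \<open>u + 1 / u\<close> for the critical \<open>d\<close>.\<close>
  define u c where "u = sqrt d" and "c = exp (6/5 :: real)"
  have u: "0 < u" "u\<^sup>2 = d" using assms by (auto simp: u_def)
  have w: "0 < u + 1 / u" using u(1) by (simp add: add_pos_pos)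
  have "(1 + 1/5 + (1/5)\<^sup>2 / 2) ^ 6 \<le> exp (1/5 :: real) ^ 6"
    by (intro power_mono exp_lower_Taylor_quadratic) auto
  also have "\<dots> = c" by (simp add: c_def flip: exp_of_nat_mult)
  finally have c: "32973/10000 \<le> c" by (simp add: power2_eq_square power_divide)
  have "ln (d + 2) \<le> ln ((u + 1 / u)\<^sup>2)"
  proof -
    have "(u + 1 / u)\<^sup>2 = d + 2 + 1 / u\<^sup>2" using u by (simp add: power2_sum power_divide)
    moreover have "0 < 1 / u\<^sup>2" using u(1) by simp
    ultimately show ?thesis using assms by (subst ln_le_cancel_iff) linarith+
  qed
  also have "\<dots> = 2 * ln (u + 1 / u)" using u(1) by (simp add: ln_realpow add_pos_pos)
  also have "\<dots> = 2 * (ln ((u + 1 / u) / c) + 6/5)"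
    using w by (subst ln_div) (auto simp: c_def)
  also have "\<dots> \<le> 2 * ((u + 1 / u) / c - 1 + 6/5)"
    using u(1) c by (intro mult_left_mono add_right_mono ln_le_minus_one divide_pos_pos add_pos_pos) auto
  also have "\<dots> = 2/5 + (u + 1 / u) * (2 / c)" by simp
  also have "\<dots> \<le> 2/5 + (u + 1 / u) * (6067/10000)"
    using u(1) c by (intro add_left_mono mult_left_mono) (auto simp: pos_divide_le_eq)
  finally have "u * ln (d + 2) \<le> u * (2/5 + (u + 1 / u) * (6067/10000))"
    using u(1) by (intro mult_left_mono) auto
  also have "\<dots> = 2/5 * u + 6067/10000 * (u\<^sup>2 + 1)" using u(1) by (simp add: power2_eq_square field_simps)
  \<comment> \<open>The inequality is proved for square roots: \<open>14934/10000\<close> is just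
    above the root of \<open>223/100\<close>, which is \<open>669/100\<close> divided by 3.\<close>
  finally have "u * ln (d + 2) * (14934/10000) \<le> (2/5 * u + 6067/10000 * (u\<^sup>2 + 1)) * (14934/10000)"
    by (intro mult_right_mono) auto
  also have "\<dots> \<le> u\<^sup>2 + 2"
  proof -
    \<comment> \<open>\<open>318/100\<close> is close to the vertex of the quadratic that
      remains.\<close>
    have "(u - 318/100)\<^sup>2 = u\<^sup>2 - 636/100 * u + 101124/10000"
      by (simp add: power2_eq_square algebra_simps)
    then have "0 \<le> u\<^sup>2 - 636/100 * u + 101124/10000" by (metis zero_le_power2)
    moreover have "(2/5 * u + 6067/10000 * (u\<^sup>2 + 1)) * (14934/10000)
        = 59736/100000 * u + 90604578/100000000 * u\<^sup>2 + 90604578/100000000"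
      by (simp add: field_simps)
    ultimately show ?thesis using u(1) by linarith
  qed
  finally have "(u * ln (d + 2) * (14934/10000))\<^sup>2 \<le> (d + 2)\<^sup>2"
    using u False by (intro power_mono) auto
  moreover have "(u * ln (d + 2) * (14934/10000))\<^sup>2 = d * (ln (d + 2))\<^sup>2 * (14934/10000)\<^sup>2"
    by (simp only: power_mult_distrib u(2))
  moreover have "d * (ln (d + 2))\<^sup>2 * (223/100) \<le> d * (ln (d + 2))\<^sup>2 * (14934/10000)\<^sup>2"
    using assms by (intro mult_left_mono) (auto simp: power2_eq_square)
  ultimately show ?thesis by linarith
qed

text \<open>If right multiplication by \<open>M\<close> acts on the direction \<open>C\<close> as a
  scalar, the information is exact. In the diagonal family that scalar involves a single coordinate
  of the parameter.\<close>

lemma info_eigen: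
  fixes M C :: "real^'n^'n"
  assumes "C ** M = \<theta> *\<^sub>R C"
  shows "info C M N = (norm C)\<^sup>2 * (\<Sum>i<N. \<Sum>l<i. \<theta> ^ (2 * l))"
proof -
  have "((\<lambda>X. X ** M) ^^ l) C = \<theta> ^ l *\<^sub>R C" for l
    by (induction l) (simp_all add: matrix_mult_scaleR assms mult.commute)
  then have "(norm (((\<lambda>X. X ** M) ^^ l) C))\<^sup>2 = (norm C)\<^sup>2 * \<theta> ^ (2 * l)" for l
    by (simp add: power_mult_distrib mult.commute power_mult power_even_abs flip: power_mult)
  then show ?thesis unfolding info_def by (simp add: sum_distrib_left)
qed

section \<open>The case \<open>s = 1\<close>\<close>

lemma linear_diag_mat: "linear (\<lambda>z. diag_mat (\<lambda>i. z $ i))"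
  by (rule linearI) (auto simp: diag_mat_def vec_eq_iff)

lemma norm_diag_mat: "(norm (diag_mat f))\<^sup>2 = (\<Sum>i\<in>UNIV. (f i)\<^sup>2)"
proof -
  have "(norm (diag_mat f))\<^sup>2 = (\<Sum>i\<in>UNIV. \<Sum>j\<in>UNIV. if i = j then (f i)\<^sup>2 else 0)"
    unfolding norm_matrix_entries diag_mat_def by (intro sum.cong) auto
  then show ?thesis by simp
qed

text \<open>Diagonal matrices commute with \<open>diag_mat s\<close>, so the perturbation has the
  same entries in the coordinates of \<open>A\<close> and of \<open>B\<inverse> A B\<close> and
  needs no weights. Positive \<open>z $ i\<close> keep all singular values at least 1, and
  \<open>669/100\<close> bounds the total information for each coordinate at the scale
  \<open>1 / N\<close>.\<close>

lemma minimax_critical: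
  fixes B :: "real^'n^'n"
  defines "d \<equiv> real CARD('n)"
  assumes B: "invertible B" and N: "0 < N"
  shows "ennreal (d / (669/100 * (real N)\<^sup>2)) \<le> minimax_risk2 B N (class_C 1)"
  unfolding minimax_risk2_def
proof (rule INF_greatest)
  fix Ahat :: "(nat \<Rightarrow> real^'n) \<Rightarrow> real^'n^'n" assume Ahat: "Ahat \<in> borel_measurable (obs_space N)"
  obtain U V s where svd: "orthogonal_matrix U" "orthogonal_matrix V" "B ** V = U ** diag_mat s"
    and s: "\<And>i::'n. 0 < s i" using invertible_SVD[OF B] by metis
  have U: "transpose U ** U = mat 1" "U ** transpose U = mat 1" and V: "transpose V ** V = mat 1" "V ** transpose V = mat 1"
    using svd by (auto simp: orthogonal_matrix_def)
  have B_eq: "B = U ** diag_mat s ** transpose V"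
    using svd(3) by (metis V(2) matrix_mul_assoc matrix_mul_rid)
  define E where "E z = diag_mat (\<lambda>i. z $ i)" for z :: "real^'n"
  define \<Phi> where "\<Phi> z = (1 / real N) *\<^sub>R (V ** E z ** transpose V)" for z
  define A where "A z = mat 1 + (1 / real N) *\<^sub>R (U ** E z ** transpose U)" for z
  have AB: "A z ** B = B ** (mat 1 + \<Phi> z)" for z
  proof -
    have 1: "E z ** diag_mat s = diag_mat s ** E z" by (simp add: E_def diag_mat_mult mult.commute)
    have "U ** E z ** transpose U ** B = U ** E z ** (transpose U ** U) ** diag_mat s ** transpose V"
      by (simp only: B_eq matrix_mul_assoc)
    also have "\<dots> = U ** (E z ** diag_mat s) ** transpose V"
      by (simp only: U matrix_mul_rid matrix_mul_assoc)
    also have "\<dots> = U ** diag_mat s ** (transpose V ** V) ** E z ** transpose V"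
      by (simp only: 1 V matrix_mul_rid matrix_mul_assoc)
    also have "\<dots> = B ** (V ** E z ** transpose V)"
      by (simp only: B_eq matrix_mul_assoc)
    finally have 2: "U ** E z ** transpose U ** B = B ** (V ** E z ** transpose V)" .
    show ?thesis unfolding A_def \<Phi>_def
      by (simp only: matrix_add_mult matrix_add_ldistrib matrix_mult_scaleR matrix_mul_lid matrix_mul_rid 2)
  qed
  have linA: "linear (\<lambda>z. (1 / real N) *\<^sub>R (U ** E z ** transpose U))" and lin\<Phi>: "linear \<Phi>"
    unfolding \<Phi>_def E_def by (intro linear_conjugation linear_diag_mat)+
  have contA: "continuous_on UNIV A"
    unfolding A_def using linA
    by (intro continuous_on_add continuous_on_const) (simp only: linear_continuous_on linear_conv_bounded_linear)
  interpret smooth_prior "cube_prior :: real^'n \<Rightarrow> real" cube_prior' "3 * real DIM(real^'n)" "(81/10) ^ DIM(real^'n)"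
    by (rule cube_smooth_prior)
  define \<psi> where "\<psi> e W = real N * ((\<chi> j. (transpose U ** (W - mat 1) ** U) $ j $ j) \<bullet> e)" for e and W :: "real^'n^'n"
  have axisE: "\<exists>j. e = axis j 1" if "e \<in> (Basis :: (real^'n) set)" for e
    using that by (auto simp: Basis_vec_def)
  have "ennreal (\<Sum>e\<in>(Basis :: (real^'n) set). (1 / (real N)\<^sup>2) / (669/100)) \<le> (SUP A\<in>class_C 1. risk2 B N Ahat A)"
  proof (rule prior_risk_bound[OF lin\<Phi> Ahat AB contA])
    show "\<psi> e \<in> borel_measurable borel" for e
    proof -
      have "\<psi> e = (\<lambda>W. real N * (\<Sum>j\<in>UNIV. ((transpose U ** (W - mat 1) ** U) \<bullet> axis j (axis j 1)) * e $ j))"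
        by (simp add: \<psi>_def inner_vec_def[of _ e] inner_axis fun_eq_iff)
      then show ?thesis by (simp only:) measurable
    qed
    show "(\<Sum>e\<in>Basis. (1 / (real N)\<^sup>2) * (\<psi> e W - z \<bullet> e)\<^sup>2) \<le> (norm (W - A z))\<^sup>2" for W z
    proof -
      define X where "X = transpose U ** (W - mat 1) ** U"
      have "transpose U ** (W - A z) ** U = X - (1 / real N) *\<^sub>R ((transpose U ** U) ** E z ** (transpose U ** U))"
      proof -
        have "W - A z = (W - mat 1) - (1 / real N) *\<^sub>R (U ** E z ** transpose U)" by (simp add: A_def)
        moreover have "transpose U ** (X - Y) = transpose U ** X - transpose U ** Y" for X Y :: "real^'n^'n"
          using matrix_add_ldistrib[of "transpose U" "X - Y" Y] by (simp add: algebra_simps)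
        ultimately show ?thesis
          by (simp only: X_def matrix_add_mult matrix_mult_scaleR matrix_mul_assoc)
      qed
      then have eq: "transpose U ** (W - A z) ** U = X - (1 / real N) *\<^sub>R E z"
        by (simp add: U)
      have "(\<Sum>e\<in>Basis. (1 / (real N)\<^sup>2) * (\<psi> e W - z \<bullet> e)\<^sup>2) = (\<Sum>e\<in>Basis. (((\<chi> j. (X - (1 / real N) *\<^sub>R E z) $ j $ j) :: real^'n) \<bullet> e)\<^sup>2)"
      proof (rule sum.cong[OF refl])
        fix e :: "real^'n" assume "e \<in> Basis"
        then obtain j where e: "e = axis j 1" using axisE by blast
        show "(1 / (real N)\<^sup>2) * (\<psi> e W - z \<bullet> e)\<^sup>2 = (((\<chi> j. (X - (1 / real N) *\<^sub>R E z) $ j $ j) :: real^'n) \<bullet> e)\<^sup>2"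
        proof -
          have "((\<chi> j. (X - (1 / real N) *\<^sub>R E z) $ j $ j) :: real^'n) \<bullet> e = X $ j $ j - z $ j / real N"
            by (simp add: e inner_axis E_def diag_mat_def)
          also have "\<dots> = (real N * X $ j $ j - z $ j) / real N" using N by (simp add: diff_divide_distrib)
          finally show ?thesis
            unfolding \<psi>_def X_def[symmetric] by (simp add: e inner_axis power_divide)
        qed
      qed
      also have "\<dots> = (norm ((\<chi> j. (X - (1 / real N) *\<^sub>R E z) $ j $ j) :: real^'n))\<^sup>2"
        unfolding power2_norm_eq_inner by (subst (2) euclidean_inner) (simp add: power2_eq_square)
      also have "\<dots> = (\<Sum>j\<in>UNIV. ((X - (1 / real N) *\<^sub>R E z) $ j $ j)\<^sup>2)"
        by (simp add: norm_vec_def L2_set_def sum_nonneg)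
      \<comment> \<open>The off-diagonal part of the error is discarded here, which leaves
        \<open>d\<close> coordinates.\<close>
      also have "\<dots> \<le> (\<Sum>j\<in>UNIV. \<Sum>k\<in>UNIV. ((X - (1 / real N) *\<^sub>R E z) $ j $ k)\<^sup>2)"
        by (intro sum_mono member_le_sum) auto
      also have "\<dots> = (norm (transpose U ** (W - A z) ** U))\<^sup>2"
        unfolding eq by (simp only: norm_matrix_entries)
      also have "\<dots> = (norm (W - A z))\<^sup>2"
        using svd(1) by (simp add: norm_orthogonal_mult)
      finally show ?thesis .
    qed
    show "(\<integral>\<^sup>+z. ennreal (cube_prior z * info (\<Phi> e) (mat 1 + \<Phi> z) N + (cube_prior' e z)\<^sup>2 / cube_prior z) \<partial>lborel)
      \<le> ennreal (669/100 * (81/10) ^ DIM(real^'n))" if e: "e \<in> Basis" for e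
    proof -
      obtain j where j: "e = axis j 1" using axisE[OF e] by blast
      have info: "info (\<Phi> e) (mat 1 + \<Phi> z) N = (\<Sum>i<N. \<Sum>l<i. (1 + (z \<bullet> e) / real N) ^ (2 * l)) / (real N)\<^sup>2" for z
      proof -
        \<comment> \<open>\<open>E e\<close> is the projection onto one axis, so the other diagonal
          entries of \<open>E z\<close> drop out.\<close>
        have EE: "E e ** E z = (z \<bullet> e) *\<^sub>R E e"
          by (simp add: E_def diag_mat_mult j inner_axis) (auto simp: diag_mat_def axis_def vec_eq_iff)
        have "(V ** E e ** transpose V) ** (V ** E z ** transpose V) = V ** E e ** (transpose V ** V) ** E z ** transpose V"
          by (simp only: matrix_mul_assoc)
        also have "\<dots> = V ** (E e ** E z) ** transpose V" by (simp only: V matrix_mul_rid matrix_mul_assoc)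
        finally have "(V ** E e ** transpose V) ** (V ** E z ** transpose V) = (z \<bullet> e) *\<^sub>R (V ** E e ** transpose V)"
          by (simp add: EE matrix_mult_scaleR)
        then have "\<Phi> e ** (mat 1 + \<Phi> z) = (1 + (z \<bullet> e) / real N) *\<^sub>R \<Phi> e"
          by (simp add: \<Phi>_def matrix_add_ldistrib matrix_mult_scaleR scaleR_add_left algebra_simps)
        from info_eigen[OF this] have "info (\<Phi> e) (mat 1 + \<Phi> z) N = (norm (\<Phi> e))\<^sup>2 * (\<Sum>i<N. \<Sum>l<i. (1 + (z \<bullet> e) / real N) ^ (2 * l))" .
        moreover have "(norm (E e))\<^sup>2 = 1"
          unfolding E_def norm_diag_mat j by (simp add: axis_def if_distrib[of "\<lambda>x. x\<^sup>2"] cong: if_cong)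
        then have "(norm (\<Phi> e))\<^sup>2 = 1 / (real N)\<^sup>2"
          using svd(2) by (simp add: \<Phi>_def norm_orthogonal_mult power_divide)
        ultimately show ?thesis by simp
      qed
      show ?thesis unfolding info
        by (rule cube_information[OF e _ _ quartic_information[OF N]]) (auto intro!: sum_nonneg divide_nonneg_nonneg)
    qed
    show "A z \<in> class_C 1" if z: "0 < cube_prior z" for z
    proof -
      have z0: "0 < z $ i" for i
        using cube_prior_pos[OF z, of "axis i 1"] by (simp add: inner_axis axis_in_Basis_iff)
      have AU: "A z = U ** diag_mat (\<lambda>i. 1 + z $ i / real N) ** transpose U"
      proof -
        have "diag_mat (\<lambda>i. 1 + z $ i / real N) = mat 1 + (1 / real N) *\<^sub>R E z"
          by (simp add: E_def diag_mat_def mat_def vec_eq_iff)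
        then show ?thesis by (simp add: A_def matrix_add_mult matrix_add_ldistrib matrix_mult_scaleR U)
      qed
      have "1 \<le> s_min (A z)"
      proof (rule s_min_ge)
        fix v :: "real^'n"
        define x where "x = transpose U *v v"
        have nx: "norm x = norm v"
          unfolding x_def by (rule norm_orthogonal_mult(1)) (simp add: svd(1))
        have "(norm x)\<^sup>2 = (\<Sum>i\<in>UNIV. (x $ i)\<^sup>2)"
          by (simp add: norm_vec_def L2_set_def sum_nonneg)
        also have "\<dots> \<le> (\<Sum>i\<in>UNIV. ((1 + z $ i / real N) * x $ i)\<^sup>2)"
        proof (intro sum_mono)
          fix i
          have "1\<^sup>2 \<le> (1 + z $ i / real N)\<^sup>2" using z0[of i] N by (intro power_mono) auto
          then show "(x $ i)\<^sup>2 \<le> ((1 + z $ i / real N) * x $ i)\<^sup>2"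
            unfolding power_mult_distrib using mult_right_mono[of 1 _ "(x $ i)\<^sup>2"] by simp
        qed
        also have "\<dots> = (norm (diag_mat (\<lambda>i. 1 + z $ i / real N) *v x))\<^sup>2"
        proof -
          have "(diag_mat f *v x) $ i = f i * x $ i" for f i
            by (simp add: diag_mat_def matrix_vector_mult_def if_distrib[of "\<lambda>y. y * _"] cong: if_cong)
          then show ?thesis by (simp add: norm_vec_def L2_set_def sum_nonneg)
        qed
        finally have "norm x \<le> norm (diag_mat (\<lambda>i. 1 + z $ i / real N) *v x)" by (rule power2_le_imp_le) simp
        also have "\<dots> = norm (A z *v v)"
          unfolding AU x_def by (simp add: norm_orthogonal_mult(1)[OF svd(1)] flip: matrix_vector_mul_assoc)
        finally show "1 * norm v \<le> norm (A z *v v)"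
          by (simp add: nx)
      qed simp
      then show ?thesis by (simp add: class_C_def)
    qed
  qed auto
  then show "ennreal (d / (669/100 * (real N)\<^sup>2)) \<le> (SUP A\<in>class_C 1. risk2 B N Ahat A)"
    by (simp add: d_def mult.commute)
qed

text \<open>Since \<open>1 + 2 / d\<close> is \<open>(d + 2) / d\<close>, the comparison with
  \<open>minimax_critical\<close> is \<open>log_square_le\<close> multiplied by
  \<open>d\<close>.\<close>

lemma minimax_unit_root:
  fixes B :: "real^'n^'n"
  defines "d \<equiv> real CARD('n)"
  assumes B: "invertible B" and N: "0 < N"
  shows "ennreal ((ln (d + 2))\<^sup>2 / (3 * (real N)\<^sup>2 * (1 + 2 / d)\<^sup>2)) \<le> minimax_risk2 B N (class_C 1)"
proof -
  have d: "0 < d" by (simp add: d_def)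
  have "(1 + 2 / d)\<^sup>2 = (d + 2)\<^sup>2 / d\<^sup>2" using d by (simp add: field_simps flip: power_divide)
  then have "(ln (d + 2))\<^sup>2 / (3 * (real N)\<^sup>2 * (1 + 2 / d)\<^sup>2) = d\<^sup>2 * (ln (d + 2))\<^sup>2 / (3 * (d + 2)\<^sup>2) / (real N)\<^sup>2"
    by (simp add: mult_ac)
  also have "\<dots> \<le> d / (669/100) / (real N)\<^sup>2"
  proof (rule divide_right_mono)
    have "d * (669/100 * d * (ln (d + 2))\<^sup>2) \<le> d * (3 * (d + 2)\<^sup>2)"
      using log_square_le[OF d] d by (intro mult_left_mono) auto
    then show "d\<^sup>2 * (ln (d + 2))\<^sup>2 / (3 * (d + 2)\<^sup>2) \<le> d / (669/100)"
      using d by (simp add: pos_divide_le_eq pos_le_divide_eq power2_eq_square mult_ac)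
  qed simp
  finally have "(ln (d + 2))\<^sup>2 / (3 * (real N)\<^sup>2 * (1 + 2 / d)\<^sup>2) \<le> d / (669/100 * (real N)\<^sup>2)" by simp
  then show ?thesis using minimax_critical[OF B N] unfolding d_def by (meson ennreal_leI order_trans)
qed

theorem corollary4p1:
  fixes B :: "real^'n^'n" and N :: nat
  assumes "N \<ge> 2" and "invertible B"
  defines "d \<equiv> real CARD('n)"
  shows
    "(\<forall>s \<alpha>. 0 \<le> s \<and> s < 1 \<and> 0 < \<alpha> \<and> \<alpha> < 1 \<and>
        real N \<ge> 16 * (d + 2)\<^sup>2 / (\<alpha> * (1 - s)\<^sup>2) \<longrightarrow>
        minimax_risk2 B N (class_C s) \<ge>
          ennreal (d\<^sup>2 * (1 - (s + 1)\<^sup>2 / 4) / ((1 + \<alpha>) * real N))) \<and>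
     (\<forall>s \<alpha>. 1 < s \<and> 0 < \<alpha> \<and> \<alpha> < 1 \<and>
        real N \<ge> log 2 ((d + 2) / \<alpha>) + 3 \<longrightarrow>
        minimax_risk2 B N (class_C s) \<ge>
          ennreal (d\<^sup>2 * ((s + 1)\<^sup>2 - 1)\<^sup>2 / ((1 + \<alpha>) * (s + 1) ^ (2 * N)))) \<and>
     minimax_risk2 B N (class_C 1) \<ge>
       ennreal ((ln (d + 2))\<^sup>2 / (3 * (real N)\<^sup>2 * (1 + 2 / d)\<^sup>2))"
proof (intro conjI allI impI)
  have N: "0 < N" using assms(1) by simp
  fix s \<alpha> :: real
  show "ennreal (d\<^sup>2 * (1 - (s + 1)\<^sup>2 / 4) / ((1 + \<alpha>) * real N)) \<le> minimax_risk2 B N (class_C s)"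
    if "0 \<le> s \<and> s < 1 \<and> 0 < \<alpha> \<and> \<alpha> < 1 \<and> 16 * (d + 2)\<^sup>2 / (\<alpha> * (1 - s)\<^sup>2) \<le> real N"
    using that minimax_stable[OF assms(2) N] unfolding d_def by blast
  show "ennreal (d\<^sup>2 * ((s + 1)\<^sup>2 - 1)\<^sup>2 / ((1 + \<alpha>) * (s + 1) ^ (2 * N))) \<le> minimax_risk2 B N (class_C s)"
    if "1 < s \<and> 0 < \<alpha> \<and> \<alpha> < 1 \<and> log 2 ((d + 2) / \<alpha>) + 3 \<le> real N"
    using that minimax_explosive[OF assms(2)] unfolding d_def by blast
  show "ennreal ((ln (d + 2))\<^sup>2 / (3 * (real N)\<^sup>2 * (1 + 2 / d)\<^sup>2)) \<le> minimax_risk2 B N (class_C 1)"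
    unfolding d_def by (rule minimax_unit_root[OF assms(2) N])
qed

end
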